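(* For every $\alpha>0$ and $\kappa>1$ there exist a constant $C_0>0$ depending only on $\alpha$ and $\kappa$, and a constant $\varepsilon<1$ depending only on $\kappa$, with the following property. Let $\xi>0$ and let $(x_i,r_i)_{i\in I}$ be a particle configuration satisfying $d_i/2>\kappa r_i$ and $r_i\le\alpha\xi$ for all $i\in I$, and such that $\mu_0:=\sup_{i\in I} r_i d_i^{-3}$ satisfies $$\mu_0<C_0\,\xi^{-2}.$$ Let $f\in H^{-1}(\mathbb{R}^3)$ and let $(\Phi_k)_{k\ge 0}$ be the terms produced by the Method of Reflections for the operator $-\Delta+\xi^{-2}$ with zero Dirichlet data on the particles. Then $\sum_{k=0}^\infty\Phi_k$ converges in $H^1(\mathbb{R}^3\setminus K)$ to the unique solution $u$ of $$-\Delta u+\xi^{-2}u=f\ \text{ in }\mathbb{R}^3\setminus K,\qquad u=0\ \text{ in }K.$$ Moreover, for all $N$, $$\Big\|\sum_{k=0}^N\Phi_k-u\Big\|_{H^1(\mathbb{R}^3\setminus K)}\le C\,\varepsilon^N\,\|f\|_{H^{-1}(\mathbb{R}^3)},$$ where $C$ depends only on $\xi$. In particular, for fixed $\xi$, $\alpha$ and $\kappa$, the convergence is uniform in all particle configurations satisfying $d_i/2>\kappa r_i$ and $r_i\le\alpha\xi$ for all $i\in I$ and $\sup_{i\in I} r_i d_i^{-3}<C_0\,\xi^{-2}$.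
   Context: Particle configuration: $I$ is a finite or countable index set; $x_i\in\mathbb{R}^3$ are centers, $r_i>0$ radii, $B_i:=B_{r_i}(x_i)$, $K:=\bigcup_{i\in I}\overline{B_i}$, and $d_i:=\inf_{j\ne i}|x_i-x_j|$. Solution: $u\in H^1(\mathbb{R}^3)$ with $u=0$ in $K$ and $\int\nabla u\cdot\nabla v+\xi^{-2}\int uv=\langle f,v\rangle$ for all $v\in H^1(\mathbb{R}^3)$ with $v=0$ in $K$. For $w\in H^1(\mathbb{R}^3)$ let $Q_iw\in H^1(\mathbb{R}^3)$ be the unique function with $Q_iw=w$ in $\overline{B_i}$ and $-\Delta Q_iw+\xi^{-2}Q_iw=0$ in $\mathbb{R}^3\setminus\overline{B_i}$. Method of Reflections: $\Phi_0\in H^1(\mathbb{R}^3)$ solves $-\Delta\Phi_0+\xi^{-2}\Phi_0=f$ in $\mathbb{R}^3$. For each $i\in I$, $\Phi_{1,i}:=-Q_i\Phi_0$, and for $k\ge2$, $\Phi_{k,i}:=-Q_i\big(\sum_{j\ne i}\Phi_{k-1,j}\big)$ (i.e. $\Phi_{k,i}$ solves the homogeneous equation outside $B_i$ with boundary value $-\sum_{j\neq i}\Phi_{k-1,j}$ on $\partial B_i$). Finally $\Phi_k:=\sum_{i\in I}\Phi_{k,i}$ for $k\ge1$ (series in $H^1(\mathbb{R}^3)$). *)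

theory Defs
  imports "HOL-Analysis.Analysis"
begin

section \<open>The Sobolev space $H^1(\mathbf{R}^3)$ and its dual\<close>

type_synonym R3 = "real ^ 3"

text \<open>Elements of $L^2$ and $H^1$ are represented by Borel functions; two functions that agree
  almost everywhere represent the same element.\<close>

text \<open>\<open>smooth \<phi>\<close>: all iterated directional derivatives of \<open>\<phi>\<close> exist everywhere and
  are (Frechet) differentiable, hence continuous; that is, \<open>\<phi>\<close> is infinitely differentiable.
  The predicate has to be the greatest fixed point, as the rule has no base case.\<close>

coinductive smooth :: "(R3 \<Rightarrow> real) \<Rightarrow> bool" where
  smoothI: "\<lbrakk>\<And>x. \<phi> differentiable (at x);
             \<And>v. smooth (\<lambda>x. frechet_derivative \<phi> (at x) v)\<rbrakk> \<Longrightarrow> smooth \<phi>"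

definition test_functions :: "(R3 \<Rightarrow> real) set" where
  "test_functions = {\<phi>. smooth \<phi> \<and> compact (closure {x. \<phi> x \<noteq> 0})}"

definition L2 :: "(R3 \<Rightarrow> 'b::euclidean_space) set" where
  "L2 = {u. u \<in> borel_measurable lborel \<and> integrable lborel (\<lambda>x. (norm (u x))\<^sup>2)}"

definition weak_gradient :: "(R3 \<Rightarrow> real) \<Rightarrow> (R3 \<Rightarrow> R3) \<Rightarrow> bool" where
  "weak_gradient u g \<longleftrightarrow>
     (\<forall>\<phi>\<in>test_functions. \<forall>i.
        (LINT x|lborel. u x * frechet_derivative \<phi> (at x) (axis i 1)) =
        - (LINT x|lborel. g x $ i * \<phi> x))"

definition H1 :: "(R3 \<Rightarrow> real) set" where
  "H1 = {u \<in> L2. \<exists>g\<in>L2. weak_gradient u g}"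

text \<open>The weak gradient is determined up to a null set, so that the choice below is immaterial.\<close>

definition wgrad :: "(R3 \<Rightarrow> real) \<Rightarrow> R3 \<Rightarrow> R3" where
  "wgrad u = (SOME g. g \<in> L2 \<and> weak_gradient u g)"

text \<open>The $H^1(S)$ norm of the restriction to \<open>S\<close> of an element of $H^1(\mathbf{R}^3)$.\<close>

definition H1_norm_on :: "R3 set \<Rightarrow> (R3 \<Rightarrow> real) \<Rightarrow> real" where
  "H1_norm_on S u = sqrt (LINT x:S|lborel. (u x)\<^sup>2 + (norm (wgrad u x))\<^sup>2)"

abbreviation H1_norm :: "(R3 \<Rightarrow> real) \<Rightarrow> real" where
  "H1_norm \<equiv> H1_norm_on UNIV"

text \<open>Unconditional convergence of a series in $H^1(\mathbf{R}^3)$, as in the library's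
  \<open>has_sum\<close>.\<close>

definition H1_has_sum :: "('i \<Rightarrow> R3 \<Rightarrow> real) \<Rightarrow> 'i set \<Rightarrow> (R3 \<Rightarrow> real) \<Rightarrow> bool" where
  "H1_has_sum F J s \<longleftrightarrow>
     (\<forall>j\<in>J. F j \<in> H1) \<and> s \<in> H1 \<and>
     ((\<lambda>A. H1_norm (\<lambda>y. (\<Sum>j\<in>A. F j y) - s y)) \<longlongrightarrow> 0) (finite_subsets_at_top J)"

text \<open>$H^{-1}(\mathbf{R}^3)$ as the dual of $H^1(\mathbf{R}^3)$. Only the values on \<open>H1\<close>
  matter. Boundedness makes \<open>f\<close> insensitive to changes of its argument on null sets.\<close>

definition H_minus1 :: "((R3 \<Rightarrow> real) \<Rightarrow> real) set" where
  "H_minus1 = {f. (\<forall>u\<in>H1. \<forall>v\<in>H1. f (\<lambda>x. u x + v x) = f u + f v) \<and>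
                  (\<forall>c. \<forall>u\<in>H1. f (\<lambda>x. c * u x) = c * f u) \<and>
                  (\<exists>B. \<forall>u\<in>H1. \<bar>f u\<bar> \<le> B * H1_norm u)}"

definition H_minus1_norm :: "((R3 \<Rightarrow> real) \<Rightarrow> real) \<Rightarrow> real" where
  "H_minus1_norm f = Sup {\<bar>f v\<bar> | v. v \<in> H1 \<and> H1_norm v \<le> 1}"


section \<open>Weak solutions of the screened Poisson equation\<close>

definition eq_on :: "R3 set \<Rightarrow> (R3 \<Rightarrow> real) \<Rightarrow> (R3 \<Rightarrow> real) \<Rightarrow> bool" where
  "eq_on A u w \<longleftrightarrow> (AE y in lborel. y \<in> A \<longrightarrow> u y = w y)"

text \<open>\<open>weak_solution \<xi> A f u\<close>: \<open>u\<close> is an element of $H^1(\mathbf{R}^3)$ with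
  $-\Delta u + \xi^{-2} u = f$ in the complement of \<open>A\<close>, tested against all elements of
  $H^1(\mathbf{R}^3)$ that vanish in \<open>A\<close>.\<close>

definition weak_solution ::
    "real \<Rightarrow> R3 set \<Rightarrow> ((R3 \<Rightarrow> real) \<Rightarrow> real) \<Rightarrow> (R3 \<Rightarrow> real) \<Rightarrow> bool" where
  "weak_solution \<xi> A f u \<longleftrightarrow>
     u \<in> H1 \<and>
     (\<forall>v\<in>H1. eq_on A v (\<lambda>_. 0) \<longrightarrow>
        (LINT y|lborel. wgrad u y \<bullet> wgrad v y) + (1 / \<xi>\<^sup>2) * (LINT y|lborel. u y * v y) = f v)"

definition dirichlet_solution ::
    "real \<Rightarrow> R3 set \<Rightarrow> ((R3 \<Rightarrow> real) \<Rightarrow> real) \<Rightarrow> (R3 \<Rightarrow> real) \<Rightarrow> bool" where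
  "dirichlet_solution \<xi> K f u \<longleftrightarrow> weak_solution \<xi> K f u \<and> eq_on K u (\<lambda>_. 0)"

text \<open>\<open>is_Q \<xi> c \<rho> w q\<close>: \<open>q\<close> represents $Q w$ for the particle with center \<open>c\<close> and
  radius \<open>\<rho>\<close>.\<close>

definition is_Q ::
    "real \<Rightarrow> R3 \<Rightarrow> real \<Rightarrow> (R3 \<Rightarrow> real) \<Rightarrow> (R3 \<Rightarrow> real) \<Rightarrow> bool" where
  "is_Q \<xi> c \<rho> w q \<longleftrightarrow> weak_solution \<xi> (cball c \<rho>) (\<lambda>_. 0) q \<and> eq_on (cball c \<rho>) q w"


section \<open>Particle configurations\<close>

text \<open>The index set of a configuration is an arbitrary subset of the natural numbers, finite or
  infinite (possibly empty); this covers every countable index set.\<close>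

definition particles :: "nat set \<Rightarrow> (nat \<Rightarrow> R3) \<Rightarrow> (nat \<Rightarrow> real) \<Rightarrow> R3 set" where
  "particles I x r = (\<Union>i\<in>I. cball (x i) (r i))"

text \<open>\<open>ennreal\<close> makes the distance infinite, and hence $r_i d_i^{-3} = 0$, if there is only
  one particle, and makes the supremum in \<open>mu0\<close> meaningful if it is infinite or empty.\<close>

definition nearest_dist :: "nat set \<Rightarrow> (nat \<Rightarrow> R3) \<Rightarrow> nat \<Rightarrow> ennreal" where
  "nearest_dist I x i = (INF j\<in>I - {i}. ennreal (dist (x i) (x j)))"

definition mu0 :: "nat set \<Rightarrow> (nat \<Rightarrow> R3) \<Rightarrow> (nat \<Rightarrow> real) \<Rightarrow> ennreal" where
  "mu0 I x r = (SUP i\<in>I. ennreal (r i) / (nearest_dist I x i) ^ 3)"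

definition admissible ::
    "real \<Rightarrow> real \<Rightarrow> real \<Rightarrow> real \<Rightarrow> nat set \<Rightarrow> (nat \<Rightarrow> R3) \<Rightarrow> (nat \<Rightarrow> real) \<Rightarrow> bool" where
  "admissible \<alpha> \<kappa> C0 \<xi> I x r \<longleftrightarrow>
     (\<forall>i\<in>I. 0 < r i \<and> ennreal (\<kappa> * r i) < nearest_dist I x i / 2 \<and> r i \<le> \<alpha> * \<xi>) \<and>
     mu0 I x r < ennreal (C0 * (1 / \<xi>\<^sup>2))"


section \<open>The Method of Reflections\<close>

text \<open>\<open>\<Psi> k i\<close> is the term $\Phi_{k,i}$, used for \<open>k \<ge> 1\<close> and \<open>i \<in> I\<close> only. All terms
  are determined up to null sets. The equation $\Phi_{k,i} = -Q_i w$ is stated as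
  $-\Phi_{k,i} = Q_i w$.\<close>

definition method_of_reflections ::
    "real \<Rightarrow> ((R3 \<Rightarrow> real) \<Rightarrow> real) \<Rightarrow> nat set \<Rightarrow> (nat \<Rightarrow> R3) \<Rightarrow> (nat \<Rightarrow> real) \<Rightarrow>
     (nat \<Rightarrow> nat \<Rightarrow> R3 \<Rightarrow> real) \<Rightarrow> (nat \<Rightarrow> R3 \<Rightarrow> real) \<Rightarrow> bool" where
  "method_of_reflections \<xi> f I x r \<Psi> \<Phi> \<longleftrightarrow>
     weak_solution \<xi> {} f (\<Phi> 0) \<and>
     (\<forall>i\<in>I. is_Q \<xi> (x i) (r i) (\<Phi> 0) (\<lambda>y. - \<Psi> 1 i y)) \<and>
     (\<forall>k\<ge>2. \<forall>i\<in>I. \<exists>s. H1_has_sum (\<Psi> (k - 1)) (I - {i}) s \<and>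
                         is_Q \<xi> (x i) (r i) s (\<lambda>y. - \<Psi> k i y)) \<and>
     (\<forall>k\<ge>1. H1_has_sum (\<Psi> k) I (\<Phi> k))"

end

theory Submission
  imports Defs
begin

text \<open>Equip $H^1(\mathbf{R}^3)$ with the inner product
  $\int \nabla u \cdot \nabla v + \xi^{-2} \int u v$. Then $Q_i$ is the orthogonal projection onto the
  complement of $V_i = \{v : v = 0 \mbox{ in } B_i\}$, the solution $u$ is the projection of $\Phi_0$
  onto $\bigcap_i V_i$, and the partial sums satisfy
  $\sum_{k \le N} \Phi_k - u = (1 - L)^N (\Phi_0 - u)$ with $L = \sum_i Q_i$.

  Both bounds that make $1 - L$ a contraction on the complement of $\bigcap_i V_i$ follow from one local
  estimate: a logarithmic cutoff $\eta_i$ with $\eta_i = 1$ in $B_i$, supported in a fixed multiple of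
  $B_i$, satisfies $\|\eta_i w\|^2 \le \frac{25}{16} E_i(w)$, where $E_i(w)$ is the energy of $w$ in
  $B_{d_i/2}(x_i)$; this is a local Hardy inequality. As these balls are disjoint and $\|Q_i w\|$ is the
  minimal norm among functions equal to $w$ in $B_i$, summation gives
  $\sum_i \|Q_i w\|^2 \le \frac{25}{16} \|w\|^2$. Conversely, for $w$ orthogonal to $\bigcap_i V_i$ the
  competitor $\sum_i \eta_i Q_i w$ gives $\|w\|^2 \le \frac{25}{16} \sum_i \|Q_i w\|^2$.
  Smallness of $\mu_0$ is used only to fit the support of $\eta_i$ into $B_{d_i/2}(x_i)$ and to
  control the lower-order term of the Hardy inequality.\<close>


section \<open>Projections in Hilbert spaces and the method of reflections\<close>

text \<open>The overview leaves open why the constant is \<open>25/16\<close>. With a common bound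
  \<open>b\<close> in both estimates, one step of \<open>1 - L\<close> multiplies the squared error
  by at most \<open>2 - 2/b\<close>, so an unspecified constant is useless: \<open>b\<close> has to
  be below 2. A cutoff falling linearly over a fixed multiple of the radius has a fixed gradient
  cost. A profile linear in the logarithm of the radius has gradient \<open>slope / s\<close>, so
  its squared cost is \<open>slope^2\<close> times the Hardy weight \<open>1 / s^2\<close>, and a
  small slope makes it as small as desired, at the price of a large ratio of radii. Slope
  \<open>1/16\<close> means ratio \<open>exp 16\<close>; with the Hardy constant 16 and Young
  weights \<open>5/4\<close> and \<open>5\<close> the total is
  \<open>5/4 + 5 * 16 / 256 = 25/16\<close>. Cutoff and Hardy field are only Lipschitz, which shapes
  the treatment of weak derivatives: they are characterized by difference quotients that converge
  weakly in L2, and product rule and integration by parts follow without smoothing any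
  factor.\<close>

lemma parallelogram_law:
  fixes a b :: "'a::real_inner"
  shows "(norm (a + b))\<^sup>2 + (norm (a - b))\<^sup>2 = 2 * (norm a)\<^sup>2 + 2 * (norm b)\<^sup>2"
  by (simp add: power2_norm_eq_inner inner_simps inner_commute)

text \<open>A minimizing sequence is Cauchy: the midpoint of two members lies in \<open>S\<close>,
  hence at distance at least \<open>d\<close>, and the parallelogram law turns near-minimality of
  both into closeness to each other.\<close>

lemma closed_subspace_nearest_point:
  fixes S :: "'a::{real_inner,banach} set"
  assumes "subspace S" "closed S"
  obtains p where "p \<in> S" "\<And>s. s \<in> S \<Longrightarrow> norm (x - p) \<le> norm (x - s)"
proof -
  define d where "d = infdist x S"
  have ne: "S \<noteq> {}" using subspace_0[OF assms(1)] by auto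
  have le: "d \<le> norm (x - s)" if "s \<in> S" for s
    using that infdist_le[of s S x] by (simp add: d_def dist_norm)
  have d0: "0 \<le> d" by (simp add: d_def infdist_nonneg)
  have "\<exists>s\<in>S. norm (x - s) < d + 1 / real (Suc n)" for n
  proof (rule ccontr)
    assume "\<not> ?thesis"
    then have "d + 1 / real (Suc n) \<le> dist x s" if "s \<in> S" for s
      using that by (auto simp: dist_norm not_less)
    then have "d + 1 / real (Suc n) \<le> (INF s\<in>S. dist x s)"
      using ne by (intro cINF_greatest) auto
    then have "d + 1 / real (Suc n) \<le> d" using ne by (simp add: d_def infdist_def)
    then show False by simp
  qed
  then obtain s where s: "\<And>n. s n \<in> S" "\<And>n. norm (x - s n) < d + 1 / real (Suc n)"
    by metis
  have lim: "(\<lambda>n. norm (x - s n)) \<longlonglongrightarrow> d"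
  proof (rule real_tendsto_sandwich[OF _ _ tendsto_const])
    show "(\<lambda>n. d + 1 / real (Suc n)) \<longlonglongrightarrow> d"
      using tendsto_add[OF tendsto_const LIMSEQ_Suc[OF lim_1_over_n]] by fastforce
    show "\<forall>\<^sub>F n in sequentially. norm (x - s n) \<le> d + 1 / real (Suc n)"
      using s(2) by (intro always_eventually allI less_imp_le)
  qed (auto intro!: le s always_eventually)
  have key: "(norm (s m - s n))\<^sup>2 \<le> 2 * (norm (x - s m))\<^sup>2 + 2 * (norm (x - s n))\<^sup>2 - 4 * d\<^sup>2" for m n
  proof -
    have "(1/2) *\<^sub>R (s m + s n) \<in> S"
      using s(1) assms(1) by (simp add: subspace_add subspace_scale)
    then have "d \<le> norm (x - (1/2) *\<^sub>R (s m + s n))" by (rule le)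
    also have "x - (1/2) *\<^sub>R (s m + s n) = (1/2) *\<^sub>R ((x - s m) + (x - s n))"
      by (simp add: algebra_simps flip: scaleR_add_left)
    finally have "2 * d \<le> norm ((x - s m) + (x - s n))" by simp
    then have "4 * d\<^sup>2 \<le> (norm ((x - s m) + (x - s n)))\<^sup>2"
      using d0 power_mono[of "2*d" _ 2] by (simp add: power_mult_distrib)
    with parallelogram_law[of "x - s m" "x - s n"] show ?thesis
      by (simp add: norm_minus_commute)
  qed
  have "Cauchy s"
  proof (rule metric_CauchyI)
    fix e :: real assume e: "0 < e"
    have "(\<lambda>n. (norm (x - s n))\<^sup>2) \<longlonglongrightarrow> d\<^sup>2" using lim by (intro tendsto_intros)
    then obtain M where M: "\<And>n. n \<ge> M \<Longrightarrow> \<bar>(norm (x - s n))\<^sup>2 - d\<^sup>2\<bar> < e\<^sup>2 / 4"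
      using e unfolding LIMSEQ_iff by (metis divide_pos_pos real_norm_def zero_less_numeral zero_less_power)
    have "dist (s m) (s n) < e" if "m \<ge> M" "n \<ge> M" for m n
    proof -
      have "(norm (s m - s n))\<^sup>2 < e\<^sup>2"
        using key[of m n] M[OF that(1)] M[OF that(2)] by linarith
      then show ?thesis using e by (simp add: dist_norm power2_less_imp_less)
    qed
    then show "\<exists>M. \<forall>m\<ge>M. \<forall>n\<ge>M. dist (s m) (s n) < e" by blast
  qed
  then obtain p where p: "s \<longlonglongrightarrow> p" using Cauchy_convergent convergent_def by blast
  have "p \<in> S" using assms(2) s(1) p closed_sequentially by blast
  moreover have "norm (x - p) = d"
    using LIMSEQ_unique[OF lim] tendsto_norm[OF tendsto_diff[OF tendsto_const p]] by metis
  ultimately show ?thesis using le that by auto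
qed

lemma nearest_point_orthogonal:
  fixes x p s :: "'a::real_inner"
  assumes "\<And>t. norm (x - p) \<le> norm (x - (p + t *\<^sub>R s))"
  shows "(x - p) \<bullet> s = 0"
proof (cases "s = 0")
  case False
  \<comment> \<open>This \<open>t\<close> minimizes the quadratic \<open>|(x - p) - t s|^2\<close>;
    a nonzero inner product would push the minimum below the value at 0.\<close>
  define t where "t = ((x - p) \<bullet> s) / (s \<bullet> s)"
  have ss: "s \<bullet> s > 0" using False by simp
  have "(norm (x - p))\<^sup>2 \<le> (norm ((x - p) - t *\<^sub>R s))\<^sup>2"
    using assms[of t] by (simp add: diff_diff_eq)
  also have "\<dots> = (norm (x - p))\<^sup>2 - ((x - p) \<bullet> s)\<^sup>2 / (s \<bullet> s)"
    unfolding power2_norm_eq_inner inner_diff_left inner_diff_right inner_scaleR_left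
      inner_scaleR_right t_def using ss
    by (simp add: inner_commute field_simps power2_eq_square)
  finally have "((x - p) \<bullet> s)\<^sup>2 \<le> 0"
    using ss by (simp add: divide_le_0_iff)
  then show ?thesis by simp
qed simp

text \<open>Characterized by orthogonality instead of minimal distance, because weak equations are
  orthogonality statements.\<close>

definition proj :: "'a::real_inner set \<Rightarrow> 'a \<Rightarrow> 'a" where
  "proj S x = (SOME p. p \<in> S \<and> (\<forall>s\<in>S. (x - p) \<bullet> s = 0))"

context
  fixes S :: "'a::{real_inner,banach} set"
  assumes S: "subspace S" "closed S"
begin

lemma proj_props: "proj S x \<in> S \<and> (\<forall>s\<in>S. (x - proj S x) \<bullet> s = 0)"
proof -
  obtain p where p: "p \<in> S" "\<And>s. s \<in> S \<Longrightarrow> norm (x - p) \<le> norm (x - s)"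
    using closed_subspace_nearest_point[OF S] by blast
  have "(x - p) \<bullet> s = 0" if "s \<in> S" for s
    using p that S(1) by (intro nearest_point_orthogonal p(2)) (simp add: subspace_add subspace_scale)
  with p(1) show ?thesis unfolding proj_def by (intro someI) auto
qed

lemma proj_in: "proj S x \<in> S"
  and proj_orth: "s \<in> S \<Longrightarrow> (x - proj S x) \<bullet> s = 0"
  using proj_props by auto

lemma proj_unique:
  assumes "p \<in> S" "\<And>s. s \<in> S \<Longrightarrow> (x - p) \<bullet> s = 0"
  shows "proj S x = p"
proof -
  have mem: "proj S x - p \<in> S" using assms(1) proj_in S(1) by (simp add: subspace_diff)
  have "(proj S x - p) \<bullet> (proj S x - p) = (x - p) \<bullet> (proj S x - p) - (x - proj S x) \<bullet> (proj S x - p)"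
    by (simp add: inner_diff_left)
  also have "\<dots> = 0" using mem assms(2) proj_orth by simp
  finally show ?thesis by simp
qed

text \<open>Dirichlet principle: the residual \<open>x - proj S x\<close> is orthogonal to
  \<open>S\<close> and differs from \<open>y\<close> by an element of \<open>S\<close>, so it is the
  shortest element of its coset. This lets an explicit competitor bound a reflection.\<close>

lemma norm_diff_proj_le:
  assumes "x - y \<in> S"
  shows "norm (x - proj S x) \<le> norm y"
proof -
  have "y - (x - proj S x) \<in> S"
    using subspace_diff[OF S(1) proj_in assms] by (simp add: algebra_simps)
  then have "(x - proj S x) \<bullet> (y - (x - proj S x)) = 0" by (rule proj_orth)
  then have "(norm (x - proj S x))\<^sup>2 = (x - proj S x) \<bullet> y"
    by (simp add: inner_diff_right power2_norm_eq_inner)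
  also have "\<dots> \<le> norm (x - proj S x) * norm y" by (rule norm_cauchy_schwarz)
  finally show ?thesis
    by (metis mult_le_cancel_left_pos norm_ge_zero order.order_iff_strict power2_eq_square)
qed

end

text \<open>Everything is relative to a closed subspace because the functional lives only on the
  copy of H1 inside L2. The kernel has codimension at most one, so the component orthogonal to it of
  any \<open>x0\<close> with \<open>f x0 \<noteq> 0\<close> represents \<open>f\<close> up to
  scale.\<close>

lemma riesz_representation:
  fixes S :: "'a::{real_inner,banach} set" and f :: "'a \<Rightarrow> real"
  assumes S: "subspace S" "closed S"
    and add: "\<And>x y. x \<in> S \<Longrightarrow> y \<in> S \<Longrightarrow> f (x + y) = f x + f y"
    and scale: "\<And>c x. x \<in> S \<Longrightarrow> f (c *\<^sub>R x) = c * f x"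
    and bdd: "\<And>x. x \<in> S \<Longrightarrow> \<bar>f x\<bar> \<le> B * norm x"
  obtains a where "a \<in> S" "\<And>x. x \<in> S \<Longrightarrow> f x = a \<bullet> x"
proof -
  define N where "N = {x\<in>S. f x = 0}"
  have f0: "f 0 = 0" using scale[OF subspace_0[OF S(1)], of 0] by simp
  have diff: "f (x - y) = f x - f y" if "x \<in> S" "y \<in> S" for x y
    using add[of x "- 1 *\<^sub>R y"] scale[of y "-1"] that S(1) by (simp add: subspace_neg)
  have subN: "subspace N"
    using S(1) f0 add scale unfolding N_def subspace_def by auto
  have "closed N"
    unfolding closed_sequential_limits
  proof (intro allI impI, elim conjE)
    fix x l assume x: "\<forall>n. x n \<in> N" and l: "x \<longlonglongrightarrow> l"
    have lS: "l \<in> S" using x l S(2) closed_sequentially[of S x l] unfolding N_def by auto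
    have "(\<lambda>n. B * norm (l - x n)) \<longlonglongrightarrow> B * norm (l - l)" by (intro tendsto_intros l)
    moreover have "\<bar>f l\<bar> \<le> B * norm (l - x n)" for n
      using bdd[of "l - x n"] diff[of l "x n"] lS x S(1) by (simp add: N_def subspace_diff)
    ultimately have "\<bar>f l\<bar> \<le> 0"
      using LIMSEQ_le_const[of "\<lambda>n. B * norm (l - x n)" 0 "\<bar>f l\<bar>"] by auto
    then show "l \<in> N" using lS by (simp add: N_def)
  qed
  note N = subN this
  show ?thesis
  proof (cases "\<forall>x\<in>S. f x = 0")
    case True
    then show ?thesis using that[of 0] S(1) by (simp add: subspace_0)
  next
    case False
    then obtain x0 where x0: "x0 \<in> S" "f x0 \<noteq> 0" by auto
    have p: "proj N x0 \<in> N" "\<And>s. s \<in> N \<Longrightarrow> (x0 - proj N x0) \<bullet> s = 0"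
      using proj_in[OF N] proj_orth[OF N] by blast+
    define z where "z = x0 - proj N x0"
    have zS: "z \<in> S" using x0 p(1) S(1) by (simp add: z_def N_def subspace_diff)
    have fz: "f z = f x0" using diff[of x0 "proj N x0"] x0 p(1) by (simp add: z_def N_def)
    have zz: "z \<bullet> z > 0" using fz x0 f0 by (metis inner_gt_zero_iff)
    show ?thesis
    proof (rule that[of "(f z / (z \<bullet> z)) *\<^sub>R z"])
      show "(f z / (z \<bullet> z)) *\<^sub>R z \<in> S" using zS S(1) by (simp add: subspace_scale)
      fix x assume x: "x \<in> S"
      have "x - (f x / f z) *\<^sub>R z \<in> N"
        using x zS S(1) fz x0 by (simp add: N_def diff scale subspace_diff subspace_scale)
      then have "z \<bullet> (x - (f x / f z) *\<^sub>R z) = 0" using p(2) by (simp add: z_def)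
      then have "z \<bullet> x = (f x / f z) * (z \<bullet> z)" by (simp add: inner_diff_right)
      then show "f x = ((f z / (z \<bullet> z)) *\<^sub>R z) \<bullet> x" using zz fz x0 by simp
    qed
  qed
qed

lemma cauchy_schwarz_sum:
  fixes u v :: "'i \<Rightarrow> 'a::real_inner"
  shows "(\<Sum>i\<in>J. u i \<bullet> v i) \<le> sqrt (\<Sum>i\<in>J. (norm (u i))\<^sup>2) * sqrt (\<Sum>i\<in>J. (norm (v i))\<^sup>2)"
proof -
  have "(\<Sum>i\<in>J. u i \<bullet> v i) \<le> (\<Sum>i\<in>J. \<bar>norm (u i)\<bar> * \<bar>norm (v i)\<bar>)"
    by (intro sum_mono) (simp add: norm_cauchy_schwarz)
  also have "\<dots> \<le> L2_set (\<lambda>i. norm (u i)) J * L2_set (\<lambda>i. norm (v i)) J"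
    by (rule L2_set_mult_ineq)
  finally show ?thesis by (simp add: L2_set_def)
qed

text \<open>A substitute for orthogonality of the terms: tails of the nonnegative series
  \<open>q\<close> control every finite sum taken outside a large finite set, which is the Cauchy
  criterion for the net of finite partial sums.\<close>

lemma summable_on_square_bound:
  fixes a :: "'i \<Rightarrow> 'a::banach" and q :: "'i \<Rightarrow> real"
  assumes q: "q summable_on I" and q0: "\<And>i. i \<in> I \<Longrightarrow> 0 \<le> q i" and C: "0 \<le> C"
    and bound: "\<And>J. finite J \<Longrightarrow> J \<subseteq> I \<Longrightarrow> (norm (\<Sum>i\<in>J. a i))\<^sup>2 \<le> C * (\<Sum>i\<in>J. q i)"
  shows "a summable_on I" and "(norm (\<Sum>\<^sub>\<infinity>i\<in>I. a i))\<^sup>2 \<le> C * (\<Sum>\<^sub>\<infinity>i\<in>I. q i)"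
proof -
  let ?S = "\<Sum>\<^sub>\<infinity>i\<in>I. q i"
  have small: "\<exists>X. finite X \<and> X \<subseteq> I \<and> (\<forall>Y. finite Y \<and> Y \<subseteq> I \<and> X \<inter> Y = {} \<longrightarrow> norm (sum a Y) < e)"
    if e: "e > 0" for e :: real
  proof -
    \<comment> \<open>The denominator \<open>C + 1\<close> keeps the threshold meaningful for
      \<open>C = 0\<close> and still gives \<open>C * sum q Y < e^2\<close>.\<close>
    have pos: "e\<^sup>2 / (C + 1) > 0" using e C by simp
    have "(sum q \<longlongrightarrow> ?S) (finite_subsets_at_top I)"
      using q unfolding summable_iff_has_sum_infsum has_sum_def .
    then have "\<forall>\<^sub>F X in finite_subsets_at_top I. ?S - e\<^sup>2 / (C + 1) < sum q X"
      using pos by (intro order_tendstoD(1)) auto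
    then obtain X where X: "finite X" "X \<subseteq> I" "?S - e\<^sup>2 / (C + 1) < sum q X"
      by (auto simp: eventually_finite_subsets_at_top)
    have "norm (sum a Y) < e" if Y: "finite Y" "Y \<subseteq> I" "X \<inter> Y = {}" for Y
    proof -
      have "sum q X + sum q Y = sum q (X \<union> Y)"
        using X Y by (intro sum.union_disjoint[symmetric]) auto
      also have "\<dots> \<le> ?S"
        using q X Y q0 by (intro finite_sum_le_infsum) auto
      finally have "sum q Y \<le> e\<^sup>2 / (C + 1)" using X(3) by simp
      then have "C * sum q Y \<le> C * (e\<^sup>2 / (C + 1))" using C by (rule mult_left_mono)
      also have "\<dots> < e\<^sup>2" using e C by (simp add: field_simps)
      finally have "(norm (\<Sum>i\<in>Y. a i))\<^sup>2 < e\<^sup>2" using bound[of Y] Y by simp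
      then show ?thesis using e by (simp add: power2_less_imp_less)
    qed
    then show ?thesis using X(1,2) by (intro exI[of _ X] conjI allI impI) auto
  qed
  show sa: "a summable_on I"
  proof -
    have "\<exists>P. eventually P (finite_subsets_at_top I) \<and>
        (\<forall>F G. P F \<and> P G \<longrightarrow> dist (sum a F) (sum a G) < e)" if e: "e > 0" for e :: real
    proof -
      obtain X where X: "finite X" "X \<subseteq> I"
        "\<forall>Y. finite Y \<and> Y \<subseteq> I \<and> X \<inter> Y = {} \<longrightarrow> norm (sum a Y) < e / 2"
        using small[OF half_gt_zero[OF e]] by (elim exE conjE) (rule that)
      have "dist (sum a F) (sum a G) < e"
        if F: "finite F" "F \<subseteq> I" "X \<subseteq> F" and G: "finite G" "G \<subseteq> I" "X \<subseteq> G" for F G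
      proof -
        \<comment> \<open>The common part cancels; what remains on either side is disjoint from
          \<open>X\<close>, as both sets contain it.\<close>
        have "sum a F = sum a (F \<inter> G) + sum a (F - G)" "sum a G = sum a (F \<inter> G) + sum a (G - F)"
          using F(1) G(1) by (metis sum.Int_Diff, metis sum.Int_Diff inf_commute)
        then have "dist (sum a F) (sum a G) = norm (sum a (F - G) - sum a (G - F))"
          by (simp add: dist_norm)
        also have "\<dots> \<le> norm (sum a (F - G)) + norm (sum a (G - F))" by (rule norm_triangle_ineq4)
        also have "\<dots> < e / 2 + e / 2"
          using F G by (intro add_strict_mono X(3)[rule_format]) auto
        finally show ?thesis by simp
      qed
      moreover have "\<forall>\<^sub>F F in finite_subsets_at_top I. finite F \<and> F \<subseteq> I \<and> X \<subseteq> F"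
        using X(1,2) by (auto simp: eventually_finite_subsets_at_top)
      ultimately show ?thesis
        by (intro exI[of _ "\<lambda>F. finite F \<and> F \<subseteq> I \<and> X \<subseteq> F"] conjI allI impI) simp_all
    qed
    then have "cauchy_filter (filtermap (sum a) (finite_subsets_at_top I))"
      by (simp add: cauchy_filter_metric_filtermap)
    moreover have "complete (UNIV :: 'a set)"
      by (meson Cauchy_convergent UNIV_I complete_def convergent_def)
    ultimately obtain l where "(sum a \<longlongrightarrow> l) (finite_subsets_at_top I)"
      using complete_uniform[where S=UNIV] by (force simp add: filterlim_def)
    then show ?thesis unfolding summable_on_def has_sum_def by blast
  qed
  have 1: "((\<lambda>J. (norm (sum a J))\<^sup>2) \<longlongrightarrow> (norm (\<Sum>\<^sub>\<infinity>i\<in>I. a i))\<^sup>2) (finite_subsets_at_top I)"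
    using sa[unfolded summable_iff_has_sum_infsum has_sum_def] by (intro tendsto_intros)
  show "(norm (\<Sum>\<^sub>\<infinity>i\<in>I. a i))\<^sup>2 \<le> C * (\<Sum>\<^sub>\<infinity>i\<in>I. q i)"
  proof (rule tendsto_upperbound[OF 1])
    show "\<forall>\<^sub>F J in finite_subsets_at_top I. (norm (sum a J))\<^sup>2 \<le> C * (\<Sum>\<^sub>\<infinity>i\<in>I. q i)"
    proof (rule eventually_finite_subsets_at_top_weakI)
      fix J assume J: "finite J" "J \<subseteq> I"
      have "sum q J \<le> (\<Sum>\<^sub>\<infinity>i\<in>I. q i)" using q J q0 by (intro finite_sum_le_infsum) auto
      then show "(norm (sum a J))\<^sup>2 \<le> C * (\<Sum>\<^sub>\<infinity>i\<in>I. q i)"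
        using bound[OF J] mult_left_mono[OF _ C] by (meson order_trans)
    qed
  qed simp
qed


lemma infsum_in_closed_subspace:
  fixes a :: "'i \<Rightarrow> 'a::banach"
  assumes "subspace S" "closed S" "a summable_on I" "\<And>i. i \<in> I \<Longrightarrow> a i \<in> S"
  shows "(\<Sum>\<^sub>\<infinity>i\<in>I. a i) \<in> S"
proof (rule Lim_in_closed_set[OF assms(2)])
  show "(sum a \<longlongrightarrow> (\<Sum>\<^sub>\<infinity>i\<in>I. a i)) (finite_subsets_at_top I)"
    using assms(3) unfolding summable_iff_has_sum_infsum has_sum_def .
  show "\<forall>\<^sub>F J in finite_subsets_at_top I. sum a J \<in> S"
    using assms(1,4) by (intro eventually_finite_subsets_at_top_weakI subspace_sum) auto
qed simp

text \<open>Each reflection sums over the other particles only; this reduces such a sum to the full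
  sum minus its own term.\<close>

lemma has_sum_remove:
  fixes \<psi> :: "'i \<Rightarrow> 'a::banach"
  assumes "i \<in> I" shows "(\<psi> has_sum s) (I - {i}) \<longleftrightarrow> (\<psi> has_sum (\<psi> i + s)) I"
proof
  assume "(\<psi> has_sum s) (I - {i})"
  then have "(\<psi> has_sum (\<psi> i + s)) (insert i (I - {i}))" by (intro has_sum_insert) auto
  then show "(\<psi> has_sum (\<psi> i + s)) I" using assms by (simp add: insert_absorb)
next
  assume *: "(\<psi> has_sum (\<psi> i + s)) I"
  then have "\<psi> summable_on I - {i}" by (meson Diff_subset summable_on_def summable_on_subset_banach)
  then obtain t where t: "(\<psi> has_sum t) (I - {i})" by (auto simp: summable_on_def)
  then have "(\<psi> has_sum (\<psi> i + t)) (insert i (I - {i}))" by (intro has_sum_insert) auto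
  then have "\<psi> i + t = \<psi> i + s" using * assms by (metis has_sum_unique insert_Diff)
  then show "(\<psi> has_sum s) (I - {i})" using t by simp
qed

text \<open>\<open>M\<close> is the Hilbert space, \<open>V i\<close> its elements vanishing on
  particle \<open>i\<close>, and \<open>Z i w\<close> a localized copy of \<open>w\<close>: it
  agrees with \<open>w\<close> on particle \<open>i\<close>, vanishes on the others, and copies at
  different particles are orthogonal. \<open>Z_bound\<close> serves twice: summed over particles in
  the upper estimate, and at a single index applied to \<open>Q i w\<close> in the coercivity
  estimate. The bound \<open>b < 2\<close> is what makes the iteration contract.\<close>

locale reflections =
  fixes M :: "'a::{real_inner,banach} set" and V :: "'i \<Rightarrow> 'a set" and I :: "'i set"
    and Z :: "'i \<Rightarrow> 'a \<Rightarrow> 'a" and b :: real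
  assumes M: "subspace M" "closed M"
    and V: "\<And>i. i \<in> I \<Longrightarrow> subspace (V i)" "\<And>i. i \<in> I \<Longrightarrow> closed (V i)"
      "\<And>i. i \<in> I \<Longrightarrow> V i \<subseteq> M"
    and b: "1 \<le> b" "b < 2"
    and Z_M: "\<And>i w. i \<in> I \<Longrightarrow> w \<in> M \<Longrightarrow> Z i w \<in> M"
    and Z_ext: "\<And>i w. i \<in> I \<Longrightarrow> w \<in> M \<Longrightarrow> w - Z i w \<in> V i"
    and Z_other: "\<And>i j w. i \<in> I \<Longrightarrow> j \<in> I \<Longrightarrow> i \<noteq> j \<Longrightarrow> w \<in> M \<Longrightarrow> Z i w \<in> V j"
    and Z_orth: "\<And>i j w w'. i \<in> I \<Longrightarrow> j \<in> I \<Longrightarrow> i \<noteq> j \<Longrightarrow> w \<in> M \<Longrightarrow> w' \<in> M \<Longrightarrow>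
      Z i w \<bullet> Z j w' = 0"
    and Z_bound: "\<And>J w. finite J \<Longrightarrow> J \<subseteq> I \<Longrightarrow> w \<in> M \<Longrightarrow>
      (\<Sum>i\<in>J. (norm (Z i w))\<^sup>2) \<le> b * (norm w)\<^sup>2"
begin

section \<open>Reflections as orthogonal projections, and their sum\<close>

definition Q :: "'i \<Rightarrow> 'a \<Rightarrow> 'a" where
  "Q i w = w - proj (V i) w"

text \<open>\<open>infsum\<close> is 0 by default if summability fails; \<open>L_has_sum\<close>
  rules this out on \<open>M\<close>.\<close>

definition L :: "'a \<Rightarrow> 'a" where
  "L w = (\<Sum>\<^sub>\<infinity>i\<in>I. Q i w)"

definition energy :: "'a \<Rightarrow> real" where
  "energy w = (\<Sum>\<^sub>\<infinity>i\<in>I. (norm (Q i w))\<^sup>2)"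

definition W :: "'a set" where
  "W = {w \<in> M. \<forall>i\<in>I. w \<in> V i}"

lemma Q_M: "i \<in> I \<Longrightarrow> w \<in> M \<Longrightarrow> Q i w \<in> M"
  unfolding Q_def using V proj_in M(1) by (meson subsetD subspace_diff)

lemma Q_orth: "i \<in> I \<Longrightarrow> v \<in> V i \<Longrightarrow> Q i w \<bullet> v = 0"
  unfolding Q_def using V proj_orth by blast

lemma Q_diff_V: "i \<in> I \<Longrightarrow> w - Q i w \<in> V i"
  unfolding Q_def using V by (simp add: proj_in)

text \<open>Self-adjointness and idempotence of \<open>Q i\<close> in one identity, from
  \<open>w' - Q i w'\<close> lying in \<open>V i\<close>.\<close>

lemma Q_inner_Q: "i \<in> I \<Longrightarrow> Q i w \<bullet> w' = Q i w \<bullet> Q i w'"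
  using Q_orth[OF _ Q_diff_V, of i w w'] by (simp add: inner_diff_right)

lemma Q_unique:
  assumes "i \<in> I" "w - q \<in> V i" "\<And>v. v \<in> V i \<Longrightarrow> q \<bullet> v = 0"
  shows "Q i w = q"
proof -
  have "proj (V i) w = w - q"
    using assms V by (intro proj_unique) auto
  then show ?thesis by (simp add: Q_def)
qed

lemma Q_add:
  assumes i: "i \<in> I" shows "Q i (x + y) = Q i x + Q i y"
proof (rule Q_unique[OF i])
  have "(x - Q i x) + (y - Q i y) \<in> V i"
    using i V(1) Q_diff_V subspace_add by blast
  then show "x + y - (Q i x + Q i y) \<in> V i" by (simp add: algebra_simps)
qed (simp add: i inner_add_left Q_orth)

lemma Q_diff:
  assumes i: "i \<in> I" shows "Q i (x - y) = Q i x - Q i y"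
  using Q_add[OF i, of "x - y" y] by simp

lemma Q_idem: "i \<in> I \<Longrightarrow> Q i (Q i x) = Q i x"
  using V(1) by (intro Q_unique) (auto simp: Q_orth subspace_0)

lemma Q_zero: "i \<in> I \<Longrightarrow> v \<in> V i \<Longrightarrow> Q i v = 0"
  by (rule Q_unique) auto

lemma Q_le_Z: "i \<in> I \<Longrightarrow> w \<in> M \<Longrightarrow> norm (Q i w) \<le> norm (Z i w)"
  unfolding Q_def using V Z_ext by (intro norm_diff_proj_le) auto

lemma Q_bound:
  assumes "finite J" "J \<subseteq> I" "w \<in> M"
  shows "(\<Sum>i\<in>J. (norm (Q i w))\<^sup>2) \<le> b * (norm w)\<^sup>2"
proof -
  have "(\<Sum>i\<in>J. (norm (Q i w))\<^sup>2) \<le> (\<Sum>i\<in>J. (norm (Z i w))\<^sup>2)"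
    using assms by (intro sum_mono power_mono Q_le_Z) auto
  then show ?thesis using Z_bound[OF assms] by simp
qed

lemma energy_summable:
  assumes "w \<in> M" shows "(\<lambda>i. (norm (Q i w))\<^sup>2) summable_on I"
  using Q_bound[OF _ _ assms]
  by (intro nonneg_bdd_above_summable_on bdd_aboveI[of _ "b * (norm w)\<^sup>2"]) auto

text \<open>Dual to \<open>Q_bound\<close>: summing reflections is adjoint to collecting them, so
  the same constant works. Concretely, the sum \<open>s\<close> is paired with itself, each
  \<open>Q i\<close> is moved onto \<open>s\<close>, and \<open>Q_bound\<close> is applied to
  \<open>s\<close> after Cauchy-Schwarz.\<close>

lemma Q_sum_bound:
  assumes J: "finite J" "J \<subseteq> I" and w: "w \<in> M"
  shows "(norm (\<Sum>i\<in>J. Q i w))\<^sup>2 \<le> b * (\<Sum>i\<in>J. (norm (Q i w))\<^sup>2)"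
proof -
  define s where "s = (\<Sum>i\<in>J. Q i w)"
  define e where "e = (\<Sum>i\<in>J. (norm (Q i w))\<^sup>2)"
  have sM: "s \<in> M" unfolding s_def using J w M(1) Q_M by (intro subspace_sum) auto
  have e0: "0 \<le> e" by (simp add: e_def sum_nonneg)
  then have be: "0 \<le> b * e" using b by simp
  have "(norm s)\<^sup>2 = (\<Sum>i\<in>J. Q i w \<bullet> s)"
    by (simp only: power2_norm_eq_inner inner_sum_left[symmetric] s_def[symmetric])
  also have "\<dots> = (\<Sum>i\<in>J. Q i w \<bullet> Q i s)"
    using J Q_inner_Q by (intro sum.cong) auto
  also have "\<dots> \<le> sqrt e * sqrt (\<Sum>i\<in>J. (norm (Q i s))\<^sup>2)"
    unfolding e_def by (rule cauchy_schwarz_sum)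
  also have "\<dots> \<le> sqrt e * sqrt (b * (norm s)\<^sup>2)"
    using Q_bound[OF J sM] e0 by (intro mult_left_mono) auto
  also have "\<dots> = sqrt (b * e) * norm s"
    by (simp add: real_sqrt_mult)
  finally have "norm s * norm s \<le> sqrt (b * e) * norm s" by (simp add: power2_eq_square)
  then have "norm s \<le> sqrt (b * e)"
    using be by (smt (verit) mult_right_le_imp_le norm_ge_zero real_sqrt_ge_zero)
  then have "(norm s)\<^sup>2 \<le> (sqrt (b * e))\<^sup>2" by (rule power_mono) (rule norm_ge_zero)
  then show ?thesis unfolding s_def[symmetric] e_def[symmetric] using be by (simp del: real_sqrt_le_iff)
qed

lemma L_has_sum:
  assumes "w \<in> M" shows "((\<lambda>i. Q i w) has_sum L w) I"
  unfolding L_def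
  using b by (intro has_sum_infsum
      summable_on_square_bound(1)[OF energy_summable[OF assms] _ _ Q_sum_bound[OF _ _ assms]]) auto

lemma L_bound: "w \<in> M \<Longrightarrow> (norm (L w))\<^sup>2 \<le> b * energy w"
  unfolding L_def energy_def
  using b by (intro summable_on_square_bound(2)[OF energy_summable _ _ Q_sum_bound]) auto

lemma L_inner:
  assumes "w \<in> M" shows "L w \<bullet> w = energy w"
proof -
  have "((\<lambda>i. Q i w \<bullet> w) has_sum (L w \<bullet> w)) I"
    using L_has_sum[OF assms] by (intro has_sum_bounded_linear[OF bounded_linear_inner_left])
  moreover have "Q i w \<bullet> w = (norm (Q i w))\<^sup>2" if "i \<in> I" for i
    using Q_inner_Q[OF that] by (simp add: power2_norm_eq_inner)
  ultimately have "((\<lambda>i. (norm (Q i w))\<^sup>2) has_sum (L w \<bullet> w)) I"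
    by (simp cong: has_sum_cong)
  then show ?thesis unfolding energy_def by (simp add: infsumI)
qed

lemma L_M: "w \<in> M \<Longrightarrow> L w \<in> M"
  unfolding L_def using L_has_sum[of w] M Q_M
  by (intro infsum_in_closed_subspace) (auto simp: summable_on_def)

lemma L_orth:
  assumes "w \<in> M" "v \<in> W" shows "L w \<bullet> v = 0"
proof -
  have "((\<lambda>i. Q i w \<bullet> v) has_sum (L w \<bullet> v)) I"
    using L_has_sum[OF assms(1)] by (intro has_sum_bounded_linear[OF bounded_linear_inner_left])
  moreover have "Q i w \<bullet> v = 0" if "i \<in> I" for i
    using Q_orth that assms(2) by (auto simp: W_def)
  ultimately show ?thesis by (metis (mono_tags, lifting) has_sum_0 has_sum_unique)
qed

lemma L_add_W:
  assumes "w \<in> M" "v \<in> W" shows "L (w + v) = L w"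
  unfolding L_def using assms Q_add Q_zero by (intro infsum_cong) (auto simp: W_def)

text \<open>A function orthogonal to \<^term>\<open>W\<close> has minimal norm among all functions with the same
  values on the particles, hence its norm is at most that of the disjointly supported competitor
  built from its reflections.\<close>

lemma energy_coercive:
  assumes w: "w \<in> M" and orth: "\<And>v. v \<in> W \<Longrightarrow> w \<bullet> v = 0"
  shows "(norm w)\<^sup>2 \<le> b * energy w"
proof -
  let ?z = "\<lambda>i. Z i (Q i w)"
  have zb: "(norm (?z i))\<^sup>2 \<le> b * (norm (Q i w))\<^sup>2" if "i \<in> I" for i
    using Z_bound[of "{i}" "Q i w"] that Q_M[OF that w] by simp
  have zz: "?z i \<bullet> ?z j = 0" if "i \<in> I" "j \<in> I" "i \<noteq> j" for i j
    using Z_orth[OF that] Q_M w that by auto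
  have bound: "(norm (\<Sum>i\<in>J. ?z i))\<^sup>2 \<le> b * (\<Sum>i\<in>J. (norm (Q i w))\<^sup>2)"
    if J: "finite J" "J \<subseteq> I" for J
  proof -
    have "(norm (\<Sum>i\<in>J. ?z i))\<^sup>2 = (\<Sum>i\<in>J. \<Sum>j\<in>J. ?z i \<bullet> ?z j)"
      unfolding power2_norm_eq_inner inner_sum_left by (simp add: inner_sum_right)
    also have "\<dots> = (\<Sum>i\<in>J. \<Sum>j\<in>J. if j = i then ?z i \<bullet> ?z i else 0)"
      using J zz by (intro sum.cong refl) (auto simp: subset_iff)
    also have "\<dots> = (\<Sum>i\<in>J. (norm (?z i))\<^sup>2)"
      using J by (simp add: power2_norm_eq_inner)
    also have "\<dots> \<le> (\<Sum>i\<in>J. b * (norm (Q i w))\<^sup>2)"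
      using J zb by (intro sum_mono) auto
    finally show ?thesis by (simp add: sum_distrib_left)
  qed
  define v where "v = (\<Sum>\<^sub>\<infinity>i\<in>I. ?z i)"
  have sz: "?z summable_on I"
    using b by (intro summable_on_square_bound(1)[OF energy_summable[OF w] _ _ bound]) auto
  have nv: "(norm v)\<^sup>2 \<le> b * energy w"
    unfolding v_def energy_def
    using b by (intro summable_on_square_bound(2)[OF energy_summable[OF w] _ _ bound]) auto
  have vM: "v \<in> M"
    unfolding v_def using M sz Z_M Q_M w by (intro infsum_in_closed_subspace) auto
  have "w - v \<in> V i" if i: "i \<in> I" for i
  proof -
    have 1: "?z summable_on (I - {i})" using sz by (rule summable_on_subset_banach) auto
    have "(\<Sum>\<^sub>\<infinity>j\<in>insert i (I - {i}). ?z j) = ?z i + (\<Sum>\<^sub>\<infinity>j\<in>I - {i}. ?z j)"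
      using 1 by (intro infsum_insert) auto
    \<comment> \<open>On particle \<open>i\<close> the own term of \<open>v\<close> agrees with
      \<open>Q i w\<close>, hence with \<open>w\<close>, and all other terms vanish; so each of the
      three summands lies in \<open>V i\<close>.\<close>
    then have "w - v = (w - Q i w) + (Q i w - ?z i) - (\<Sum>\<^sub>\<infinity>j\<in>I - {i}. ?z j)"
      using i by (simp add: v_def insert_absorb)
    moreover have "(\<Sum>\<^sub>\<infinity>j\<in>I - {i}. ?z j) \<in> V i"
      using V i 1 Z_other Q_M w by (intro infsum_in_closed_subspace) auto
    moreover have "w - Q i w \<in> V i" "Q i w - ?z i \<in> V i"
      using Q_diff_V[OF i] Z_ext[OF i Q_M[OF i w]] by auto
    ultimately show ?thesis using V(1)[OF i] by (metis subspace_add subspace_diff)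
  qed
  then have "w - v \<in> W" using w vM M(1) by (simp add: W_def subspace_diff)
  then have "w \<bullet> (w - v) = 0" by (rule orth)
  then have "(norm w)\<^sup>2 = w \<bullet> v" by (simp add: inner_diff_right power2_norm_eq_inner)
  also have "\<dots> \<le> norm w * norm v" by (rule norm_cauchy_schwarz)
  finally have "norm w \<le> norm v"
    by (metis mult_le_cancel_left_pos norm_ge_zero order.order_iff_strict power2_eq_square)
  then have "(norm w)\<^sup>2 \<le> (norm v)\<^sup>2" by (intro power_mono) auto
  then show ?thesis using nv by linarith
qed

text \<open>With \<open>E = energy w\<close>, expanding the square gives
  \<open>|w|^2 - 2 E + |L w|^2\<close>. The upper bound \<open>|L w|^2 \<le> b E\<close> and the
  lower bound \<open>E \<ge> |w|^2 / b\<close> leave the factor \<open>1 - (2 - b) / b\<close>,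
  which is below 1 because \<open>b < 2\<close>.\<close>

lemma contraction:
  assumes w: "w \<in> M" and orth: "\<And>v. v \<in> W \<Longrightarrow> w \<bullet> v = 0"
  shows "(norm (w - L w))\<^sup>2 \<le> (2 - 2 / b) * (norm w)\<^sup>2"
proof -
  have "(norm (w - L w))\<^sup>2 = (norm w)\<^sup>2 - 2 * energy w + (norm (L w))\<^sup>2"
    using L_inner[OF w] by (simp add: power2_norm_eq_inner inner_diff_left inner_diff_right inner_commute)
  also have "\<dots> \<le> (norm w)\<^sup>2 - (2 - b) * energy w"
    using L_bound[OF w] by (simp add: algebra_simps)
  also have "\<dots> \<le> (norm w)\<^sup>2 - (2 - b) * ((norm w)\<^sup>2 / b)"
    using energy_coercive[OF assms] b by (intro diff_left_mono mult_left_mono) (auto simp: field_simps)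
  also have "\<dots> = (2 - 2 / b) * (norm w)\<^sup>2"
    using b by (simp add: field_simps)
  finally show ?thesis .
qed

section \<open>The iteration and its identification with the series of reflections\<close>

primrec iterate :: "'a \<Rightarrow> nat \<Rightarrow> 'a" where
  "iterate a 0 = a"
| "iterate a (Suc n) = iterate a n - L (iterate a n)"

lemma iterate_M: "a \<in> M \<Longrightarrow> iterate a n \<in> M"
  by (induction n) (auto simp: L_M M(1) subspace_diff)

text \<open>Every \<open>Q i\<close> annihilates \<open>W\<close>, so the error
  \<open>iterate a n - u\<close> obeys the same recursion as the iterate. As \<open>L\<close> maps
  into the orthogonal complement of \<open>W\<close>, the orthogonality required by
  \<open>contraction\<close> persists.\<close>

lemma iterate_converges:
  assumes a: "a \<in> M" and u: "u \<in> W" and orth: "\<And>v. v \<in> W \<Longrightarrow> (a - u) \<bullet> v = 0"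
  shows "(norm (iterate a n - u))\<^sup>2 \<le> (2 - 2 / b) ^ n * (norm (a - u))\<^sup>2"
proof -
  have "(\<forall>v\<in>W. (iterate a n - u) \<bullet> v = 0) \<and>
    (norm (iterate a n - u))\<^sup>2 \<le> (2 - 2 / b) ^ n * (norm (a - u))\<^sup>2"
  proof (induction n)
    case 0 then show ?case using orth by simp
  next
    case (Suc n)
    let ?d = "iterate a n - u"
    have dM: "?d \<in> M" using iterate_M[OF a] u M(1) by (simp add: W_def subspace_diff)
    have eq: "iterate a (Suc n) - u = ?d - L ?d"
      using L_add_W[OF dM u] by simp
    have "(norm (?d - L ?d))\<^sup>2 \<le> (2 - 2 / b) * (norm ?d)\<^sup>2"
      using contraction[OF dM] Suc by auto
    also have "\<dots> \<le> (2 - 2 / b) * ((2 - 2 / b) ^ n * (norm (a - u))\<^sup>2)"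
      using Suc b by (intro mult_left_mono) (auto simp: field_simps)
    finally have "(norm (?d - L ?d))\<^sup>2 \<le> (2 - 2 / b) ^ Suc n * (norm (a - u))\<^sup>2"
      by (simp add: mult_ac)
    then show ?case unfolding eq using Suc L_orth[OF dM] by (simp add: inner_diff_left)
  qed
  then show ?thesis ..
qed

definition reflection_terms :: "'a \<Rightarrow> (nat \<Rightarrow> 'i \<Rightarrow> 'a) \<Rightarrow> (nat \<Rightarrow> 'a) \<Rightarrow> bool" where
  "reflection_terms a \<psi> \<phi> \<longleftrightarrow> \<phi> 0 = a \<and> (\<forall>i\<in>I. \<psi> 1 i = - Q i a) \<and>
    (\<forall>k\<ge>2. \<forall>i\<in>I. \<exists>s. (\<psi> (k - 1) has_sum s) (I - {i}) \<and> \<psi> k i = - Q i s) \<and>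
    (\<forall>k\<ge>1. (\<psi> k has_sum \<phi> k) I)"

lemma reflection_terms_exist:
  assumes a: "a \<in> M"
  obtains \<psi> \<phi> where "reflection_terms a \<psi> \<phi>" "\<And>k i. i \<in> I \<Longrightarrow> \<psi> k i \<in> M" "\<And>k. \<phi> k \<in> M"
proof
  \<comment> \<open>Closed form of the recursion: the reflection of order \<open>k\<close> is
    \<open>- Q i\<close> applied to the partial sum up to order \<open>k - 1\<close>. At
    \<open>k = 0\<close> truncated subtraction merely fills in an unconstrained value.\<close>
  let ?\<psi> = "\<lambda>k i. - Q i (iterate a (k - 1))"
  let ?\<phi> = "\<lambda>k. if k = 0 then a else - L (iterate a (k - 1))"
  have sum: "(?\<psi> k has_sum ?\<phi> k) I" if "k \<ge> 1" for k
    using that L_has_sum[OF iterate_M[OF a]] by (simp add: has_sum_uminus)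
  have "\<exists>s. (?\<psi> (k - 1) has_sum s) (I - {i}) \<and> ?\<psi> k i = - Q i s" if k: "k \<ge> 2" and i: "i \<in> I" for k i
  proof (intro exI conjI)
    obtain n where n: "k = Suc (Suc n)" using k by (metis add_2_eq_Suc nat_le_iff_add)
    show "(?\<psi> (k - 1) has_sum (?\<phi> (k - 1) - ?\<psi> (k - 1) i)) (I - {i})"
      using sum[of "k - 1"] n by (simp add: has_sum_remove[OF i])
    \<comment> \<open>Omitting the own term adds \<open>Q i\<close> of the old iterate; by
      idempotence of \<open>Q i\<close> the right side becomes \<open>- Q i\<close> of the next
      iterate.\<close>
    show "?\<psi> k i = - Q i (?\<phi> (k - 1) - ?\<psi> (k - 1) i)"
      using i by (simp add: n Q_diff Q_idem Q_add)
  qed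
  then show "reflection_terms a ?\<psi> ?\<phi>"
    unfolding reflection_terms_def using sum by auto
  show "?\<psi> k i \<in> M" if "i \<in> I" for k i
    using that M(1) Q_M iterate_M[OF a] by (simp add: subspace_neg)
  show "?\<phi> k \<in> M" for k
    using a M(1) L_M iterate_M[OF a] by (simp add: subspace_neg)
qed

lemma reflection_terms_partial_sum:
  assumes a: "a \<in> M" and R: "reflection_terms a \<psi> \<phi>"
  shows "(\<Sum>k\<le>n. \<phi> k) = iterate a n"
proof -
  have R0: "\<phi> 0 = a" and R1: "\<And>i. i \<in> I \<Longrightarrow> \<psi> 1 i = - Q i a"
    and R2: "\<And>k i. k \<ge> 2 \<Longrightarrow> i \<in> I \<Longrightarrow> \<exists>s. (\<psi> (k - 1) has_sum s) (I - {i}) \<and> \<psi> k i = - Q i s"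
    and R3: "\<And>k. k \<ge> 1 \<Longrightarrow> (\<psi> k has_sum \<phi> k) I"
    using R by (auto simp: reflection_terms_def)
  \<comment> \<open>The induction carries the closed form of the single reflections one order ahead
    of the partial sums: the terms of order \<open>Suc n\<close> are determined by the iterate of
    order \<open>n\<close>.\<close>
  have "(\<forall>i\<in>I. \<psi> (Suc n) i = - Q i (iterate a n)) \<and> (\<Sum>k\<le>n. \<phi> k) = iterate a n"
  proof (induction n)
    case 0 then show ?case using R0 R1 by simp
  next
    case (Suc n)
    have "((\<lambda>i. - Q i (iterate a n)) has_sum \<phi> (Suc n)) I"
      using R3[of "Suc n"] Suc by (simp cong: has_sum_cong)
    moreover have "((\<lambda>i. - Q i (iterate a n)) has_sum - L (iterate a n)) I"
      using L_has_sum[OF iterate_M[OF a]] by (simp add: has_sum_uminus)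
    ultimately have phi: "\<phi> (Suc n) = - L (iterate a n)" using has_sum_unique by blast
    have "\<psi> (Suc (Suc n)) i = - Q i (iterate a (Suc n))" if i: "i \<in> I" for i
    proof -
      obtain s where s: "(\<psi> (Suc n) has_sum s) (I - {i})" "\<psi> (Suc (Suc n)) i = - Q i s"
        using R2[of "Suc (Suc n)" i] i by auto
      have "\<psi> (Suc n) i + s = \<phi> (Suc n)"
        by (rule has_sum_unique[OF iffD1[OF has_sum_remove[OF i] s(1)] R3]) simp
      then have "s = - L (iterate a n) + Q i (iterate a n)" using Suc i phi by (simp add: algebra_simps)
      then show ?thesis using s(2) i by (simp add: Q_add Q_idem Q_diff)
    qed
    then show ?case using Suc phi by simp
  qed
  then show ?thesis by blast
qed

end

section \<open>The Hilbert space $L^2(\mathbf{R}^3)$\<close>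

lemma L2I: "u \<in> borel_measurable lborel \<Longrightarrow> integrable lborel (\<lambda>x. (norm (u x))\<^sup>2) \<Longrightarrow> u \<in> L2"
  and L2_measurable: "u \<in> L2 \<Longrightarrow> u \<in> borel_measurable lborel"
  and L2_integrable: "u \<in> L2 \<Longrightarrow> integrable lborel (\<lambda>x. (norm (u x))\<^sup>2)"
  by (auto simp: L2_def)

lemma L2_dominated:
  fixes u :: "R3 \<Rightarrow> 'b::euclidean_space" and v :: "R3 \<Rightarrow> 'c::euclidean_space"
  assumes v: "v \<in> L2" and u: "u \<in> borel_measurable lborel" and le: "\<And>x. norm (u x) \<le> C * norm (v x)"
  shows "u \<in> L2"
proof (rule L2I[OF u])
  have [measurable]: "u \<in> borel_measurable lborel" by fact
  show "integrable lborel (\<lambda>x. (norm (u x))\<^sup>2)"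
  proof (rule Bochner_Integration.integrable_bound)
    show "integrable lborel (\<lambda>x. C\<^sup>2 * (norm (v x))\<^sup>2)" using L2_integrable[OF v] by simp
    have "norm ((norm (u x))\<^sup>2) \<le> norm (C\<^sup>2 * (norm (v x))\<^sup>2)" for x
      using power_mono[OF le norm_ge_zero, of x 2] by (simp add: power_mult_distrib abs_mult)
    then show "AE x in lborel. norm ((norm (u x))\<^sup>2) \<le> norm (C\<^sup>2 * (norm (v x))\<^sup>2)" by simp
  qed measurable
qed

lemma L2_zero: "(\<lambda>_. 0) \<in> L2"
  by (simp add: L2_def)

lemma norm_add_square_le: "(norm (a + b :: 'a::real_normed_vector))\<^sup>2 \<le> 2 * (norm a)\<^sup>2 + 2 * (norm b)\<^sup>2"
proof -
  have "(norm (a + b))\<^sup>2 \<le> (norm a + norm b)\<^sup>2"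
    by (intro power_mono norm_triangle_ineq norm_ge_zero)
  also have "\<dots> \<le> 2 * (norm a)\<^sup>2 + 2 * (norm b)\<^sup>2"
    using zero_le_power2[of "norm a - norm b"] by (simp add: power2_sum power2_diff)
  finally show ?thesis .
qed

lemma L2_add:
  fixes u v :: "R3 \<Rightarrow> 'b::euclidean_space"
  assumes "u \<in> L2" "v \<in> L2"
  shows "(\<lambda>x. u x + v x) \<in> L2"
proof (rule L2I)
  have [measurable]: "u \<in> borel_measurable lborel" "v \<in> borel_measurable lborel"
    using assms by (auto dest: L2_measurable)
  show "(\<lambda>x. u x + v x) \<in> borel_measurable lborel" by measurable
  show "integrable lborel (\<lambda>x. (norm (u x + v x))\<^sup>2)"
  proof (rule Bochner_Integration.integrable_bound)
    show "integrable lborel (\<lambda>x. 2 * (norm (u x))\<^sup>2 + 2 * (norm (v x))\<^sup>2)"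
      using assms by (intro Bochner_Integration.integrable_add integrable_mult_right L2_integrable)
    show "AE x in lborel. norm ((norm (u x + v x))\<^sup>2) \<le> norm (2 * (norm (u x))\<^sup>2 + 2 * (norm (v x))\<^sup>2)"
      using norm_add_square_le by (auto intro!: AE_I2)
  qed measurable
qed

lemma L2_scaleR:
  fixes u :: "R3 \<Rightarrow> 'b::euclidean_space"
  assumes "u \<in> L2" shows "(\<lambda>x. c *\<^sub>R u x) \<in> L2"
  using L2_measurable[OF assms]
  by (intro L2_dominated[OF assms, of _ "\<bar>c\<bar>"]) auto

lemma L2_minus: "u \<in> L2 \<Longrightarrow> (\<lambda>x. - u x) \<in> L2" for u :: "R3 \<Rightarrow> 'b::euclidean_space"
  using L2_scaleR[of u "-1"] by simp

lemma L2_diff: "u \<in> L2 \<Longrightarrow> v \<in> L2 \<Longrightarrow> (\<lambda>x. u x - v x) \<in> L2" for u :: "R3 \<Rightarrow> 'b::euclidean_space"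
  using L2_add[OF _ L2_minus, of u v] by simp

lemma L2_bounded_mult:
  fixes u :: "R3 \<Rightarrow> real"
  assumes "u \<in> L2" "\<eta> \<in> borel_measurable lborel" "\<And>x. \<bar>\<eta> x\<bar> \<le> C"
  shows "(\<lambda>x. \<eta> x * u x) \<in> L2"
proof (rule L2_dominated[OF assms(1)])
  show "(\<lambda>x. \<eta> x * u x) \<in> borel_measurable lborel"
    using assms(2) L2_measurable[OF assms(1)] by measurable
  show "norm (\<eta> x * u x) \<le> C * norm (u x)" for x
    using assms(3)[of x] by (simp add: abs_mult mult_right_mono)
qed

lemma L2_integrable_inner:
  fixes u v :: "R3 \<Rightarrow> 'b::euclidean_space"
  assumes "u \<in> L2" "v \<in> L2"
  shows "integrable lborel (\<lambda>x. u x \<bullet> v x)"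
proof (rule Bochner_Integration.integrable_bound)
  have [measurable]: "u \<in> borel_measurable lborel" "v \<in> borel_measurable lborel"
    using assms by (auto dest: L2_measurable)
  show "(\<lambda>x. u x \<bullet> v x) \<in> borel_measurable lborel" by measurable
  show "integrable lborel (\<lambda>x. (norm (u x))\<^sup>2 + (norm (v x))\<^sup>2)"
    using assms by (auto dest: L2_integrable)
  have "norm (a \<bullet> b) \<le> (norm a)\<^sup>2 + (norm b)\<^sup>2" for a b :: 'b
    using Cauchy_Schwarz_ineq2[of a b] zero_le_power2[of "norm a - norm b"] zero_le_power2[of "norm a + norm b"]
    unfolding power2_sum power2_diff real_norm_def by linarith
  then show "AE x in lborel. norm (u x \<bullet> v x) \<le> norm ((norm (u x))\<^sup>2 + (norm (v x))\<^sup>2)"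
    by (auto intro!: AE_I2)
qed

lemmas L2_integrable_mult = L2_integrable_inner[where 'b=real, simplified]

\<comment> \<open>A partial equivalence on all functions. Passing to a type makes L2 an instance of
  \<open>real_inner\<close> and \<open>banach\<close>, so that the abstract results on projections
  and series apply directly.\<close>
quotient_type (overloaded) 'b l2 = "R3 \<Rightarrow> 'b::euclidean_space" /
  partial: "\<lambda>u v. u \<in> L2 \<and> v \<in> L2 \<and> (AE x in lborel. u x = v x)"
proof (rule part_equivpI)
  show "\<exists>u::R3 \<Rightarrow> 'b. u \<in> L2 \<and> u \<in> L2 \<and> (AE x in lborel. u x = u x)"
    using L2_zero by auto
qed (auto intro!: sympI transpI)

instantiation l2 :: (euclidean_space) real_vector
begin

lift_definition zero_l2 :: "'a l2" is "\<lambda>_. 0"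
  by (simp add: L2_zero)

lift_definition plus_l2 :: "'a l2 \<Rightarrow> 'a l2 \<Rightarrow> 'a l2" is "\<lambda>u v x. u x + v x"
  by (auto simp: L2_add)

lift_definition minus_l2 :: "'a l2 \<Rightarrow> 'a l2 \<Rightarrow> 'a l2" is "\<lambda>u v x. u x - v x"
  by (auto simp: L2_diff)

lift_definition uminus_l2 :: "'a l2 \<Rightarrow> 'a l2" is "\<lambda>u x. - u x"
  by (auto simp: L2_minus)

lift_definition scaleR_l2 :: "real \<Rightarrow> 'a l2 \<Rightarrow> 'a l2" is "\<lambda>c u x. c *\<^sub>R u x"
  by (auto simp: L2_scaleR)

instance
proof
  fix f g h :: "'a l2" and c d :: real
  show "f + g + h = f + (g + h)" by transfer (auto simp: add.assoc L2_add)
  show "f + g = g + f" by transfer (auto simp: add.commute L2_add)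
  show "0 + f = f" by transfer auto
  show "- f + f = 0" by transfer (auto simp: L2_zero)
  show "f - g = f + - g" by transfer (auto simp: L2_diff)
  show "c *\<^sub>R (f + g) = c *\<^sub>R f + c *\<^sub>R g"
    by transfer (auto simp: scaleR_add_right L2_add L2_scaleR)
  show "(c + d) *\<^sub>R f = c *\<^sub>R f + d *\<^sub>R f"
    by transfer (auto simp: scaleR_add_left L2_add L2_scaleR)
  show "c *\<^sub>R d *\<^sub>R f = (c * d) *\<^sub>R f" by transfer (auto simp: L2_scaleR)
  show "1 *\<^sub>R f = f" by transfer auto
qed

end

instantiation l2 :: (euclidean_space) real_inner
begin

lift_definition inner_l2 :: "'a l2 \<Rightarrow> 'a l2 \<Rightarrow> real" is "\<lambda>u v. LINT x|lborel. u x \<bullet> v x"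
proof -
  fix u u' v v' :: "R3 \<Rightarrow> 'a"
  assume 1: "u \<in> L2 \<and> u' \<in> L2 \<and> (AE x in lborel. u x = u' x)"
    and 2: "v \<in> L2 \<and> v' \<in> L2 \<and> (AE x in lborel. v x = v' x)"
  then have [measurable]: "u \<in> borel_measurable lborel" "u' \<in> borel_measurable lborel"
      "v \<in> borel_measurable lborel" "v' \<in> borel_measurable lborel"
    by (auto simp: L2_def)
  show "(LINT x|lborel. u x \<bullet> v x) = (LINT x|lborel. u' x \<bullet> v' x)"
    using 1 2 by (intro integral_cong_AE) auto
qed

definition norm_l2 :: "'a l2 \<Rightarrow> real" where "norm_l2 f = sqrt (f \<bullet> f)"
definition dist_l2 :: "'a l2 \<Rightarrow> 'a l2 \<Rightarrow> real" where "dist_l2 f g = norm (f - g)"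
definition sgn_l2 :: "'a l2 \<Rightarrow> 'a l2" where "sgn_l2 f = f /\<^sub>R norm f"
definition uniformity_l2 :: "('a l2 \<times> 'a l2) filter" where
  "uniformity_l2 = (INF e\<in>{0 <..}. principal {(x, y). dist x y < e})"
definition open_l2 :: "'a l2 set \<Rightarrow> bool" where
  "open_l2 U = (\<forall>x\<in>U. \<forall>\<^sub>F (x', y) in uniformity. x' = x \<longrightarrow> y \<in> U)"

instance
proof
  fix f g h :: "'a l2" and c :: real
  show "dist f g = norm (f - g)" by (simp add: dist_l2_def)
  show "sgn f = f /\<^sub>R norm f" by (simp add: sgn_l2_def)
  show "uniformity = (INF e\<in>{0 <..}. principal {(x, y :: 'a l2). dist x y < e})"
    by (simp add: uniformity_l2_def)
  show "open U = (\<forall>x\<in>U. \<forall>\<^sub>F (x', y) in uniformity. x' = x \<longrightarrow> y \<in> U)" for U :: "'a l2 set"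
    by (simp add: open_l2_def)
  show "f \<bullet> g = g \<bullet> f" by transfer (simp add: inner_commute)
  show "(f + g) \<bullet> h = f \<bullet> h + g \<bullet> h"
    by transfer (simp add: inner_add_left Bochner_Integration.integral_add L2_integrable_inner)
  show "c *\<^sub>R f \<bullet> g = c * (f \<bullet> g)" by transfer simp
  show "0 \<le> f \<bullet> f" by transfer simp
  show "f \<bullet> f = 0 \<longleftrightarrow> f = 0"
    by transfer (simp add: L2_zero integral_nonneg_eq_0_iff_AE L2_integrable_inner)
  show "norm f = sqrt (f \<bullet> f)" by (simp add: norm_l2_def)
qed

end

lemma abs_l2_surj: obtains u where "u \<in> L2" "f = abs_l2 u"
  by (induction f rule: l2.abs_induct) auto

lemma abs_l2_eq_iff:
  assumes "u \<in> L2" "v \<in> L2" shows "abs_l2 u = abs_l2 v \<longleftrightarrow> (AE x in lborel. u x = v x)"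
  using assms Quotient3_rel[OF Quotient3_l2, of u v] by auto

lemma abs_l2_add: "u \<in> L2 \<Longrightarrow> v \<in> L2 \<Longrightarrow> abs_l2 u + abs_l2 v = abs_l2 (\<lambda>x. u x + v x)"
  and abs_l2_diff: "u \<in> L2 \<Longrightarrow> v \<in> L2 \<Longrightarrow> abs_l2 u - abs_l2 v = abs_l2 (\<lambda>x. u x - v x)"
  and abs_l2_scaleR: "u \<in> L2 \<Longrightarrow> c *\<^sub>R abs_l2 u = abs_l2 (\<lambda>x. c *\<^sub>R u x)"
  and abs_l2_zero: "abs_l2 (\<lambda>_. 0) = 0"
  and inner_abs_l2: "u \<in> L2 \<Longrightarrow> v \<in> L2 \<Longrightarrow> abs_l2 u \<bullet> abs_l2 v = (LINT x|lborel. u x \<bullet> v x)"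
  by (auto simp: plus_l2.abs_eq minus_l2.abs_eq scaleR_l2.abs_eq zero_l2_def inner_l2.abs_eq)

lemma norm_abs_l2: "u \<in> L2 \<Longrightarrow> (norm (abs_l2 u))\<^sup>2 = (LINT x|lborel. (norm (u x))\<^sup>2)"
  by (simp add: power2_norm_eq_inner inner_abs_l2)

lemma nn_integral_norm_abs_l2:
  assumes "u \<in> L2" shows "(\<integral>\<^sup>+x. ennreal ((norm (u x))\<^sup>2) \<partial>lborel) = ennreal ((norm (abs_l2 u))\<^sup>2)"
  using nn_integral_eq_integral[OF L2_integrable[OF assms]] by (simp add: norm_abs_l2[OF assms])

lemma L2_cauchy_schwarz:
  assumes "u \<in> L2" "v \<in> L2"
  shows "\<bar>LINT x|lborel. u x \<bullet> v x\<bar> \<le> norm (abs_l2 u) * norm (abs_l2 v)"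
  using Cauchy_Schwarz_ineq2[of "abs_l2 u" "abs_l2 v"] assms by (simp add: inner_abs_l2)

text \<open>Weighting the increments by \<open>2 ^ n\<close> makes the square function dominate the sum of the
  increments, so that a rapidly convergent sequence converges almost everywhere.\<close>

lemma L2_rapid_Cauchy_AE:
  fixes u :: "nat \<Rightarrow> R3 \<Rightarrow> 'b::euclidean_space"
  assumes u: "\<And>n. u n \<in> L2"
    and rapid: "\<And>n. (norm (abs_l2 (\<lambda>x. u (Suc n) x - u n x)))\<^sup>2 \<le> (1/4) ^ n"
  shows "AE x in lborel. convergent (\<lambda>n. u n x)"
proof -
  have [measurable]: "u n \<in> borel_measurable lborel" for n using u L2_measurable by blast
  let ?d = "\<lambda>n x. norm (u (Suc n) x - u n x)"
  have "(\<integral>\<^sup>+x. (\<Sum>n. ennreal (2 ^ n * (?d n x)\<^sup>2)) \<partial>lborel)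
      = (\<Sum>n. \<integral>\<^sup>+x. ennreal (2 ^ n * (?d n x)\<^sup>2) \<partial>lborel)"
    by (rule nn_integral_suminf) measurable
  also have "\<dots> = (\<Sum>n. ennreal (2 ^ n) * ennreal ((norm (abs_l2 (\<lambda>x. u (Suc n) x - u n x)))\<^sup>2))"
    by (simp add: ennreal_mult nn_integral_cmult nn_integral_norm_abs_l2 L2_diff u)
  also have "\<dots> \<le> (\<Sum>n. ennreal ((1/2) ^ n))"
  proof (intro suminf_le summableI)
    fix n
    have "2 ^ n * (norm (abs_l2 (\<lambda>x. u (Suc n) x - u n x)))\<^sup>2 \<le> 2 ^ n * (1/4) ^ n"
      using rapid by (intro mult_left_mono) auto
    also have "\<dots> = (1/2) ^ n" by (simp flip: power_mult_distrib)
    finally show "ennreal (2 ^ n) * ennreal ((norm (abs_l2 (\<lambda>x. u (Suc n) x - u n x)))\<^sup>2) \<le> ennreal ((1/2) ^ n)"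
      by (simp flip: ennreal_mult add: ennreal_leI)
  qed
  also have "\<dots> = ennreal (\<Sum>n. (1/2) ^ n)"
    by (intro suminf_ennreal2) (auto intro: summable_geometric)
  also have "\<dots> < \<infinity>" by simp
  finally have "AE x in lborel. (\<Sum>n. ennreal (2 ^ n * (?d n x)\<^sup>2)) \<noteq> \<infinity>"
    by (intro nn_integral_PInf_AE) auto
  then show ?thesis
  proof eventually_elim
    fix x assume "(\<Sum>n. ennreal (2 ^ n * (?d n x)\<^sup>2)) \<noteq> \<infinity>"
    then have s: "summable (\<lambda>n. 2 ^ n * (?d n x)\<^sup>2)"
      by (intro summable_suminf_not_top) auto
    have "summable (\<lambda>n. ?d n x)"
    proof (rule summable_comparison_test')
      show "summable (\<lambda>n. (1/2) ^ n + 2 ^ n * (?d n x)\<^sup>2)"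
        by (intro summable_add s) (simp add: summable_geometric)
      fix n :: nat
      define a where "a = ?d n x"
      \<comment> \<open>Completing the square bounds \<open>2 a\<close> by
        \<open>2^n a^2 + 2^-n\<close>, a summable majorant of the increments.\<close>
      have "0 \<le> (2 ^ n * a - 1)\<^sup>2 / 2 ^ n" by simp
      also have "\<dots> = 2 ^ n * a\<^sup>2 - 2 * a + (1/2) ^ n"
        by (simp add: power2_diff field_simps power2_eq_square)
      finally have "a \<le> (1/2) ^ n + 2 ^ n * a\<^sup>2"
        using norm_ge_zero[of "u (Suc n) x - u n x"] unfolding a_def[symmetric] by linarith
      then show "norm (?d n x) \<le> (1/2) ^ n + 2 ^ n * (?d n x)\<^sup>2"
        by (simp add: a_def)
    qed
    then have "summable (\<lambda>n. u (Suc n) x - u n x)" by (rule summable_norm_cancel)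
    then show "convergent (\<lambda>n. u n x)"
      unfolding summable_iff_convergent sum_lessThan_telescope[of "\<lambda>n. u n x"]
      using convergent_diff_const_right_iff[of "\<lambda>n. u n x" "u 0 x"] by simp
  qed
qed

text \<open>Riesz-Fischer: a rapidly convergent subsequence converges almost everywhere, Fatou's
  lemma shows that its pointwise limit is also its L2 limit, and a Cauchy sequence with a convergent
  subsequence converges.\<close>

instance l2 :: (euclidean_space) banach
proof
  fix X :: "nat \<Rightarrow> 'a l2" assume X: "Cauchy X"
  have "\<exists>N. \<forall>m\<ge>N. \<forall>n\<ge>N. norm (X m - X n) < (1/2) ^ k" for k
    using X[unfolded Cauchy_def dist_norm, rule_format, of "(1/2) ^ k"] by simp
  then have "\<forall>k. \<exists>N. \<forall>m\<ge>N. \<forall>n\<ge>N. norm (X m - X n) < (1/2) ^ k" by (rule allI)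
  from choice[OF this] obtain N where N: "\<forall>k. \<forall>m\<ge>N k. \<forall>n\<ge>N k. norm (X m - X n) < (1/2) ^ k"
    by (rule exE)
  \<comment> \<open>The maximum makes the indices strictly increasing and keeps them beyond the
    Cauchy threshold of level \<open>k\<close>.\<close>
  define s where "s = rec_nat (N 0) (\<lambda>k m. max (Suc m) (N (Suc k)))"
  have s_Suc: "s (Suc k) = max (Suc (s k)) (N (Suc k))" for k by (simp add: s_def)
  have s_mono: "strict_mono s"
    unfolding strict_mono_Suc_iff s_Suc by (intro allI) linarith
  have sN: "s k \<ge> N k" for k by (cases k) (auto simp: s_Suc, simp add: s_def)
  have "\<exists>u. u \<in> L2 \<and> X n = abs_l2 u" for n by (rule abs_l2_surj[of "X n"]) blast
  then have "\<forall>n. \<exists>u. u \<in> L2 \<and> X n = abs_l2 u" by (rule allI)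
  from choice[OF this] obtain u where "\<forall>n. u n \<in> L2 \<and> X n = abs_l2 (u n)"
    by (rule exE)
  then have u: "u n \<in> L2" "X n = abs_l2 (u n)" for n by simp_all
  let ?v = "\<lambda>k. u (s k)"
  have v: "?v k \<in> L2" for k by (rule u)
  have [measurable]: "u n \<in> borel_measurable lborel" for n using u L2_measurable by blast
  have vX: "abs_l2 (\<lambda>x. ?v m x - ?v k x) = X (s m) - X (s k)" for m k
    using u by (simp add: abs_l2_diff)
  have "AE x in lborel. convergent (\<lambda>k. ?v k x)"
  proof (rule L2_rapid_Cauchy_AE[OF v])
    fix k
    have "norm (X (s (Suc k)) - X (s k)) < (1/2) ^ k"
      using sN[of k] by (intro N[rule_format]) (auto simp: s_Suc)
    then have "(norm (X (s (Suc k)) - X (s k)))\<^sup>2 \<le> ((1/2) ^ k)\<^sup>2"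
      by (intro power_mono) auto
    then show "(norm (abs_l2 (\<lambda>x. ?v (Suc k) x - ?v k x)))\<^sup>2 \<le> (1/4) ^ k"
      by (simp add: vX power2_eq_square flip: power_mult_distrib)
  qed
  then have lim: "AE x in lborel. (\<lambda>k. ?v k x) \<longlonglongrightarrow> lim (\<lambda>k. ?v k x)"
    by eventually_elim (simp add: convergent_LIMSEQ_iff)
  define w where "w = (\<lambda>x. lim (\<lambda>k. ?v k x))"
  have w_meas [measurable]: "w \<in> borel_measurable lborel"
    unfolding w_def by measurable
  have est: "(\<integral>\<^sup>+x. ennreal ((norm (?v k x - w x))\<^sup>2) \<partial>lborel) \<le> ennreal (((1/2) ^ k)\<^sup>2)" for k
  proof -
    have "(\<integral>\<^sup>+x. ennreal ((norm (?v k x - w x))\<^sup>2) \<partial>lborel)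
        = (\<integral>\<^sup>+x. liminf (\<lambda>m. ennreal ((norm (?v k x - ?v m x))\<^sup>2)) \<partial>lborel)"
    proof (rule nn_integral_cong_AE)
      show "AE x in lborel. ennreal ((norm (?v k x - w x))\<^sup>2) = liminf (\<lambda>m. ennreal ((norm (?v k x - ?v m x))\<^sup>2))"
        using lim
      proof eventually_elim
        fix x assume "(\<lambda>k. ?v k x) \<longlonglongrightarrow> lim (\<lambda>k. ?v k x)"
        then have "(\<lambda>m. ennreal ((norm (?v k x - ?v m x))\<^sup>2)) \<longlonglongrightarrow> ennreal ((norm (?v k x - w x))\<^sup>2)"
          unfolding w_def by (intro tendsto_intros tendsto_ennrealI)
        then show "ennreal ((norm (?v k x - w x))\<^sup>2) = liminf (\<lambda>m. ennreal ((norm (?v k x - ?v m x))\<^sup>2))"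
          using lim_imp_Liminf trivial_limit_sequentially by metis
      qed
    qed
    \<comment> \<open>Fatou's lemma; the resulting finite bound is also what places the limit in
      L2.\<close>
    also have "\<dots> \<le> liminf (\<lambda>m. \<integral>\<^sup>+x. ennreal ((norm (?v k x - ?v m x))\<^sup>2) \<partial>lborel)"
      by (intro nn_integral_liminf) measurable
    also have "\<dots> = liminf (\<lambda>m. ennreal ((norm (X (s k) - X (s m)))\<^sup>2))"
      by (simp add: nn_integral_norm_abs_l2[OF L2_diff[OF v v]] vX)
    also have "\<dots> \<le> ennreal (((1/2) ^ k)\<^sup>2)"
    proof (rule Liminf_le)
      show "\<forall>\<^sub>F m in sequentially. ennreal ((norm (X (s k) - X (s m)))\<^sup>2) \<le> ennreal (((1/2) ^ k)\<^sup>2)"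
        using eventually_ge_at_top[of k]
      proof eventually_elim
        fix m assume "m \<ge> k"
        then have "s m \<ge> N k" using sN[of k] s_mono by (meson order_trans strict_mono_less_eq)
        then have "norm (X (s k) - X (s m)) < (1/2) ^ k"
            using N[rule_format] sN by simp
        then show "ennreal ((norm (X (s k) - X (s m)))\<^sup>2) \<le> ennreal (((1/2) ^ k)\<^sup>2)"
          by (intro ennreal_leI power_mono) auto
      qed
    qed simp
    finally show ?thesis .
  qed
  have dL2: "(\<lambda>x. ?v k x - w x) \<in> L2" for k
  proof (rule L2I)
    show "integrable lborel (\<lambda>x. (norm (?v k x - w x))\<^sup>2)"
      using est[of k] by (intro integrableI_bounded) (auto simp: le_less_trans)
  qed measurable
  have wL2: "w \<in> L2"
    using L2_diff[OF v[of 0] dL2[of 0]] by simp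
  have "norm (X (s k) - abs_l2 w) \<le> (1/2) ^ k" for k
  proof -
    have "ennreal ((norm (X (s k) - abs_l2 w))\<^sup>2) \<le> ennreal (((1/2) ^ k)\<^sup>2)"
      using est[of k] nn_integral_norm_abs_l2[OF dL2[of k]] u wL2 by (simp add: abs_l2_diff)
    then have "(norm (X (s k) - abs_l2 w))\<^sup>2 \<le> ((1/2) ^ k)\<^sup>2" by (simp add: ennreal_le_iff)
    then show ?thesis by (rule power2_le_imp_le) simp
  qed
  then have "(\<lambda>k. X (s k) - abs_l2 w) \<longlonglongrightarrow> 0"
    by (rule Lim_null_comparison[OF always_eventually[OF allI]]) (rule LIMSEQ_realpow_zero; simp)
  then have "(X \<circ> s) \<longlonglongrightarrow> abs_l2 w"
    unfolding o_def by (rule LIM_zero_cancel)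
  then have "X \<longlonglongrightarrow> abs_l2 w" by (rule Cauchy_converges_subseq[OF X s_mono])
  then show "convergent X" by (rule convergentI)
qed

section \<open>Test functions\<close>

text \<open>The functions \<open>t^-n exp(-1/t)\<close>, extended by zero. The power is a parameter
  because differentiation raises it, so the family spans its own derivatives.\<close>

definition flat :: "nat \<Rightarrow> real \<Rightarrow> real" where
  "flat n t = (if t > 0 then (1/t) ^ n * exp (- (1/t)) else 0)"

lemma flat_nonneg: "0 \<le> flat n t"
  by (simp add: flat_def)

lemma flat_0_le_1: "flat 0 t \<le> 1"
  by (simp add: flat_def)

lemma flat_tendsto_0: "(flat n \<longlongrightarrow> 0) (at 0)"
proof (rule filterlim_split_at)
  show "(flat n \<longlongrightarrow> 0) (at_left 0)"
    by (rule tendsto_eventually) (auto simp: eventually_at_left_field flat_def intro: exI[of _ "-1"])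
  have "((\<lambda>t. (inverse t) ^ n / exp (inverse t)) \<longlongrightarrow> (0::real)) (at_right 0)"
    by (rule filterlim_compose[OF tendsto_power_div_exp_0 filterlim_inverse_at_top_right])
  moreover have "\<forall>\<^sub>F t in at_right 0. (inverse t) ^ n / exp (inverse t) = flat n t"
    using eventually_at_right_less[of "0::real"]
    by eventually_elim (simp add: flat_def exp_minus divide_inverse)
  ultimately show "(flat n \<longlongrightarrow> 0) (at_right 0)"
    by (simp add: filterlim_cong)
qed

lemma flat_has_derivative:
  "(flat n has_real_derivative (flat (n + 2) t - real n * flat (n + 1) t)) (at t)"
proof (cases "t = 0")
  case True
  \<comment> \<open>At the origin the difference quotient is exactly \<open>flat (Suc n)\<close>,
    which tends to 0.\<close>
  have "(\<lambda>h. (flat n (0 + h) - flat n 0) / h) \<midarrow>0\<rightarrow> 0"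
  proof (rule Lim_transform_eventually[OF flat_tendsto_0[of "Suc n"]])
    show "\<forall>\<^sub>F h in at 0. flat (Suc n) h = (flat n (0 + h) - flat n 0) / h"
      by (auto simp: eventually_at_filter flat_def divide_simps)
  qed
  then show ?thesis unfolding True DERIV_def by (simp add: flat_def)
next
  case False
  show ?thesis
  proof (cases "t > 0")
    case True
    have "((\<lambda>t. (1/t) ^ n * exp (- (1/t))) has_real_derivative
        (real n * (1/t) ^ (n - 1) * (- (1/t)\<^sup>2) * exp (- (1/t)) + (1/t) ^ n * (exp (- (1/t)) * (1/t)\<^sup>2))) (at t)"
      using True by (auto intro!: derivative_eq_intros simp: power2_eq_square)
    moreover have eq: "real n * (1/t) ^ (n - 1) * (- (1/t)\<^sup>2) = - (real n * (1/t) ^ (n + 1))"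
      by (cases n) (simp_all add: power2_eq_square power_add)
    moreover have "real n * (1/t) ^ (n - 1) * (- (1/t)\<^sup>2) * exp (- (1/t)) + (1/t) ^ n * (exp (- (1/t)) * (1/t)\<^sup>2)
        = flat (n + 2) t - real n * flat (n + 1) t"
      unfolding eq using True by (simp add: flat_def power_add power2_eq_square)
    ultimately have "((\<lambda>t. (1/t) ^ n * exp (- (1/t))) has_real_derivative
        (flat (n + 2) t - real n * flat (n + 1) t)) (at t)" by (simp only:)
    then show ?thesis
      by (rule has_field_derivative_transform_within_open[of _ _ _ "{0<..}"]) (use True in \<open>auto simp: flat_def\<close>)
  next
    case False
    then have "t < 0" using \<open>t \<noteq> 0\<close> by simp
    have "((\<lambda>t. 0) has_real_derivative (flat (n + 2) t - real n * flat (n + 1) t)) (at t)"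
      using \<open>t < 0\<close> by (simp add: flat_def)
    then show ?thesis
      by (rule has_field_derivative_transform_within_open[of _ _ _ "{..<0}"]) (use \<open>t < 0\<close> in \<open>auto simp: flat_def\<close>)
  qed
qed

text \<open>An algebra of functions that is closed under differentiation, to which coinduction applies.\<close>

inductive_set flat_algebra :: "(R3 \<Rightarrow> real) set" where
  const: "(\<lambda>_. c) \<in> flat_algebra"
| flat: "(\<lambda>x. flat n (a * x $ i + b)) \<in> flat_algebra"
| add: "\<phi> \<in> flat_algebra \<Longrightarrow> \<psi> \<in> flat_algebra \<Longrightarrow> (\<lambda>x. \<phi> x + \<psi> x) \<in> flat_algebra"
| mult: "\<phi> \<in> flat_algebra \<Longrightarrow> \<psi> \<in> flat_algebra \<Longrightarrow> (\<lambda>x. \<phi> x * \<psi> x) \<in> flat_algebra"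

lemma flat_algebra_derivative:
  assumes "\<phi> \<in> flat_algebra"
  shows "\<exists>D. (\<forall>x. (\<phi> has_derivative D x) (at x)) \<and> (\<forall>v. (\<lambda>x. D x v) \<in> flat_algebra)"
  using assms
proof induction
  case (const c)
  show ?case by (intro exI[of _ "\<lambda>x v. 0"]) (auto intro: flat_algebra.const)
next
  case (flat n a i b)
  let ?d = "\<lambda>t. flat (n + 2) t + (- real n) * flat (n + 1) t"
  let ?D = "\<lambda>x v :: R3. (a * v $ i) * ?d (a * x $ i + b)"
  have "((\<lambda>x :: R3. flat n (a * x $ i + b)) has_derivative ?D x) (at x)" for x
  proof -
    have 1: "((\<lambda>x :: R3. a * x $ i + b) has_derivative (\<lambda>v. a * v $ i)) (at x)"
      by (auto intro!: derivative_eq_intros bounded_linear_imp_has_derivative bounded_linear_vec_nth)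
    have 2: "(flat n has_derivative (*) (?d (a * x $ i + b))) (at (a * x $ i + b))"
      using flat_has_derivative[of n "a * x $ i + b"] by (simp add: has_field_derivative_def)
    show ?thesis using has_derivative_compose[OF 1 2] by (simp add: mult.commute)
  qed
  moreover have "(\<lambda>x. ?D x v) \<in> flat_algebra" for v
    by (intro flat_algebra.intros)
  ultimately show ?case by (intro exI[of _ ?D]) auto
next
  case (add \<phi> \<psi>)
  then obtain D E where D: "\<And>x. (\<phi> has_derivative D x) (at x)" "\<And>v. (\<lambda>x. D x v) \<in> flat_algebra"
    and E: "\<And>x. (\<psi> has_derivative E x) (at x)" "\<And>v. (\<lambda>x. E x v) \<in> flat_algebra" by auto
  show ?case
    by (intro exI[of _ "\<lambda>x v. D x v + E x v"] conjI allI has_derivative_add D E flat_algebra.intros)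
next
  case (mult \<phi> \<psi>)
  then obtain D E where D: "\<And>x. (\<phi> has_derivative D x) (at x)" "\<And>v. (\<lambda>x. D x v) \<in> flat_algebra"
    and E: "\<And>x. (\<psi> has_derivative E x) (at x)" "\<And>v. (\<lambda>x. E x v) \<in> flat_algebra" by auto
  show ?case
    by (intro exI[of _ "\<lambda>x v. \<phi> x * E x v + D x v * \<psi> x"] conjI allI has_derivative_mult D E
        flat_algebra.add flat_algebra.mult mult.hyps)
qed

lemma smooth_flat_algebra:
  assumes "\<phi> \<in> flat_algebra" shows "smooth \<phi>"
proof (rule smooth.coinduct[of "\<lambda>\<phi>. \<phi> \<in> flat_algebra"])
  fix \<phi> :: "R3 \<Rightarrow> real" assume "\<phi> \<in> flat_algebra"
  then obtain D where D: "\<And>x. (\<phi> has_derivative D x) (at x)" "\<And>v. (\<lambda>x. D x v) \<in> flat_algebra"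
    using flat_algebra_derivative by blast
  have "frechet_derivative \<phi> (at x) = D x" for x
    using frechet_derivative_at[OF D(1)] by simp
  then show "\<exists>\<psi>. \<phi> = \<psi> \<and> (\<forall>x. \<psi> differentiable (at x)) \<and>
      (\<forall>v. (\<lambda>x. frechet_derivative \<psi> (at x) v) \<in> flat_algebra \<or> smooth (\<lambda>x. frechet_derivative \<psi> (at x) v))"
    using D by (auto simp: differentiable_def)
qed (fact assms)

section \<open>Closure properties of smooth functions and test functions\<close>

lemma smooth_differentiable: "smooth \<phi> \<Longrightarrow> \<phi> differentiable (at x)"
  and smooth_derivative: "smooth \<phi> \<Longrightarrow> smooth (\<lambda>x. frechet_derivative \<phi> (at x) v)"
  by (auto elim: smooth.cases)

lemma smooth_has_derivative: "smooth \<phi> \<Longrightarrow> (\<phi> has_derivative frechet_derivative \<phi> (at x)) (at x)"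
  using smooth_differentiable frechet_derivative_works by blast

text \<open>The coinduction invariant is the set of all such combinations with the same coefficient
  \<open>c\<close>; differentiation preserves it.\<close>

lemma smooth_lincomb:
  assumes "smooth \<phi>" "smooth \<psi>" shows "smooth (\<lambda>x. \<phi> x + c * \<psi> x)"
proof (rule smooth.coinduct[of "\<lambda>\<phi>. \<exists>\<psi> \<theta>. smooth \<psi> \<and> smooth \<theta> \<and> \<phi> = (\<lambda>x. \<psi> x + c * \<theta> x)"])
  fix \<phi> :: "R3 \<Rightarrow> real" assume "\<exists>\<psi> \<theta>. smooth \<psi> \<and> smooth \<theta> \<and> \<phi> = (\<lambda>x. \<psi> x + c * \<theta> x)"
  then obtain \<psi> \<theta> where *: "smooth \<psi>" "smooth \<theta>" "\<phi> = (\<lambda>x. \<psi> x + c * \<theta> x)" by blast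
  let ?D = "\<lambda>x v. frechet_derivative \<psi> (at x) v + c * frechet_derivative \<theta> (at x) v"
  have D: "(\<phi> has_derivative ?D x) (at x)" for x
    unfolding *(3) by (intro has_derivative_add has_derivative_mult_right smooth_has_derivative *)
  then have "frechet_derivative \<phi> (at x) = ?D x" for x
    using frechet_derivative_at by metis
  then have "\<exists>\<psi> \<theta>. smooth \<psi> \<and> smooth \<theta> \<and>
      (\<lambda>x. frechet_derivative \<phi> (at x) v) = (\<lambda>x. \<psi> x + c * \<theta> x)" for v
    using smooth_derivative[OF *(1)] smooth_derivative[OF *(2)]
    by (intro exI[of _ "\<lambda>x. frechet_derivative \<psi> (at x) v"] exI[of _ "\<lambda>x. frechet_derivative \<theta> (at x) v"]) simp
  moreover have "\<phi> differentiable (at x)" for x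
    using D differentiable_def by blast
  ultimately show "\<exists>\<phi>'. \<phi> = \<phi>' \<and> (\<forall>x. \<phi>' differentiable (at x)) \<and>
      (\<forall>v. (\<exists>\<psi> \<theta>. smooth \<psi> \<and> smooth \<theta> \<and> (\<lambda>x. frechet_derivative \<phi>' (at x) v) = (\<lambda>x. \<psi> x + c * \<theta> x)) \<or>
        smooth (\<lambda>x. frechet_derivative \<phi>' (at x) v))"
    by blast
qed (use assms in blast)

lemma smooth_translate:
  assumes "smooth \<phi>" shows "smooth (\<lambda>x. \<phi> (x + a))"
    and "frechet_derivative (\<lambda>x. \<phi> (x + a)) (at x) = frechet_derivative \<phi> (at (x + a))"
proof -
  have D: "((\<lambda>x. \<psi> (x + a)) has_derivative frechet_derivative \<psi> (at (x + a))) (at x)"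
    if "smooth \<psi>" for \<psi> x
  proof -
    have "((\<lambda>x. x + a) has_derivative (\<lambda>v. v)) (at x)"
      by (auto intro!: derivative_eq_intros)
    from has_derivative_compose[OF this smooth_has_derivative[OF that]] show ?thesis by simp
  qed
  have fd: "frechet_derivative (\<lambda>x. \<psi> (x + a)) (at x) = frechet_derivative \<psi> (at (x + a))"
    if "smooth \<psi>" for \<psi> x
    using frechet_derivative_at[OF D[OF that]] by simp
  show "frechet_derivative (\<lambda>x. \<phi> (x + a)) (at x) = frechet_derivative \<phi> (at (x + a))"
    using fd assms by blast
  show "smooth (\<lambda>x. \<phi> (x + a))"
  proof (rule smooth.coinduct[of "\<lambda>\<phi>. \<exists>\<psi>. smooth \<psi> \<and> \<phi> = (\<lambda>x. \<psi> (x + a))"])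
    fix \<phi> :: "R3 \<Rightarrow> real" assume "\<exists>\<psi>. smooth \<psi> \<and> \<phi> = (\<lambda>x. \<psi> (x + a))"
    then obtain \<psi> where *: "smooth \<psi>" "\<phi> = (\<lambda>x. \<psi> (x + a))" by blast
    show "\<exists>\<phi>'. \<phi> = \<phi>' \<and> (\<forall>x. \<phi>' differentiable (at x)) \<and>
      (\<forall>v. (\<exists>\<psi>. smooth \<psi> \<and> (\<lambda>x. frechet_derivative \<phi>' (at x) v) = (\<lambda>x. \<psi> (x + a))) \<or>
        smooth (\<lambda>x. frechet_derivative \<phi>' (at x) v))"
    proof (rule exI[of _ \<phi>], intro conjI allI refl disjI1)
      show "\<phi> differentiable (at x)" for x
        using D[OF *(1)] unfolding *(2) differentiable_def by blast
      show "\<exists>\<psi>. smooth \<psi> \<and> (\<lambda>x. frechet_derivative \<phi> (at x) v) = (\<lambda>x. \<psi> (x + a))" for v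
        using smooth_derivative[OF *(1), of v]
        by (intro exI[of _ "\<lambda>x. frechet_derivative \<psi> (at x) v"]) (simp add: *(2) fd[OF *(1)])
    qed
  qed (use assms in blast)
qed

lemma smooth_continuous: "smooth \<phi> \<Longrightarrow> continuous_on UNIV \<phi>"
  by (simp add: continuous_at_imp_continuous_on differentiable_imp_continuous_within smooth_differentiable)

lemma test_functionsI:
  assumes "smooth \<phi>" "\<And>x. norm x > R \<Longrightarrow> \<phi> x = 0" shows "\<phi> \<in> test_functions"
proof -
  have "{x. \<phi> x \<noteq> 0} \<subseteq> cball 0 R" using assms(2) by (auto simp: subset_iff) (meson not_le)
  then have "bounded {x. \<phi> x \<noteq> 0}" by (rule bounded_subset[OF bounded_cball])
  then show ?thesis using assms(1) by (simp add: test_functions_def compact_closure)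
qed

lemma test_functionsE:
  assumes "\<phi> \<in> test_functions" obtains R where "smooth \<phi>" "R > 0" "\<And>x. norm x > R \<Longrightarrow> \<phi> x = 0"
proof -
  have "bounded {x. \<phi> x \<noteq> 0}"
    using assms by (auto simp: test_functions_def compact_closure)
  then obtain R where "R > 0" "\<And>x. \<phi> x \<noteq> 0 \<Longrightarrow> norm x \<le> R"
    by (auto simp: bounded_pos)
  then show ?thesis using assms that[of R] by (force simp: test_functions_def)
qed

lemma test_functions_lincomb:
  assumes "\<phi> \<in> test_functions" "\<psi> \<in> test_functions"
  shows "(\<lambda>x. \<phi> x + c * \<psi> x) \<in> test_functions"
proof -
  obtain R where R: "smooth \<phi>" "\<And>x. norm x > R \<Longrightarrow> \<phi> x = 0" using test_functionsE[OF assms(1)] by metis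
  obtain S where S: "smooth \<psi>" "\<And>x. norm x > S \<Longrightarrow> \<psi> x = 0" using test_functionsE[OF assms(2)] by metis
  show ?thesis
    by (rule test_functionsI[of _ "max R S"]) (auto simp: smooth_lincomb R S)
qed

lemma test_functions_translate:
  assumes "\<phi> \<in> test_functions" shows "(\<lambda>x. \<phi> (x + a)) \<in> test_functions"
proof -
  obtain R where R: "smooth \<phi>" "\<And>x. norm x > R \<Longrightarrow> \<phi> x = 0" using test_functionsE[OF assms(1)] by metis
  show ?thesis
  proof (rule test_functionsI[of _ "R + norm a"])
    fix x :: R3 assume "R + norm a < norm x"
    then have "norm (x + a) > R" using norm_diff_ineq[of x a] by linarith
    then show "\<phi> (x + a) = 0" by (rule R)
  qed (simp add: smooth_translate R)
qed

lemma test_functions_derivative: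
  assumes "\<phi> \<in> test_functions" shows "(\<lambda>x. frechet_derivative \<phi> (at x) v) \<in> test_functions"
proof -
  obtain R where R: "smooth \<phi>" "\<And>x. norm x > R \<Longrightarrow> \<phi> x = 0" using test_functionsE[OF assms(1)] by metis
  show ?thesis
  proof (rule test_functionsI[of _ R])
    fix x :: R3 assume "norm x > R"
    have "open {x :: R3. norm x > R}" by (intro open_Collect_less continuous_intros)
    then have "(\<phi> has_derivative (\<lambda>_. 0)) (at x)"
      using \<open>norm x > R\<close> R(2)
      by (intro has_derivative_transform_within_open[OF has_derivative_const[of 0]]) auto
    then show "frechet_derivative \<phi> (at x) v = 0"
      using frechet_derivative_at by metis
  qed (simp add: smooth_derivative R)
qed

lemma test_functions_bounded:
  assumes "\<phi> \<in> test_functions" obtains B where "B \<ge> 0" "\<And>x. \<bar>\<phi> x\<bar> \<le> B"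
proof -
  obtain R where R: "smooth \<phi>" "R > 0" "\<And>x. norm x > R \<Longrightarrow> \<phi> x = 0" using test_functionsE[OF assms(1)] by metis
  have "compact (\<phi> ` cball 0 R)"
    using smooth_continuous[OF R(1)] by (intro compact_continuous_image) (auto intro: continuous_on_subset)
  then obtain B where B: "\<And>x. x \<in> cball 0 R \<Longrightarrow> \<bar>\<phi> x\<bar> \<le> B"
    using compact_imp_bounded bounded_iff by (metis image_eqI real_norm_def)
  have "\<bar>\<phi> x\<bar> \<le> max B 0" for x
    using B[of x] R(3)[of x] by (cases "norm x \<le> R") auto
  then show ?thesis using that[of "max B 0"] by simp
qed

lemma test_functions_L2:
  assumes "\<phi> \<in> test_functions" shows "\<phi> \<in> L2"
proof (rule L2I)
  obtain R where R: "smooth \<phi>" "R > 0" "\<And>x. norm x > R \<Longrightarrow> \<phi> x = 0" using test_functionsE[OF assms(1)] by metis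
  have [measurable]: "\<phi> \<in> borel_measurable borel"
    using smooth_continuous[OF R(1)] by (rule borel_measurable_continuous_onI)
  then show "\<phi> \<in> borel_measurable lborel" by simp
  obtain B where B: "\<And>x. \<bar>\<phi> x\<bar> \<le> B" using test_functions_bounded[OF assms] by metis
  show "integrable lborel (\<lambda>x. (norm (\<phi> x))\<^sup>2)"
  proof (rule Bochner_Integration.integrable_bound)
    show "integrable lborel (\<lambda>x. B\<^sup>2 * indicator (cball (0::R3) R) x)"
      by (intro integrable_mult_right integrable_real_indicator emeasure_lborel_cball_finite) simp
    have "norm ((norm (\<phi> x))\<^sup>2) \<le> norm (B\<^sup>2 * indicator (cball 0 R) x)" for x
      using R(3)[of x] power_mono[OF B[of x], of 2] by (cases "norm x \<le> R") (auto simp: indicator_def)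
    then show "AE x in lborel. norm ((norm (\<phi> x))\<^sup>2) \<le> norm (B\<^sup>2 * indicator (cball 0 R) x)"
      by simp
  qed simp
qed

text \<open>A smooth approximation of the indicator of \<open>box a b\<close>: each factor
  \<open>flat 0 (n t)\<close> tends to 1 for \<open>t > 0\<close> and vanishes for
  \<open>t \<le> 0\<close>, while the support never leaves the box.\<close>

definition bump :: "nat \<Rightarrow> R3 \<Rightarrow> R3 \<Rightarrow> R3 \<Rightarrow> real" where
  "bump n a b x = (\<Prod>i\<in>UNIV. flat 0 (real n * (x $ i - a $ i)) * flat 0 (real n * (b $ i - x $ i)))"

lemma bump_flat_algebra: "bump n a b \<in> flat_algebra"
proof -
  have fac: "(\<lambda>x. flat 0 (real n * (x $ i - a $ i)) * flat 0 (real n * (b $ i - x $ i))) \<in> flat_algebra" for i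
  proof (rule flat_algebra.mult)
    show "(\<lambda>x. flat 0 (real n * (x $ i - a $ i))) \<in> flat_algebra"
      using flat_algebra.flat[of 0 "real n" i "- real n * a $ i"] by (simp add: algebra_simps)
    show "(\<lambda>x. flat 0 (real n * (b $ i - x $ i))) \<in> flat_algebra"
      using flat_algebra.flat[of 0 "- real n" i "real n * b $ i"] by (simp add: algebra_simps)
  qed
  have "(\<lambda>x. \<Prod>i\<in>J. flat 0 (real n * (x $ i - a $ i)) * flat 0 (real n * (b $ i - x $ i))) \<in> flat_algebra"
    if "finite J" for J
    using that
  proof induction
    case empty
    then show ?case using flat_algebra.const[of 1] by simp
  next
    case (insert i J)
    then show ?case using flat_algebra.mult[OF fac[of i]] by simp
  qed
  then show ?thesis unfolding bump_def[abs_def] by simp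
qed

lemma bump_outside: "x \<notin> box a b \<Longrightarrow> bump n a b x = 0"
proof -
  assume "x \<notin> box a b"
  then obtain i where "x $ i \<le> a $ i \<or> b $ i \<le> x $ i"
    by (auto simp: mem_box_cart not_less)
  then have "flat 0 (real n * (x $ i - a $ i)) * flat 0 (real n * (b $ i - x $ i)) = 0"
    by (auto simp: flat_def zero_less_mult_iff)
  then show ?thesis unfolding bump_def by (meson UNIV_I finite prod_zero)
qed

lemma bump_test: "bump n a b \<in> test_functions"
proof -
  have "bounded (box a b)" by (rule bounded_box)
  then obtain R where R: "\<And>x. x \<in> box a b \<Longrightarrow> norm x \<le> R" by (auto simp: bounded_iff)
  show ?thesis
    by (rule test_functionsI[of _ R]) (use R bump_outside in \<open>force simp: smooth_flat_algebra bump_flat_algebra\<close>)+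
qed

lemma bump_bounds: "0 \<le> bump n a b x" "bump n a b x \<le> 1"
  unfolding bump_def
  by (auto intro!: prod_nonneg prod_le_1 mult_nonneg_nonneg mult_le_one simp: flat_nonneg flat_0_le_1)

lemma bump_tendsto: "(\<lambda>n. bump n a b x) \<longlonglongrightarrow> indicator (box a b) x"
proof (cases "x \<in> box a b")
  case True
  have lim: "(\<lambda>n. flat 0 (real n * t)) \<longlonglongrightarrow> 1" if "t > 0" for t
  proof -
    have "(\<lambda>n. exp (- (1 / t * (1 / real n)))) \<longlonglongrightarrow> exp (- (1 / t * 0))"
      by (intro tendsto_intros lim_1_over_n)
    moreover have "\<forall>\<^sub>F n in sequentially. exp (- (1 / t * (1 / real n))) = flat 0 (real n * t)"
      using eventually_gt_at_top[of "0::nat"] by eventually_elim (simp add: flat_def that mult.commute)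
    ultimately show ?thesis by (simp add: filterlim_cong)
  qed
  have "(\<lambda>n. bump n a b x) \<longlonglongrightarrow> (\<Prod>i\<in>(UNIV :: 3 set). 1 * 1)"
    unfolding bump_def using True by (intro tendsto_prod tendsto_mult lim) (auto simp: mem_box_cart)
  then show ?thesis using True by simp
next
  case False
  then show ?thesis by (simp add: bump_outside)
qed

text \<open>Positive and negative part of \<open>h\<close> are densities of two measures that agree
  on boxes. Boxes form an intersection-stable generator and exhaust space with finite measure, so
  the measures coincide and with them the densities.\<close>

lemma AE_zero_if_box_integrals_zero:
  fixes h :: "R3 \<Rightarrow> real"
  assumes [measurable]: "h \<in> borel_measurable lborel"
    and int: "\<And>a b. integrable lborel (\<lambda>x. h x * indicator (box a b) x)"
    and zero: "\<And>a b. (LINT x|lborel. h x * indicator (box a b) x) = 0"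
  shows "AE x in lborel. h x = 0"
proof -
  let ?p = "\<lambda>x. max 0 (h x)" and ?m = "\<lambda>x. max 0 (- h x)"
  have intp: "integrable lborel (\<lambda>x. ?p x * indicator (box a b) x)"
    and intm: "integrable lborel (\<lambda>x. ?m x * indicator (box a b) x)" for a b
    by (rule Bochner_Integration.integrable_bound[OF int[of a b]]; auto simp: indicator_def)+
  have eq: "(LINT x|lborel. ?p x * indicator (box a b) x) = (LINT x|lborel. ?m x * indicator (box a b) x)" for a b
  proof -
    have "(LINT x|lborel. ?p x * indicator (box a b) x) - (LINT x|lborel. ?m x * indicator (box a b) x)
      = (LINT x|lborel. ?p x * indicator (box a b) x - ?m x * indicator (box a b) x)"
      using intp intm by (rule Bochner_Integration.integral_diff[symmetric])
    also have "\<dots> = (LINT x|lborel. h x * indicator (box a b) x)"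
      by (intro Bochner_Integration.integral_cong) (auto simp: indicator_def)
    finally show ?thesis using zero by simp
  qed
  have em: "emeasure (density lborel (\<lambda>x. ennreal (f x))) (box a b) = ennreal (LINT x|lborel. f x * indicator (box a b) x)"
    if [measurable]: "f \<in> borel_measurable lborel" and "\<And>x. 0 \<le> f x"
      and "integrable lborel (\<lambda>x. f x * indicator (box a b) x)" for f :: "R3 \<Rightarrow> real" and a b
  proof -
    have "emeasure (density lborel (\<lambda>x. ennreal (f x))) (box a b)
        = (\<integral>\<^sup>+x. ennreal (f x) * indicator (box a b) x \<partial>lborel)"
      by (rule emeasure_density) simp_all
    also have "\<dots> = (\<integral>\<^sup>+x. ennreal (f x * indicator (box a b) x) \<partial>lborel)"
      by (intro nn_integral_cong) (auto simp: indicator_def)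
    also have "\<dots> = ennreal (LINT x|lborel. f x * indicator (box a b) x)"
      using that by (intro nn_integral_eq_integral) auto
    finally show ?thesis .
  qed
  let ?E = "range (\<lambda>(a, b). box a b :: R3 set)"
  have "density lborel (\<lambda>x. ennreal (?p x)) = density lborel (\<lambda>x. ennreal (?m x))"
  proof (rule measure_eqI_generator_eq)
    show "Int_stable ?E"
      by (auto simp: Int_stable_def box_Int_box)
    show "?E \<subseteq> Pow UNIV" by simp
    show "sets (density lborel (\<lambda>x. ennreal (?p x))) = sigma_sets UNIV ?E"
      "sets (density lborel (\<lambda>x. ennreal (?m x))) = sigma_sets UNIV ?E"
      by (simp_all add: borel_eq_box)
    let ?A = "\<lambda>n::nat. box (- (real n *\<^sub>R One)) (real n *\<^sub>R One) :: R3 set"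
    show "range ?A \<subseteq> ?E" "(\<Union>i. ?A i) = UNIV"
      unfolding UN_box_eq_UNIV by auto
    show "emeasure (density lborel (\<lambda>x. ennreal (?p x))) (?A i) \<noteq> \<infinity>" for i
      by (subst em) (auto simp: intp)
    show "emeasure (density lborel (\<lambda>x. ennreal (?p x))) X = emeasure (density lborel (\<lambda>x. ennreal (?m x))) X"
      if "X \<in> ?E" for X
    proof -
      obtain a b where X: "X = box a b" using \<open>X \<in> ?E\<close> by auto
      show ?thesis unfolding X by (subst (1 2) em) (auto simp: intp intm eq)
    qed
  qed
  then have "AE x in lborel. ennreal (?p x) = ennreal (?m x)"
    by (intro sigma_finite_measure.density_unique[OF sigma_finite_lborel]) auto
  then show ?thesis
  proof eventually_elim
    fix x assume "ennreal (?p x) = ennreal (?m x)"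
    then have "?p x = ?m x" by (subst (asm) ennreal_inj) auto
    then show "h x = 0" by linarith
  qed
qed

section \<open>Density of the test functions in L2\<close>

lemma box_indicator_L2: "indicator (box a b :: R3 set) \<in> (L2 :: (R3 \<Rightarrow> real) set)"
proof (rule L2I)
  have "integrable lborel (indicator (box a b) :: R3 \<Rightarrow> real)"
    by (simp add: emeasure_lborel_box_eq)
  moreover have "(\<lambda>x :: R3. (norm (indicator (box a b) x :: real))\<^sup>2) = indicator (box a b)"
    by (auto simp: indicator_def)
  ultimately show "integrable lborel (\<lambda>x :: R3. (norm (indicator (box a b) x :: real))\<^sup>2)" by simp
qed simp

text \<open>The bumps converge boundedly to the indicator of a box without leaving it, so dominated
  convergence extends the orthogonality from bumps to boxes.\<close>

lemma AE_zero_if_orthogonal_test_functions: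
  fixes h :: "R3 \<Rightarrow> real"
  assumes h: "h \<in> L2" and orth: "\<And>\<phi>. \<phi> \<in> test_functions \<Longrightarrow> (LINT x|lborel. h x * \<phi> x) = 0"
  shows "AE x in lborel. h x = 0"
proof (rule AE_zero_if_box_integrals_zero)
  show [measurable]: "h \<in> borel_measurable lborel" by (rule L2_measurable[OF h])
  show int: "integrable lborel (\<lambda>x. h x * indicator (box a b) x)" for a b
    by (rule L2_integrable_mult[OF h box_indicator_L2])
  show "(LINT x|lborel. h x * indicator (box a b) x) = 0" for a b
  proof -
    have [measurable]: "bump n a b \<in> borel_measurable lborel" for n
      using test_functions_L2[OF bump_test] by (rule L2_measurable)
    have "(\<lambda>n. LINT x|lborel. h x * bump n a b x) \<longlonglongrightarrow> (LINT x|lborel. h x * indicator (box a b) x)"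
    proof (rule integral_dominated_convergence[where w = "\<lambda>x. \<bar>h x * indicator (box a b) x\<bar>"])
      show "integrable lborel (\<lambda>x. \<bar>h x * indicator (box a b) x\<bar>)" using int by simp
      show "AE x in lborel. (\<lambda>n. h x * bump n a b x) \<longlonglongrightarrow> h x * indicator (box a b) x"
        by (intro AE_I2 tendsto_intros bump_tendsto)
      have "norm (h x * bump n a b x) \<le> \<bar>h x * indicator (box a b) x\<bar>" for n x
        using bump_outside[of x a b n] bump_bounds[of n a b x]
        by (cases "x \<in> box a b") (auto simp: abs_mult mult_left_le)
      then show "AE x in lborel. norm (h x * bump n a b x) \<le> \<bar>h x * indicator (box a b) x\<bar>" for n by simp
    qed measurable
    then show ?thesis by (simp add: orth bump_test LIMSEQ_const_iff)
  qed
qed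

lemma subspace_closure:
  fixes S :: "'a::real_normed_vector set"
  assumes "subspace S" shows "subspace (closure S)"
proof (rule subspaceI)
  show "0 \<in> closure S" using subspace_0[OF assms] closure_subset by blast
next
  fix x y assume "x \<in> closure S" "y \<in> closure S"
  then obtain f g where "\<And>n. f n \<in> S" "f \<longlonglongrightarrow> x" "\<And>n. g n \<in> S" "g \<longlonglongrightarrow> y"
    by (auto simp: closure_sequential)
  then show "x + y \<in> closure S"
    unfolding closure_sequential using subspace_add[OF assms]
    by (intro exI[of _ "\<lambda>n. f n + g n"]) (auto intro: tendsto_add)
next
  fix x c assume "x \<in> closure S"
  then obtain f where "\<And>n. f n \<in> S" "f \<longlonglongrightarrow> x"
    by (auto simp: closure_sequential)
  then show "c *\<^sub>R x \<in> closure S"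
    unfolding closure_sequential using subspace_scale[OF assms]
    by (intro exI[of _ "\<lambda>n. c *\<^sub>R f n"]) (auto intro: tendsto_scaleR)
qed

text \<open>The residual of the projection onto the closure is orthogonal to every test function,
  hence zero.\<close>

lemma closure_test_functions: "closure (abs_l2 ` test_functions) = UNIV"
proof -
  let ?T = "abs_l2 ` test_functions"
  have "subspace ?T"
  proof (rule subspaceI)
    have "(\<lambda>_. 0) \<in> test_functions"
      by (rule test_functionsI[of _ 0]) (auto intro: smooth_flat_algebra flat_algebra.const)
    then show z: "0 \<in> ?T" using abs_l2_zero by (metis image_eqI)
    fix f g assume "f \<in> ?T" "g \<in> ?T"
    then obtain \<phi> \<psi> where *: "f = abs_l2 \<phi>" "g = abs_l2 \<psi>" "\<phi> \<in> test_functions" "\<psi> \<in> test_functions"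
      by blast
    then show "f + g \<in> ?T"
      using test_functions_lincomb[of \<phi> \<psi> 1] by (auto simp: abs_l2_add test_functions_L2)
  next
    fix f c assume "f \<in> ?T"
    then obtain \<phi> where *: "f = abs_l2 \<phi>" "\<phi> \<in> test_functions" by blast
    \<comment> \<open>\<open>test_functions_lincomb\<close> fixes the first coefficient at 1, so the
      multiple by \<open>c\<close> is split accordingly.\<close>
    have "(\<lambda>x. \<phi> x + (c - 1) * \<phi> x) \<in> test_functions" using * by (intro test_functions_lincomb)
    moreover have "(\<lambda>x. \<phi> x + (c - 1) * \<phi> x) = (\<lambda>x. c *\<^sub>R \<phi> x)" by (auto simp: algebra_simps)
    ultimately show "c *\<^sub>R f \<in> ?T" using * by (auto simp: abs_l2_scaleR test_functions_L2)
  qed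
  then have S: "subspace (closure ?T)" by (rule subspace_closure)
  have "f \<in> closure ?T" for f
  proof -
    let ?d = "f - proj (closure ?T) f"
    obtain h where h: "h \<in> L2" "?d = abs_l2 h" using abs_l2_surj by blast
    have "AE x in lborel. h x = 0"
    proof (rule AE_zero_if_orthogonal_test_functions[OF h(1)])
      fix \<phi> assume \<phi>: "\<phi> \<in> test_functions"
      then have "?d \<bullet> abs_l2 \<phi> = 0"
        using closure_subset[of ?T] by (intro proj_orth[OF S]) auto
      then show "(LINT x|lborel. h x * \<phi> x) = 0"
        using h test_functions_L2[OF \<phi>] by (simp add: inner_abs_l2)
    qed
    then have "?d = 0" using h L2_zero abs_l2_eq_iff[OF h(1) L2_zero] abs_l2_zero by metis
    then show ?thesis using proj_in[OF S closed_closure, of f] by simp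
  qed
  then show ?thesis by blast
qed

section \<open>Weak derivatives and translations\<close>

lemma dominated_convergence_at_0:
  fixes s :: "real \<Rightarrow> 'a \<Rightarrow> real"
  assumes s: "\<And>t. s t \<in> borel_measurable M" and f: "f \<in> borel_measurable M" and w: "integrable M w"
    and lim: "AE x in M. ((\<lambda>t. s t x) \<longlongrightarrow> f x) (at 0)"
    and bound: "\<And>t. t \<noteq> 0 \<Longrightarrow> \<bar>t\<bar> \<le> 1 \<Longrightarrow> AE x in M. \<bar>s t x\<bar> \<le> w x"
  shows "((\<lambda>t. integral\<^sup>L M (s t)) \<longlongrightarrow> integral\<^sup>L M f) (at 0)"
  unfolding tendsto_at_iff_sequentially
proof (intro allI impI)
  fix X :: "nat \<Rightarrow> real" assume X0: "\<forall>i. X i \<in> UNIV - {0}" and X: "X \<longlonglongrightarrow> 0"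
  \<comment> \<open>The majorant is only assumed for \<open>|t| \<le> 1\<close>, so an initial
    segment of the sequence is dropped.\<close>
  obtain N where N: "\<And>n. n \<ge> N \<Longrightarrow> \<bar>X n\<bar> < 1"
    using metric_LIMSEQ_D[OF X, of 1] by auto
  have "(\<lambda>n. integral\<^sup>L M (s (X (n + N)))) \<longlonglongrightarrow> integral\<^sup>L M f"
  proof (rule integral_dominated_convergence[OF f s w])
    show "AE x in M. (\<lambda>n. s (X (n + N)) x) \<longlonglongrightarrow> f x"
      using lim
    proof eventually_elim
      fix x assume "((\<lambda>t. s t x) \<longlongrightarrow> f x) (at 0)"
      then have "(\<lambda>n. s (X n) x) \<longlonglongrightarrow> f x"
        unfolding tendsto_at_iff_sequentially using X0 X by (auto simp: o_def)
      then show "(\<lambda>n. s (X (n + N)) x) \<longlonglongrightarrow> f x" by (rule LIMSEQ_ignore_initial_segment)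
    qed
    show "AE x in M. norm (s (X (n + N)) x) \<le> w x" for n
      using bound[of "X (n + N)"] X0 N[of "n + N"] by auto
  qed
  then show "((\<lambda>t. integral\<^sup>L M (s t)) \<circ> X) \<longlonglongrightarrow> integral\<^sup>L M f"
    unfolding o_def by (rule LIMSEQ_offset)
qed

section \<open>Translations and difference quotients\<close>

lemma integral_translate:
  fixes f :: "R3 \<Rightarrow> real"
  assumes "f \<in> borel_measurable lborel"
  shows "(LINT x|lborel. f (x + c)) = (LINT x|lborel. f x)"
proof -
  have "(LINT x|lborel. f x) = (LINT x|distr lborel borel ((+) c). f x)"
    by (simp add: lborel_distr_plus)
  also have "\<dots> = (LINT x|lborel. f (c + x))"
    using assms by (intro integral_distr) simp_all
  finally show ?thesis by (simp add: add.commute)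
qed

lemma integrable_translate:
  fixes f :: "R3 \<Rightarrow> real"
  assumes "integrable lborel f"
  shows "integrable lborel (\<lambda>x. f (x + c))"
proof -
  have "integrable (distr lborel borel ((+) c)) f"
    using assms by (simp add: lborel_distr_plus)
  then have "integrable lborel (\<lambda>x. f (c + x))"
    by (subst (asm) integrable_distr_eq) (use assms in auto)
  then show ?thesis by (simp add: add.commute)
qed

lemma measurable_translate:
  fixes u :: "R3 \<Rightarrow> 'b::topological_space"
  assumes "u \<in> borel_measurable lborel" shows "(\<lambda>x. u (x + c)) \<in> borel_measurable lborel"
proof -
  have [measurable]: "u \<in> borel_measurable borel" using assms by simp
  have "(\<lambda>x. u (x + c)) \<in> borel_measurable borel" by measurable
  then show ?thesis by simp
qed

lemma L2_translate:
  fixes u :: "R3 \<Rightarrow> 'b::euclidean_space"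
  assumes "u \<in> L2" shows "(\<lambda>x. u (x + c)) \<in> L2"
  using measurable_translate[OF L2_measurable[OF assms]] integrable_translate[OF L2_integrable[OF assms]]
  by (intro L2I) auto

lemma cball_indicator_L2: "indicator (cball 0 R :: R3 set) \<in> (L2 :: (R3 \<Rightarrow> real) set)"
proof (rule L2I)
  have "integrable lborel (indicator (cball 0 R) :: R3 \<Rightarrow> real)"
    by (intro integrable_real_indicator emeasure_lborel_cball_finite) simp
  moreover have "(\<lambda>x :: R3. (norm (indicator (cball 0 R) x :: real))\<^sup>2) = indicator (cball 0 R)"
    by (auto simp: indicator_def)
  ultimately show "integrable lborel (\<lambda>x :: R3. (norm (indicator (cball 0 R) x :: real))\<^sup>2)" by simp
qed (intro borel_measurable_indicator, simp)

lemma smooth_line_derivative: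
  assumes "smooth \<phi>"
  shows "((\<lambda>s. \<phi> (x + s *\<^sub>R e)) has_real_derivative frechet_derivative \<phi> (at (x + s *\<^sub>R e)) e) (at s within S)"
proof -
  have 1: "((\<lambda>s. x + s *\<^sub>R e) has_derivative (\<lambda>h. h *\<^sub>R e)) (at s within S)"
    by (auto intro!: derivative_eq_intros)
  have 2: "(\<phi> has_derivative frechet_derivative \<phi> (at (x + s *\<^sub>R e))) (at (x + s *\<^sub>R e))"
    by (rule smooth_has_derivative[OF assms])
  have "linear (frechet_derivative \<phi> (at (x + s *\<^sub>R e)))"
    using 2 has_derivative_linear by blast
  then have "(\<lambda>h. frechet_derivative \<phi> (at (x + s *\<^sub>R e)) (h *\<^sub>R e)) = (*) (frechet_derivative \<phi> (at (x + s *\<^sub>R e)) e)"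
    by (intro ext) (simp add: linear_cmul)
  with has_derivative_compose[OF 1 2] show ?thesis
    unfolding has_field_derivative_def by simp
qed

lemma test_difference_quotient:
  fixes e :: R3
  assumes u: "u \<in> L2" and \<phi>: "\<phi> \<in> test_functions"
  shows "((\<lambda>t. (LINT x|lborel. u x * (\<phi> (x + t *\<^sub>R e) - \<phi> x)) / t) \<longlongrightarrow>
    (LINT x|lborel. u x * frechet_derivative \<phi> (at x) e)) (at 0)"
proof -
  obtain R where R: "smooth \<phi>" "R > 0" "\<And>x. norm x > R \<Longrightarrow> \<phi> x = 0"
    using test_functionsE[OF \<phi>] by metis
  let ?D = "\<lambda>x. frechet_derivative \<phi> (at x) e"
  have D: "?D \<in> test_functions" by (rule test_functions_derivative[OF \<phi>])
  obtain B where B: "B \<ge> 0" "\<And>x. \<bar>?D x\<bar> \<le> B" using test_functions_bounded[OF D] by metis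
  \<comment> \<open>For \<open>|t| \<le> 1\<close> both \<open>\<phi>\<close> and its translate by
    \<open>t e\<close> vanish outside this enlarged ball, so \<open>u\<close> times the indicator is
    an integrable majorant although \<open>u\<close> is only in L2.\<close>
  let ?I = "indicator (cball 0 (R + norm e)) :: R3 \<Rightarrow> real"
  have m [measurable]: "u \<in> borel_measurable lborel" "\<phi> \<in> borel_measurable lborel" "?D \<in> borel_measurable lborel"
    using u \<phi> D test_functions_L2 L2_measurable by blast+
  have [measurable]: "(\<lambda>x. \<phi> (x + t *\<^sub>R e)) \<in> borel_measurable lborel" for t
    by (rule measurable_translate) measurable
  have "((\<lambda>t. LINT x|lborel. u x * ((\<phi> (x + t *\<^sub>R e) - \<phi> x) / t)) \<longlongrightarrow> (LINT x|lborel. u x * ?D x)) (at 0)"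
  proof (rule dominated_convergence_at_0[where w = "\<lambda>x. \<bar>u x * ?I x\<bar> * B"])
    show "integrable lborel (\<lambda>x. \<bar>u x * ?I x\<bar> * B)"
      using L2_integrable_mult[OF u cball_indicator_L2] by auto
    have "((\<lambda>t. (\<phi> (x + t *\<^sub>R e) - \<phi> x) / t) \<longlongrightarrow> ?D x) (at 0)" for x
      using smooth_line_derivative[OF R(1), of x e 0 UNIV] by (simp add: DERIV_def)
    then show "AE x in lborel. ((\<lambda>t. u x * ((\<phi> (x + t *\<^sub>R e) - \<phi> x) / t)) \<longlongrightarrow> u x * ?D x) (at 0)"
      by (intro AE_I2 tendsto_mult tendsto_const)
    fix t :: real assume t: "t \<noteq> 0" "\<bar>t\<bar> \<le> 1"
    have q: "\<bar>(\<phi> (x + t *\<^sub>R e) - \<phi> x) / t\<bar> \<le> B * ?I x" for x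
    proof (cases "norm x \<le> R + norm e")
      case True
      have "norm (\<phi> (x + t *\<^sub>R e) - \<phi> (x + 0 *\<^sub>R e)) \<le> B * norm (t - 0)"
        by (rule field_differentiable_bound[of UNIV "\<lambda>s. \<phi> (x + s *\<^sub>R e)"])
          (auto intro: smooth_line_derivative[OF R(1)] simp: B)
      then show ?thesis using True t by (simp add: field_simps)
    next
      case False
      have "norm (t *\<^sub>R e) \<le> norm e" using t by (simp add: mult_left_le_one_le)
      then have "norm (x + t *\<^sub>R e) > R"
        using norm_diff_ineq[of x "t *\<^sub>R e"] False by linarith
      moreover have "norm x > R" using False norm_ge_zero[of e] by linarith
      ultimately show ?thesis using R(3) B by simp
    qed
    have "\<bar>u x * ((\<phi> (x + t *\<^sub>R e) - \<phi> x) / t)\<bar> \<le> \<bar>u x * ?I x\<bar> * B" for x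
    proof -
      have "\<bar>u x * ((\<phi> (x + t *\<^sub>R e) - \<phi> x) / t)\<bar> \<le> \<bar>u x\<bar> * (B * ?I x)"
        unfolding abs_mult[of "u x"] by (intro mult_left_mono q) simp
      then show ?thesis by (simp add: abs_mult mult_ac)
    qed
    then show "AE x in lborel. \<bar>u x * ((\<phi> (x + t *\<^sub>R e) - \<phi> x) / t)\<bar> \<le> \<bar>u x * ?I x\<bar> * B"
      by simp
  qed measurable
  then show ?thesis by simp
qed

text \<open>One direction at a time, because the difference quotients shift along a single axis;
  membership of both functions in L2 is built in.\<close>

definition weak_partial :: "3 \<Rightarrow> (R3 \<Rightarrow> real) \<Rightarrow> (R3 \<Rightarrow> real) \<Rightarrow> bool" where
  "weak_partial i u k \<longleftrightarrow> u \<in> L2 \<and> k \<in> L2 \<and> (\<forall>\<phi>\<in>test_functions.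
     (LINT x|lborel. u x * frechet_derivative \<phi> (at x) (axis i 1)) = - (LINT x|lborel. k x * \<phi> x))"

lemma weak_partialD:
  assumes "weak_partial i u k"
  shows "u \<in> L2" "k \<in> L2" "\<And>\<phi>. \<phi> \<in> test_functions \<Longrightarrow>
    (LINT x|lborel. u x * frechet_derivative \<phi> (at x) (axis i 1)) = - (LINT x|lborel. k x * \<phi> x)"
  using assms by (auto simp: weak_partial_def)

lemma L2_mult_diff_right:
  fixes u v w :: "R3 \<Rightarrow> real"
  assumes "u \<in> L2" "v \<in> L2" "w \<in> L2"
  shows "(LINT x|lborel. u x * (v x - w x)) = (LINT x|lborel. u x * v x) - (LINT x|lborel. u x * w x)"
  using L2_integrable_mult assms by (simp add: right_diff_distrib)

lemma L2_mult_diff_left: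
  fixes u v w :: "R3 \<Rightarrow> real"
  assumes "u \<in> L2" "v \<in> L2" "w \<in> L2"
  shows "(LINT x|lborel. (v x - w x) * u x) = (LINT x|lborel. v x * u x) - (LINT x|lborel. w x * u x)"
  using L2_integrable_mult assms by (simp add: left_diff_distrib)

lemma integral_mult_translate:
  assumes "u \<in> L2" "v \<in> L2"
  shows "(LINT x|lborel. u (x + c) * v x) = (LINT x|lborel. u x * v (x - c) :: real)"
proof -
  have [measurable]: "u \<in> borel_measurable lborel" "(\<lambda>x. v (x - c)) \<in> borel_measurable lborel"
    using assms L2_measurable[OF L2_translate, of v "-c"] by (auto dest: L2_measurable)
  show ?thesis
    using integral_translate[of "\<lambda>x. u x * v (x - c)" c] by simp
qed

lemma L2_cauchy_schwarz_real:
  fixes u v :: "R3 \<Rightarrow> real"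
  assumes "u \<in> L2" "v \<in> L2"
  shows "\<bar>LINT x|lborel. u x * v x\<bar> \<le> norm (abs_l2 u) * norm (abs_l2 v)"
  using L2_cauchy_schwarz[OF assms] by simp

text \<open>Translates of test functions are test functions, so the defining identity of the weak
  derivative computes the derivative at every \<open>t\<close>, not only at 0.\<close>

lemma test_translate_derivative:
  assumes u: "weak_partial i u k" and \<phi>: "\<phi> \<in> test_functions"
  shows "((\<lambda>t. LINT x|lborel. u x * \<phi> (x + t *\<^sub>R axis i 1)) has_real_derivative
    - (LINT x|lborel. k x * \<phi> (x + t *\<^sub>R axis i 1))) (at t)"
proof -
  let ?\<phi> = "\<lambda>t x. \<phi> (x + t *\<^sub>R axis i 1)"
  have test: "?\<phi> t \<in> test_functions" for t by (rule test_functions_translate[OF \<phi>])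
  have "((\<lambda>h. (LINT x|lborel. u x * (?\<phi> t (x + h *\<^sub>R axis i 1) - ?\<phi> t x)) / h) \<longlongrightarrow>
      - (LINT x|lborel. k x * ?\<phi> t x)) (at 0)"
    using test_difference_quotient[OF weak_partialD(1)[OF u] test[of t], of "axis i 1"]
    unfolding weak_partialD(3)[OF u test] .
  moreover have "(LINT x|lborel. u x * (?\<phi> t (x + h *\<^sub>R axis i 1) - ?\<phi> t x))
      = (LINT x|lborel. u x * ?\<phi> (t + h) x) - (LINT x|lborel. u x * ?\<phi> t x)" for h
    using L2_mult_diff_right[OF weak_partialD(1)[OF u] test_functions_L2[OF test[of "t + h"]] test_functions_L2[OF test[of t]]]
    by (simp add: algebra_simps)
  ultimately show ?thesis unfolding DERIV_def by simp
qed

lemma filterlim_uminus_at_0: "filterlim (\<lambda>t. - t) (at 0) (at (0::real))"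
  by (simp add: filterlim_at tendsto_minus_cancel_left[symmetric] eventually_at_filter)

text \<open>Pairing the increment with a test function moves the shift onto that function; the
  pairing is then differentiable in the shift with derivative at most \<open>|k| |\<phi>|\<close>,
  and the mean value inequality applies. Density of the test functions upgrades this to a norm
  bound.\<close>

lemma norm_translate_diff_le:
  assumes u: "weak_partial i u k"
  shows "norm (abs_l2 (\<lambda>x. u (x + t *\<^sub>R axis i 1) - u x)) \<le> \<bar>t\<bar> * norm (abs_l2 k)"
proof -
  let ?d = "\<lambda>x. u (x + t *\<^sub>R axis i 1) - u x"
  note uL = weak_partialD(1)[OF u] and kL = weak_partialD(2)[OF u]
  have dL: "?d \<in> L2" by (intro L2_diff L2_translate uL)
  have test: "abs_l2 ?d \<bullet> f \<le> \<bar>t\<bar> * norm (abs_l2 k) * norm f" if f: "f \<in> abs_l2 ` test_functions" for f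
  proof -
    obtain \<phi> where \<phi>: "\<phi> \<in> test_functions" "f = abs_l2 \<phi>" using f by blast
    note \<phi>L = test_functions_L2[OF \<phi>(1)]
    let ?F = "\<lambda>s. LINT x|lborel. u x * \<phi> (x + s *\<^sub>R axis i 1)"
    have "\<bar>LINT x|lborel. k x * \<phi> (x + s *\<^sub>R axis i 1)\<bar> \<le> norm (abs_l2 k) * norm f" for s
    proof -
      have "(norm (abs_l2 (\<lambda>x. \<phi> (x + s *\<^sub>R axis i 1))))\<^sup>2 = (norm f)\<^sup>2"
        using integral_translate[of "\<lambda>x. (\<phi> x)\<^sup>2" "s *\<^sub>R axis i 1"] L2_measurable[OF \<phi>L]
        by (simp add: norm_abs_l2 L2_translate \<phi>L \<phi>(2))
      then have "norm (abs_l2 (\<lambda>x. \<phi> (x + s *\<^sub>R axis i 1))) = norm f" by simp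
      then show ?thesis using L2_cauchy_schwarz_real[OF kL L2_translate[OF \<phi>L, of "s *\<^sub>R axis i 1"]] by simp
    qed
    then have "norm (?F (- t) - ?F 0) \<le> (norm (abs_l2 k) * norm f) * norm (- t - 0)"
      by (intro field_differentiable_bound[of UNIV])
        (auto intro!: DERIV_subset[OF test_translate_derivative[OF u \<phi>(1)]])
    moreover have "abs_l2 ?d \<bullet> f = ?F (- t) - ?F 0"
      using L2_mult_diff_left[OF \<phi>L L2_translate[OF uL, of "t *\<^sub>R axis i 1"] uL]
      by (simp add: \<phi>(2) inner_abs_l2 dL \<phi>L integral_mult_translate uL)
    ultimately show ?thesis by (simp add: mult_ac)
  qed
  have "abs_l2 ?d \<in> closure (abs_l2 ` test_functions)" by (simp add: closure_test_functions)
  then obtain f where f: "\<And>n. f n \<in> abs_l2 ` test_functions" "f \<longlonglongrightarrow> abs_l2 ?d"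
    by (auto simp: closure_sequential)
  have "abs_l2 ?d \<bullet> abs_l2 ?d \<le> \<bar>t\<bar> * norm (abs_l2 k) * norm (abs_l2 ?d)"
  proof (rule LIMSEQ_le)
    show "(\<lambda>n. abs_l2 ?d \<bullet> f n) \<longlonglongrightarrow> abs_l2 ?d \<bullet> abs_l2 ?d"
      by (intro tendsto_inner tendsto_const f(2))
    show "(\<lambda>n. \<bar>t\<bar> * norm (abs_l2 k) * norm (f n)) \<longlonglongrightarrow> \<bar>t\<bar> * norm (abs_l2 k) * norm (abs_l2 ?d)"
      by (intro tendsto_mult tendsto_norm tendsto_const f(2))
    show "\<exists>N. \<forall>n\<ge>N. abs_l2 ?d \<bullet> f n \<le> \<bar>t\<bar> * norm (abs_l2 k) * norm (f n)"
      by (intro exI[of _ 0] allI impI test f(1))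
  qed
  then have "norm (abs_l2 ?d) * norm (abs_l2 ?d) \<le> (\<bar>t\<bar> * norm (abs_l2 k)) * norm (abs_l2 ?d)"
    by (simp only: power2_norm_eq_inner[symmetric] power2_eq_square)
  then show ?thesis
    by (cases "norm (abs_l2 ?d) = 0") (auto dest: mult_right_le_imp_le)
qed

text \<open>Weak L2 convergence of the difference quotients. Against test functions it follows from
  the derivative above; as the quotients are bounded in norm by that of \<open>k\<close>, an
  argument with three small errors reaches every \<open>v\<close> in L2.\<close>

lemma translate_quotient_tendsto:
  assumes u: "weak_partial i u k" and v: "v \<in> L2"
  shows "((\<lambda>t. (LINT x|lborel. (u (x + t *\<^sub>R axis i 1) - u x) * v x) / t) \<longlongrightarrow>
    (LINT x|lborel. k x * v x)) (at 0)"
proof -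
  note uL = weak_partialD(1)[OF u] and kL = weak_partialD(2)[OF u]
  let ?d = "\<lambda>t x. u (x + t *\<^sub>R axis i 1) - u x"
  let ?q = "\<lambda>t f. (abs_l2 (?d t) \<bullet> f) / t"
  have dL: "?d t \<in> L2" for t by (intro L2_diff L2_translate uL)
  have test: "((\<lambda>t. ?q t (abs_l2 \<phi>)) \<longlongrightarrow> abs_l2 k \<bullet> abs_l2 \<phi>) (at 0)" if \<phi>: "\<phi> \<in> test_functions" for \<phi>
  proof -
    note \<phi>L = test_functions_L2[OF \<phi>]
    let ?F = "\<lambda>s. LINT x|lborel. u x * \<phi> (x + s *\<^sub>R axis i 1)"
    have "((\<lambda>h. (?F (0 + h) - ?F 0) / h) \<longlongrightarrow> - (LINT x|lborel. k x * \<phi> x)) (at 0)"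
      using test_translate_derivative[OF u \<phi>, of 0] unfolding DERIV_def by simp
    then have "((\<lambda>t. (?F (0 + - t) - ?F 0) / - t) \<longlongrightarrow> - (LINT x|lborel. k x * \<phi> x)) (at 0)"
      by (rule filterlim_compose[OF _ filterlim_uminus_at_0])
    then have "((\<lambda>t. - ((?F (- t) - ?F 0) / - t)) \<longlongrightarrow> - (- (LINT x|lborel. k x * \<phi> x))) (at 0)"
      by (intro tendsto_minus) simp
    moreover have "abs_l2 (?d t) \<bullet> abs_l2 \<phi> = ?F (- t) - ?F 0" for t
      using L2_mult_diff_left[OF \<phi>L L2_translate[OF uL, of "t *\<^sub>R axis i 1"] uL]
      by (simp add: inner_abs_l2 dL \<phi>L integral_mult_translate uL)
    ultimately show ?thesis by (simp add: inner_abs_l2 kL \<phi>L)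
  qed
  have "((\<lambda>t. ?q t (abs_l2 v)) \<longlongrightarrow> abs_l2 k \<bullet> abs_l2 v) (at 0)"
  proof (rule tendstoI)
    fix \<epsilon> :: real assume \<epsilon>: "\<epsilon> > 0"
    \<comment> \<open>Adding 1 keeps the divisor positive when \<open>k\<close> vanishes.\<close>
    define K where "K = norm (abs_l2 k) + 1"
    have K: "K > 0" "norm (abs_l2 k) \<le> K" by (auto simp: K_def add_nonneg_pos)
    have "abs_l2 v \<in> closure (abs_l2 ` test_functions)" by (simp add: closure_test_functions)
    moreover have "\<epsilon> / (3 * K) > 0" using \<epsilon> K by simp
    ultimately obtain \<phi> where \<phi>: "\<phi> \<in> test_functions" "dist (abs_l2 \<phi>) (abs_l2 v) < \<epsilon> / (3 * K)"
      unfolding closure_approachable by blast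
    define r where "r = abs_l2 v - abs_l2 \<phi>"
    have r: "norm r * K < \<epsilon> / 3"
      using \<phi>(2) K by (simp add: r_def dist_norm norm_minus_commute field_simps)
    have rk: "\<bar>abs_l2 k \<bullet> r\<bar> < \<epsilon> / 3"
      using Cauchy_Schwarz_ineq2[of "abs_l2 k" r] mult_right_mono[OF K(2) norm_ge_zero[of r]] r
      by (simp add: mult.commute)
    have "\<forall>\<^sub>F t in at 0. dist (?q t (abs_l2 \<phi>)) (abs_l2 k \<bullet> abs_l2 \<phi>) < \<epsilon> / 3"
      using \<epsilon> by (intro tendstoD[OF test[OF \<phi>(1)]]) simp
    moreover have "\<forall>\<^sub>F t in at 0. t \<noteq> (0::real)" by (simp add: eventually_at_filter)
    ultimately show "\<forall>\<^sub>F t in at 0. dist (?q t (abs_l2 v)) (abs_l2 k \<bullet> abs_l2 v) < \<epsilon>"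
    proof eventually_elim
      fix t :: real assume 1: "dist (?q t (abs_l2 \<phi>)) (abs_l2 k \<bullet> abs_l2 \<phi>) < \<epsilon> / 3" and t: "t \<noteq> 0"
      have "\<bar>abs_l2 (?d t) \<bullet> r\<bar> \<le> norm (abs_l2 (?d t)) * norm r" by (rule Cauchy_Schwarz_ineq2)
      also have "\<dots> \<le> (\<bar>t\<bar> * norm (abs_l2 k)) * norm r"
        by (intro mult_right_mono norm_translate_diff_le[OF u] norm_ge_zero)
      also have "\<dots> \<le> (\<bar>t\<bar> * K) * norm r"
        by (intro mult_right_mono mult_left_mono K norm_ge_zero abs_ge_zero)
      finally have "\<bar>?q t r\<bar> \<le> K * norm r" using t by (simp add: field_simps)
      then have 2: "\<bar>?q t r\<bar> < \<epsilon> / 3" using r by (simp add: mult.commute)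
      have 3: "?q t (abs_l2 v) = ?q t (abs_l2 \<phi>) + ?q t r"
        by (simp add: r_def inner_diff_right diff_divide_distrib)
      have 4: "abs_l2 k \<bullet> abs_l2 v = abs_l2 k \<bullet> abs_l2 \<phi> + abs_l2 k \<bullet> r"
        by (simp add: r_def inner_diff_right)
      have tri: "\<bar>a + b - (c + d)\<bar> < \<epsilon>" if "\<bar>a - c\<bar> < \<epsilon> / 3" "\<bar>b\<bar> < \<epsilon> / 3" "\<bar>d\<bar> < \<epsilon> / 3" for a b c d :: real
        using that by linarith
      show "dist (?q t (abs_l2 v)) (abs_l2 k \<bullet> abs_l2 v) < \<epsilon>"
        unfolding dist_real_def 3 4 by (rule tri[OF 1[unfolded dist_real_def] 2 rk])
    qed
  qed
  then show ?thesis by (simp only: inner_abs_l2[OF dL v] inner_abs_l2[OF kL v] inner_real_def)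
qed

text \<open>Converse of the preceding convergence: shifting the quotient back onto the test function
  recovers the definition. The product rule is proved through this criterion.\<close>

lemma weak_partialI_translate:
  assumes uL: "u \<in> L2" and kL: "k \<in> L2"
    and lim: "\<And>\<phi>. \<phi> \<in> test_functions \<Longrightarrow>
      ((\<lambda>t. (LINT x|lborel. (u (x + t *\<^sub>R axis i 1) - u x) * \<phi> x) / t) \<longlongrightarrow> (LINT x|lborel. k x * \<phi> x)) (at 0)"
  shows "weak_partial i u k"
  unfolding weak_partial_def
proof (intro conjI ballI uL kL)
  fix \<phi> assume \<phi>: "\<phi> \<in> test_functions"
  note \<phi>L = test_functions_L2[OF \<phi>]
  let ?e = "axis i 1 :: R3"
  let ?F = "\<lambda>s. LINT x|lborel. u x * (\<phi> (x + s *\<^sub>R ?e) - \<phi> x)"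
  from filterlim_compose[OF test_difference_quotient[OF uL \<phi>, of ?e] filterlim_uminus_at_0]
  have "((\<lambda>t. - (?F (- t) / - t)) \<longlongrightarrow> - (LINT x|lborel. u x * frechet_derivative \<phi> (at x) ?e)) (at 0)"
    by (intro tendsto_minus) simp
  moreover have "(LINT x|lborel. (u (x + t *\<^sub>R ?e) - u x) * \<phi> x) = ?F (- t)" for t
    using L2_mult_diff_left[OF \<phi>L L2_translate[OF uL, of "t *\<^sub>R ?e"] uL]
      L2_mult_diff_right[OF uL L2_translate[OF \<phi>L, of "- t *\<^sub>R ?e"] \<phi>L]
    by (simp add: integral_mult_translate uL \<phi>L)
  ultimately have "((\<lambda>t. (LINT x|lborel. (u (x + t *\<^sub>R ?e) - u x) * \<phi> x) / t) \<longlongrightarrow>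
      - (LINT x|lborel. u x * frechet_derivative \<phi> (at x) ?e)) (at 0)" by simp
  from tendsto_unique[OF _ lim[OF \<phi>] this]
  show "(LINT x|lborel. u x * frechet_derivative \<phi> (at x) ?e) = - (LINT x|lborel. k x * \<phi> x)" by simp
qed

text \<open>The definition only allows a test function as second factor. Translation invariance
  turns a shift of \<open>u\<close> by \<open>t\<close> into a shift of \<open>v\<close> by
  \<open>-t\<close>, and both quotients converge by
  \<open>translate_quotient_tendsto\<close>.\<close>

lemma weak_partial_integration_by_parts:
  assumes u: "weak_partial i u k" and v: "weak_partial i v l"
  shows "(LINT x|lborel. k x * v x) = - (LINT x|lborel. u x * l x)"
proof -
  note uL = weak_partialD(1)[OF u] and vL = weak_partialD(1)[OF v]
  let ?e = "axis i 1 :: R3"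
  from filterlim_compose[OF translate_quotient_tendsto[OF v uL] filterlim_uminus_at_0]
  have "((\<lambda>t. - ((LINT x|lborel. (v (x + - t *\<^sub>R ?e) - v x) * u x) / - t)) \<longlongrightarrow> - (LINT x|lborel. l x * u x)) (at 0)"
    by (intro tendsto_minus) simp
  moreover have "(LINT x|lborel. (v (x + - t *\<^sub>R ?e) - v x) * u x) = (LINT x|lborel. (u (x + t *\<^sub>R ?e) - u x) * v x)" for t
    using L2_mult_diff_left[OF vL L2_translate[OF uL, of "t *\<^sub>R ?e"] uL]
      L2_mult_diff_left[OF uL L2_translate[OF vL, of "- t *\<^sub>R ?e"] vL]
      integral_mult_translate[OF vL uL, of "- t *\<^sub>R ?e"]
    by (simp add: mult.commute)
  ultimately have "((\<lambda>t. (LINT x|lborel. (u (x + t *\<^sub>R ?e) - u x) * v x) / t) \<longlongrightarrow> - (LINT x|lborel. l x * u x)) (at 0)"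
    by simp
  from tendsto_unique[OF _ translate_quotient_tendsto[OF u vL] this]
  show ?thesis by (simp add: mult.commute)
qed

lemma weak_partial_unique:
  assumes "weak_partial i u k" "weak_partial i u' k'" "AE x in lborel. u x = u' x"
  shows "AE x in lborel. k x = k' x"
proof -
  have "AE x in lborel. k x - k' x = 0"
  proof (rule AE_zero_if_orthogonal_test_functions)
    show "(\<lambda>x. k x - k' x) \<in> L2" using assms by (intro L2_diff weak_partialD)
    fix \<phi> assume \<phi>: "\<phi> \<in> test_functions"
    note D = test_functions_L2[OF test_functions_derivative[OF \<phi>, of "axis i 1"]]
    have [measurable]: "u \<in> borel_measurable lborel" "u' \<in> borel_measurable lborel"
        "(\<lambda>x. frechet_derivative \<phi> (at x) (axis i 1)) \<in> borel_measurable lborel"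
      using assms weak_partialD(1) D L2_measurable by blast+
    have "(LINT x|lborel. u x * frechet_derivative \<phi> (at x) (axis i 1))
        = (LINT x|lborel. u' x * frechet_derivative \<phi> (at x) (axis i 1))"
      using assms(3) by (intro integral_cong_AE) auto
    then show "(LINT x|lborel. (k x - k' x) * \<phi> x) = 0"
      using weak_partialD(3)[OF assms(1) \<phi>] weak_partialD(3)[OF assms(2) \<phi>]
        L2_mult_diff_left[OF test_functions_L2[OF \<phi>] weak_partialD(2)[OF assms(1)] weak_partialD(2)[OF assms(2)]]
      by linarith
  qed
  then show ?thesis by simp
qed

lemma weak_partial_inner_iff:
  "weak_partial i u k \<longleftrightarrow> u \<in> L2 \<and> k \<in> L2 \<and> (\<forall>\<phi>\<in>test_functions.
    abs_l2 u \<bullet> abs_l2 (\<lambda>x. frechet_derivative \<phi> (at x) (axis i 1)) = - (abs_l2 k \<bullet> abs_l2 \<phi>))"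
proof -
  have "abs_l2 u \<bullet> abs_l2 (\<lambda>x. frechet_derivative \<phi> (at x) (axis i 1))
      = (LINT x|lborel. u x * frechet_derivative \<phi> (at x) (axis i 1))"
    and "abs_l2 k \<bullet> abs_l2 \<phi> = (LINT x|lborel. k x * \<phi> x)"
    if "u \<in> L2" "k \<in> L2" "\<phi> \<in> test_functions" for \<phi>
    using that test_functions_derivative test_functions_L2 by (simp_all add: inner_abs_l2)
  then show ?thesis
    unfolding weak_partial_def by (intro conj_cong refl ball_cong) simp_all
qed

lemma weak_partial_lincomb:
  assumes "weak_partial i u k" "weak_partial i v l"
  shows "weak_partial i (\<lambda>x. u x + c * v x) (\<lambda>x. k x + c * l x)"
proof -
  note L = weak_partialD(1,2)[OF assms(1)] weak_partialD(1,2)[OF assms(2)]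
  have c: "(\<lambda>x. c * v x) \<in> L2" "(\<lambda>x. c * l x) \<in> L2"
    using L2_scaleR[OF L(3), of c] L2_scaleR[OF L(4), of c] by simp_all
  have "abs_l2 (\<lambda>x. u x + c * v x) = abs_l2 u + c *\<^sub>R abs_l2 v"
    "abs_l2 (\<lambda>x. k x + c * l x) = abs_l2 k + c *\<^sub>R abs_l2 l"
    using L c by (simp_all add: abs_l2_add abs_l2_scaleR)
  then show ?thesis
    using assms c L unfolding weak_partial_inner_iff by (simp add: L2_add inner_add_left)
qed

text \<open>For a fixed test function both sides of the defining identity are L2-continuous. This is
  the source of the completeness of H1.\<close>

lemma weak_partial_closed:
  assumes "\<And>n. weak_partial i (u n) (k n)" "v \<in> L2" "l \<in> L2"
    and "(\<lambda>n. abs_l2 (u n)) \<longlonglongrightarrow> abs_l2 v" "(\<lambda>n. abs_l2 (k n)) \<longlonglongrightarrow> abs_l2 l"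
  shows "weak_partial i v l"
  unfolding weak_partial_inner_iff
proof (intro conjI ballI assms(2,3))
  fix \<phi> assume \<phi>: "\<phi> \<in> test_functions"
  let ?D = "abs_l2 (\<lambda>x. frechet_derivative \<phi> (at x) (axis i 1))"
  have "(\<lambda>n. abs_l2 (u n) \<bullet> ?D) \<longlonglongrightarrow> abs_l2 v \<bullet> ?D"
    by (intro tendsto_inner assms tendsto_const)
  moreover have "(\<lambda>n. - (abs_l2 (k n) \<bullet> abs_l2 \<phi>)) \<longlonglongrightarrow> - (abs_l2 l \<bullet> abs_l2 \<phi>)"
    by (intro tendsto_minus tendsto_inner assms tendsto_const)
  moreover have "abs_l2 (u n) \<bullet> ?D = - (abs_l2 (k n) \<bullet> abs_l2 \<phi>)" for n
    using assms(1)[of n] \<phi> unfolding weak_partial_inner_iff by blast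
  ultimately show "abs_l2 v \<bullet> ?D = - (abs_l2 l \<bullet> abs_l2 \<phi>)"
    using LIMSEQ_unique by simp
qed

lemma norm_abs_l2_mono:
  fixes u :: "R3 \<Rightarrow> 'b::euclidean_space" and v :: "R3 \<Rightarrow> 'c::euclidean_space"
  assumes "u \<in> L2" "v \<in> L2" "0 \<le> C" "\<And>x. norm (u x) \<le> C * norm (v x)"
  shows "norm (abs_l2 u) \<le> C * norm (abs_l2 v)"
proof -
  have "(norm (abs_l2 u))\<^sup>2 \<le> (LINT x|lborel. C\<^sup>2 * (norm (v x))\<^sup>2)"
    unfolding norm_abs_l2[OF assms(1)]
  proof (intro integral_mono)
    fix x show "(norm (u x))\<^sup>2 \<le> C\<^sup>2 * (norm (v x))\<^sup>2"
      using power_mono[OF assms(4)[of x] norm_ge_zero, of 2] by (simp add: power_mult_distrib)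
  qed (use assms L2_integrable in auto)
  also have "\<dots> = (C * norm (abs_l2 v))\<^sup>2"
    by (simp add: norm_abs_l2[OF assms(2)] power_mult_distrib)
  finally show ?thesis by (rule power2_le_imp_le) (simp add: assms(3))
qed

text \<open>The multiplier only has to be Lipschitz, so that truncated radial profiles are admissible.\<close>

lemma weak_partial_mult_lipschitz:
  assumes u: "weak_partial i u k"
    and meas [measurable]: "\<eta> \<in> borel_measurable lborel" "d \<in> borel_measurable lborel"
    and C: "\<And>x. \<bar>\<eta> x\<bar> \<le> C" and B: "\<And>x. \<bar>d x\<bar> \<le> B"
    and lip: "\<And>x t. \<bar>\<eta> (x + t *\<^sub>R axis i 1) - \<eta> x\<bar> \<le> B * \<bar>t\<bar>"
    and lim: "AE x in lborel. ((\<lambda>t. (\<eta> (x + t *\<^sub>R axis i 1) - \<eta> x) / t) \<longlongrightarrow> d x) (at 0)"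
  shows "weak_partial i (\<lambda>x. \<eta> x * u x) (\<lambda>x. \<eta> x * k x + d x * u x)"
proof (rule weak_partialI_translate)
  let ?e = "axis i 1 :: R3"
  note uL = weak_partialD(1)[OF u] and kL = weak_partialD(2)[OF u]
  have B0: "0 \<le> B" using B[of 0] by linarith
  show vL: "(\<lambda>x. \<eta> x * u x) \<in> L2" by (rule L2_bounded_mult[OF uL meas(1) C])
  have duL: "(\<lambda>x. d x * u x) \<in> L2" by (rule L2_bounded_mult[OF uL meas(2) B])
  have ekL: "(\<lambda>x. \<eta> x * k x) \<in> L2" by (rule L2_bounded_mult[OF kL meas(1) C])
  show "(\<lambda>x. \<eta> x * k x + d x * u x) \<in> L2" by (rule L2_add[OF ekL duL])
  have [measurable]: "u \<in> borel_measurable lborel" "k \<in> borel_measurable lborel"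
    using uL kL L2_measurable by blast+
  have [measurable]: "(\<lambda>x. \<eta> (x + t *\<^sub>R ?e)) \<in> borel_measurable lborel" for t
    by (rule measurable_translate[OF meas(1)])
  fix \<phi> assume \<phi>: "\<phi> \<in> test_functions"
  note \<phi>L = test_functions_L2[OF \<phi>]
  have [measurable]: "\<phi> \<in> borel_measurable lborel" using \<phi>L L2_measurable by blast
  have epL: "(\<lambda>x. \<eta> x * \<phi> x) \<in> L2" by (rule L2_bounded_mult[OF \<phi>L meas(1) C])
  let ?q = "\<lambda>t x. (\<eta> (x + t *\<^sub>R ?e) - \<eta> x) / t"
  let ?d = "\<lambda>t x. u (x + t *\<^sub>R ?e) - u x"
  have qB: "\<bar>?q t x\<bar> \<le> B" for t x
    using lip[of x t] B0 by (cases "t = 0") (simp_all add: field_simps)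
  have qL: "(\<lambda>x. ?q t x * \<phi> x) \<in> L2" for t
    by (rule L2_bounded_mult[OF \<phi>L _ qB]) measurable
  have dL: "?d t \<in> L2" for t by (intro L2_diff L2_translate uL)
  \<comment> \<open>Discrete Leibniz rule: the quotient of \<open>\<eta> u\<close> splits into
    \<open>\<eta>\<close> times the quotient of \<open>u\<close>, \<open>u\<close> times the
    quotient of \<open>\<eta>\<close>, and the quotient of \<open>\<eta>\<close> times the increment
    of \<open>u\<close>. The facts \<open>1\<close>, \<open>2\<close>, \<open>3\<close> are the
    three limits; the last is 0 since that quotient is bounded by \<open>B\<close> and the increment
    is of order \<open>t\<close> in L2.\<close>
  have 1: "((\<lambda>t. (LINT x|lborel. ?d t x * (\<eta> x * \<phi> x)) / t) \<longlongrightarrow> (LINT x|lborel. k x * (\<eta> x * \<phi> x))) (at 0)"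
    by (rule translate_quotient_tendsto[OF u epL])
  have 2: "((\<lambda>t. LINT x|lborel. (?q t x * \<phi> x) * u x) \<longlongrightarrow> (LINT x|lborel. (d x * \<phi> x) * u x)) (at 0)"
  proof (rule dominated_convergence_at_0[where w = "\<lambda>x. B * \<bar>\<phi> x * u x\<bar>"])
    show "integrable lborel (\<lambda>x. B * \<bar>\<phi> x * u x\<bar>)"
      using L2_integrable_mult[OF \<phi>L uL] by simp
    show "AE x in lborel. ((\<lambda>t. ?q t x * \<phi> x * u x) \<longlongrightarrow> d x * \<phi> x * u x) (at 0)"
      using lim by eventually_elim (intro tendsto_mult tendsto_const)
    have "\<bar>?q t x * \<phi> x * u x\<bar> \<le> B * \<bar>\<phi> x * u x\<bar>" for t x
      using mult_right_mono[OF qB[where x = x and t = t] abs_ge_zero[of "\<phi> x * u x"]]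
      by (simp only: abs_mult mult.assoc)
    then show "AE x in lborel. \<bar>?q t x * \<phi> x * u x\<bar> \<le> B * \<bar>\<phi> x * u x\<bar>" for t by simp
  qed measurable
  have 3: "((\<lambda>t. LINT x|lborel. (?q t x * \<phi> x) * ?d t x) \<longlongrightarrow> 0) (at 0)"
  proof (rule Lim_null_comparison)
    have "norm (LINT x|lborel. (?q t x * \<phi> x) * ?d t x) \<le> (B * norm (abs_l2 \<phi>)) * (\<bar>t\<bar> * norm (abs_l2 k))" for t
    proof -
      have "norm (abs_l2 (\<lambda>x. ?q t x * \<phi> x)) \<le> B * norm (abs_l2 \<phi>)"
        using mult_right_mono[OF qB[where t = t] abs_ge_zero] B0
        by (intro norm_abs_l2_mono qL \<phi>L) (simp_all only: abs_mult real_norm_def)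
      then have "norm (abs_l2 (\<lambda>x. ?q t x * \<phi> x)) * norm (abs_l2 (?d t)) \<le> (B * norm (abs_l2 \<phi>)) * (\<bar>t\<bar> * norm (abs_l2 k))"
        using B0 by (intro mult_mono norm_translate_diff_le[OF u]) auto
      then show ?thesis
        using L2_cauchy_schwarz_real[OF qL dL, of t t] by simp
    qed
    then show "\<forall>\<^sub>F t in at 0. norm (LINT x|lborel. (?q t x * \<phi> x) * ?d t x) \<le> (B * norm (abs_l2 \<phi>)) * (\<bar>t\<bar> * norm (abs_l2 k))"
      by (intro always_eventually allI)
    show "((\<lambda>t. (B * norm (abs_l2 \<phi>)) * (\<bar>t\<bar> * norm (abs_l2 k))) \<longlongrightarrow> 0) (at (0::real))"
      by (intro tendsto_mult_right_zero tendsto_mult_left_zero) (simp add: tendsto_rabs_zero_iff)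
  qed
  have "(LINT x|lborel. (\<eta> (x + t *\<^sub>R ?e) * u (x + t *\<^sub>R ?e) - \<eta> x * u x) * \<phi> x) / t
      = (LINT x|lborel. ?d t x * (\<eta> x * \<phi> x)) / t + ((LINT x|lborel. (?q t x * \<phi> x) * u x)
        + (LINT x|lborel. (?q t x * \<phi> x) * ?d t x))" if t: "t \<noteq> 0" for t
  proof -
    have i1: "integrable lborel (\<lambda>x. ?d t x * (\<eta> x * \<phi> x) / t)"
      by (intro integrable_divide L2_integrable_mult dL epL)
    have i2: "integrable lborel (\<lambda>x. (?q t x * \<phi> x) * u x)"
      by (rule L2_integrable_mult[OF qL uL])
    have i3: "integrable lborel (\<lambda>x. (?q t x * \<phi> x) * ?d t x)"
      by (rule L2_integrable_mult[OF qL dL])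
    have "(LINT x|lborel. ?d t x * (\<eta> x * \<phi> x)) / t + ((LINT x|lborel. (?q t x * \<phi> x) * u x)
        + (LINT x|lborel. (?q t x * \<phi> x) * ?d t x))
        = (LINT x|lborel. ?d t x * (\<eta> x * \<phi> x) / t + ((?q t x * \<phi> x) * u x + (?q t x * \<phi> x) * ?d t x))"
      by (simp only: Bochner_Integration.integral_add[OF i1 Bochner_Integration.integrable_add[OF i2 i3]]
          Bochner_Integration.integral_add[OF i2 i3] integral_divide_zero)
    also have "\<dots> = (LINT x|lborel. ((\<eta> (x + t *\<^sub>R ?e) * u (x + t *\<^sub>R ?e) - \<eta> x * u x) * \<phi> x) / t)"
    proof (intro Bochner_Integration.integral_cong refl)
      fix x
      have "(U - v) * (b * p) / t + ((a - b) / t * p * v + (a - b) / t * p * (U - v)) = (a * U - b * v) * p / t"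
        for a b p U v :: real using t by (simp add: field_simps)
      then show "?d t x * (\<eta> x * \<phi> x) / t + ((?q t x * \<phi> x) * u x + (?q t x * \<phi> x) * ?d t x)
        = (\<eta> (x + t *\<^sub>R ?e) * u (x + t *\<^sub>R ?e) - \<eta> x * u x) * \<phi> x / t" .
    qed
    also have "\<dots> = (LINT x|lborel. (\<eta> (x + t *\<^sub>R ?e) * u (x + t *\<^sub>R ?e) - \<eta> x * u x) * \<phi> x) / t"
      by (rule integral_divide_zero)
    finally show ?thesis by (rule sym)
  qed
  then have ev: "\<forall>\<^sub>F t in at 0. (LINT x|lborel. ?d t x * (\<eta> x * \<phi> x)) / t + ((LINT x|lborel. (?q t x * \<phi> x) * u x)
        + (LINT x|lborel. (?q t x * \<phi> x) * ?d t x)) =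
      (LINT x|lborel. (\<eta> (x + t *\<^sub>R ?e) * u (x + t *\<^sub>R ?e) - \<eta> x * u x) * \<phi> x) / t"
    unfolding eventually_at_filter by (intro always_eventually allI impI) (rule sym)
  have "(LINT x|lborel. (\<eta> x * k x + d x * u x) * \<phi> x)
      = (LINT x|lborel. k x * (\<eta> x * \<phi> x) + (d x * \<phi> x) * u x)"
    by (intro Bochner_Integration.integral_cong refl) (simp add: field_simps)
  also have "\<dots> = (LINT x|lborel. k x * (\<eta> x * \<phi> x)) + ((LINT x|lborel. (d x * \<phi> x) * u x) + 0)"
    using Bochner_Integration.integral_add[OF L2_integrable_mult[OF kL epL] L2_integrable_mult[OF L2_bounded_mult[OF \<phi>L meas(2) B] uL]]
    by (simp only: add_0_right)
  finally have "(LINT x|lborel. (\<eta> x * k x + d x * u x) * \<phi> x)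
      = (LINT x|lborel. k x * (\<eta> x * \<phi> x)) + ((LINT x|lborel. (d x * \<phi> x) * u x) + 0)" .
  then show "((\<lambda>t. (LINT x|lborel. (\<eta> (x + t *\<^sub>R ?e) * u (x + t *\<^sub>R ?e) - \<eta> x * u x) * \<phi> x) / t) \<longlongrightarrow>
      (LINT x|lborel. (\<eta> x * k x + d x * u x) * \<phi> x)) (at 0)"
    by (simp only:) (rule Lim_transform_eventually[OF tendsto_add[OF 1 tendsto_add[OF 2 3]] ev])
qed

section \<open>A local Hardy inequality\<close>

text \<open>The radial profiles below are piecewise smooth; their kinks lie on finitely many
  spheres, which are null sets.\<close>

lemma AE_norm_notin:
  fixes c :: R3
  assumes "finite F"
  shows "AE x in lborel. norm (x - c) \<notin> F"
proof -
  have "AE x in lborel. \<forall>s\<in>F. norm (x - c) \<noteq> s"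
  proof (rule AE_finite_allI[OF assms])
    fix s
    have "sphere c s \<in> null_sets lborel"
      using negligible_sphere[of c s] by (simp add: negligible_iff_null_sets null_sets_completion_iff)
    then have "AE x in lborel. x \<notin> sphere c s" by (rule AE_not_in)
    then show "AE x in lborel. norm (x - c) \<noteq> s"
      by (simp add: sphere_def dist_norm norm_minus_commute)
  qed
  then show ?thesis by eventually_elim blast
qed

lemma norm_line_derivative:
  fixes y e :: "'a::real_inner"
  assumes "y \<noteq> 0"
  shows "((\<lambda>t. norm (y + t *\<^sub>R e)) has_real_derivative (y \<bullet> e) / norm y) (at 0)"
proof -
  have "((\<lambda>t. (y + t *\<^sub>R e) \<bullet> (y + t *\<^sub>R e)) has_real_derivative 2 * (y \<bullet> e)) (at 0)"
  proof -
    have "(\<lambda>t. (y + t *\<^sub>R e) \<bullet> (y + t *\<^sub>R e)) = (\<lambda>t. y \<bullet> y + 2 * (y \<bullet> e) * t + (e \<bullet> e) * t\<^sup>2)"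
      by (auto simp: inner_add_left inner_add_right inner_commute power2_eq_square algebra_simps)
    then show ?thesis by (auto intro!: derivative_eq_intros)
  qed
  moreover have "0 < (y + 0 *\<^sub>R e) \<bullet> (y + 0 *\<^sub>R e)" using assms by simp
  ultimately have "((\<lambda>t. sqrt ((y + t *\<^sub>R e) \<bullet> (y + t *\<^sub>R e))) has_real_derivative
      inverse (sqrt ((y + 0 *\<^sub>R e) \<bullet> (y + 0 *\<^sub>R e))) / 2 * (2 * (y \<bullet> e))) (at 0)"
    by (rule DERIV_chain2[OF DERIV_real_sqrt, rotated])
  then show ?thesis
    unfolding norm_eq_sqrt_inner by (simp add: field_simps)
qed

lemma radial_difference_quotient:
  fixes c x :: R3
  assumes k: "(k has_real_derivative k') (at (norm (x - c)))" and x: "x \<noteq> c"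
  shows "((\<lambda>t. (k (norm (x + t *\<^sub>R axis i 1 - c)) - k (norm (x - c))) / t) \<longlongrightarrow>
    k' * ((x - c) $ i / norm (x - c))) (at 0)"
proof -
  let ?N = "\<lambda>t. norm ((x - c) + t *\<^sub>R axis i 1)"
  have N: "(?N has_real_derivative (x - c) $ i / norm (x - c)) (at 0)"
    using norm_line_derivative[of "x - c" "axis i 1"] x by (simp add: inner_axis)
  have "(k has_real_derivative k') (at (?N 0))" using k by simp
  from DERIV_chain2[OF this N] show ?thesis
    unfolding DERIV_def by (simp add: algebra_simps)
qed

lemma norm_diff_line_le:
  fixes x c :: R3
  shows "\<bar>norm (x + t *\<^sub>R axis i 1 - c) - norm (x - c)\<bar> \<le> \<bar>t\<bar>"
  using norm_triangle_ineq3[of "x + t *\<^sub>R axis i 1 - c" "x - c"] by simp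

lemma DERIV_transform_interval:
  assumes "(f has_real_derivative D) (at s)" "a < s" "s < b" "\<And>t. a < t \<Longrightarrow> t < b \<Longrightarrow> f t = g t"
  shows "(g has_real_derivative D) (at s)"
  by (rule has_field_derivative_transform_within_open[OF assms(1), of "{a<..<b}"]) (use assms in auto)

text \<open>A relation instead of the chosen \<open>wgrad\<close>, so that explicitly computed
  gradients can be used.\<close>

definition has_gradient :: "(R3 \<Rightarrow> real) \<Rightarrow> (R3 \<Rightarrow> R3) \<Rightarrow> bool" where
  "has_gradient u g \<longleftrightarrow> u \<in> L2 \<and> g \<in> L2 \<and> weak_gradient u g"

lemma L2_component:
  fixes g :: "R3 \<Rightarrow> R3"
  assumes "g \<in> L2" shows "(\<lambda>x. g x $ i) \<in> L2"
proof (rule L2_dominated[OF assms])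
  have [measurable]: "g \<in> borel_measurable lborel" by (rule L2_measurable[OF assms])
  have "(\<lambda>x. g x \<bullet> axis i 1) \<in> borel_measurable lborel" by measurable
  then show "(\<lambda>x. g x $ i) \<in> borel_measurable lborel" by (simp add: inner_axis)
  show "norm (g x $ i) \<le> 1 * norm (g x)" for x using component_le_norm_cart by simp
qed

lemma measurable_vecI:
  fixes g :: "R3 \<Rightarrow> R3"
  assumes "\<And>i. (\<lambda>x. g x $ i) \<in> borel_measurable lborel"
  shows "g \<in> borel_measurable lborel"
  unfolding borel_measurable_euclidean_space[where f = g]
  using assms by (auto simp: Basis_vec_def inner_axis)

lemma norm_vec_square: "(norm (a :: R3))\<^sup>2 = (\<Sum>i\<in>UNIV. (a $ i)\<^sup>2)"
  unfolding power2_norm_eq_inner inner_vec_def by (simp add: power2_eq_square)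

lemma L2_vecI:
  fixes g :: "R3 \<Rightarrow> R3"
  assumes "\<And>i. (\<lambda>x. g x $ i) \<in> L2"
  shows "g \<in> L2"
proof (rule L2I)
  show "g \<in> borel_measurable lborel"
    using assms by (intro measurable_vecI L2_measurable)
  have "integrable lborel (\<lambda>x. \<Sum>i\<in>UNIV. (norm (g x $ i))\<^sup>2)"
    using assms by (intro Bochner_Integration.integrable_sum L2_integrable)
  then show "integrable lborel (\<lambda>x. (norm (g x))\<^sup>2)"
    by (simp add: norm_vec_square)
qed

lemma has_gradient_iff: "has_gradient u g \<longleftrightarrow> (\<forall>i. weak_partial i u (\<lambda>x. g x $ i))"
proof
  assume "has_gradient u g"
  then show "\<forall>i. weak_partial i u (\<lambda>x. g x $ i)"
    using L2_component by (auto simp: has_gradient_def weak_partial_def weak_gradient_def)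
next
  assume *: "\<forall>i. weak_partial i u (\<lambda>x. g x $ i)"
  then have "u \<in> L2" "\<And>i. (\<lambda>x. g x $ i) \<in> L2" using weak_partialD by blast+
  then show "has_gradient u g"
    using * L2_vecI[of g] by (simp add: has_gradient_def weak_partial_def weak_gradient_def)
qed

lemma has_gradient_mult_lipschitz:
  assumes u: "has_gradient u g"
    and meas: "\<eta> \<in> borel_measurable lborel" "\<And>i. (\<lambda>x. d x $ i) \<in> borel_measurable lborel"
    and "\<And>x. \<bar>\<eta> x\<bar> \<le> C" "\<And>x i. \<bar>d x $ i\<bar> \<le> B"
    and "\<And>x t i. \<bar>\<eta> (x + t *\<^sub>R axis i 1) - \<eta> x\<bar> \<le> B * \<bar>t\<bar>"
    and "\<And>i. AE x in lborel. ((\<lambda>t. (\<eta> (x + t *\<^sub>R axis i 1) - \<eta> x) / t) \<longlongrightarrow> d x $ i) (at 0)"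
  shows "has_gradient (\<lambda>x. \<eta> x * u x) (\<lambda>x. \<eta> x *\<^sub>R g x + u x *\<^sub>R d x)"
  unfolding has_gradient_iff
proof
  fix i
  have "weak_partial i (\<lambda>x. \<eta> x * u x) (\<lambda>x. \<eta> x * g x $ i + d x $ i * u x)"
    using u assms by (intro weak_partial_mult_lipschitz[where B = B and C = C]) (auto simp: has_gradient_iff)
  then show "weak_partial i (\<lambda>x. \<eta> x * u x) (\<lambda>x. (\<eta> x *\<^sub>R g x + u x *\<^sub>R d x) $ i)"
    by (simp add: mult.commute[of "u _"])
qed

lemma integrable_indicator_mult:
  fixes f :: "R3 \<Rightarrow> real"
  assumes "integrable lborel f" "A \<in> sets borel" shows "integrable lborel (\<lambda>x. indicator A x * f x)"
  using integrable_mult_indicator[of A lborel f] assms by simp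

lemma integrable_annulus:
  fixes u :: "R3 \<Rightarrow> real"
  assumes uL: "u \<in> L2" and r: "0 < r"
  shows "integrable lborel (\<lambda>x. if r < norm (x - c) \<and> norm (x - c) < \<rho> then (u x)\<^sup>2 / (norm (x - c))\<^sup>2 else 0)"
    (is "integrable lborel ?a")
proof (rule Bochner_Integration.integrable_bound)
  have [measurable]: "u \<in> borel_measurable borel" using L2_measurable[OF uL] by simp
  show "?a \<in> borel_measurable lborel" by measurable
  show "integrable lborel (\<lambda>x. (u x)\<^sup>2 / r\<^sup>2)" using L2_integrable[OF uL] by simp
  have "norm (?a x) \<le> norm ((u x)\<^sup>2 / r\<^sup>2)" for x
    using r by (auto intro!: divide_left_mono power_mono mult_pos_pos zero_less_power)
  then show "AE x in lborel. norm (?a x) \<le> norm ((u x)\<^sup>2 / r\<^sup>2)" by simp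
qed

text \<open>The Hardy inequality results from testing with the vector field \<open>hardy_k r \<rho> R |x| x\<close>. The function
  \<open>h(s) = s\<^sup>3 hardy_f \<rho> s = \<rho> s / (\<rho> + s)\<close> solves the Riccati equation \<open>s\<^sup>2 h' = h\<^sup>2\<close>, so that the
  divergence of the field dominates its square, and \<open>h \<le> \<rho>\<close> keeps the loss from truncating it at
  radius \<open>R\<close> of order \<open>\<rho> / R\<^sup>3\<close>. Freezing the profile below radius \<open>r\<close> makes it Lipschitz.\<close>

definition hardy_f :: "real \<Rightarrow> real \<Rightarrow> real" where
  "hardy_f \<rho> s = \<rho> / (s\<^sup>2 * (\<rho> + s))"

definition hardy_k :: "real \<Rightarrow> real \<Rightarrow> real \<Rightarrow> real \<Rightarrow> real" where
  "hardy_k r \<rho> R s = max 0 (hardy_f \<rho> (max r s) - hardy_f \<rho> R)"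

text \<open>The derivative of \<open>hardy_k\<close> away from its kinks at radii \<open>r\<close>
  and \<open>R\<close>; the value 0 assigned there affects only a null set.\<close>

definition hardy_k' :: "real \<Rightarrow> real \<Rightarrow> real \<Rightarrow> real \<Rightarrow> real" where
  "hardy_k' r \<rho> R s = (if r < s \<and> s < R then - \<rho> * (2 * \<rho> + 3 * s) / (s ^ 3 * (\<rho> + s)\<^sup>2) else 0)"

context
  fixes r \<rho> R :: real
  assumes r: "0 < r" "r < \<rho>" "\<rho> \<le> R"
begin

lemma hardy_f_pos: "0 < s \<Longrightarrow> 0 < hardy_f \<rho> s"
  using r by (simp add: hardy_f_def)

lemma hardy_f_derivative:
  assumes "0 < s"
  shows "(hardy_f \<rho> has_real_derivative (- \<rho> * (2 * \<rho> + 3 * s) / (s ^ 3 * (\<rho> + s)\<^sup>2))) (at s within S)"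
proof -
  have nz: "s\<^sup>2 * (\<rho> + s) \<noteq> 0" using assms r by auto
  have "(hardy_f \<rho> has_real_derivative (- \<rho> * (2 * s * (\<rho> + s) + s\<^sup>2) / (s\<^sup>2 * (\<rho> + s))\<^sup>2)) (at s within S)"
    unfolding hardy_f_def[abs_def] using nz
    by (auto intro!: derivative_eq_intros simp: power2_eq_square)
  moreover have "- \<rho> * (2 * s * (\<rho> + s) + s\<^sup>2) / (s\<^sup>2 * (\<rho> + s))\<^sup>2 = - \<rho> * (2 * \<rho> + 3 * s) / (s ^ 3 * (\<rho> + s)\<^sup>2)"
    using assms r by (simp add: divide_simps) (simp add: power2_eq_square power3_eq_cube power4_eq_xxxx algebra_simps)
  ultimately show ?thesis by simp
qed

lemma hardy_f_antimono: "0 < s \<Longrightarrow> s \<le> t \<Longrightarrow> hardy_f \<rho> t \<le> hardy_f \<rho> s"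
  unfolding hardy_f_def using r by (intro divide_left_mono mult_mono power_mono) auto

lemma hardy_f_derivative_bound:
  assumes "r \<le> s"
  shows "\<bar>- \<rho> * (2 * \<rho> + 3 * s) / (s ^ 3 * (\<rho> + s)\<^sup>2)\<bar> \<le> 3 / r ^ 3"
proof -
  have s: "0 < s" using assms r by linarith
  have "\<bar>- \<rho> * (2 * \<rho> + 3 * s) / (s ^ 3 * (\<rho> + s)\<^sup>2)\<bar> = \<rho> * (2 * \<rho> + 3 * s) / (s ^ 3 * (\<rho> + s)\<^sup>2)"
    using r s by (simp add: abs_mult)
  also have "\<dots> \<le> 3 * (\<rho> + s)\<^sup>2 / (s ^ 3 * (\<rho> + s)\<^sup>2)"
  proof (rule divide_right_mono)
    show "\<rho> * (2 * \<rho> + 3 * s) \<le> 3 * (\<rho> + s)\<^sup>2"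
      using r s mult_pos_pos[of \<rho> s] by (simp add: power2_eq_square algebra_simps add_nonneg_nonneg)
  qed (use r s in auto)
  also have "\<dots> = 3 / s ^ 3" using r s by simp
  also have "\<dots> \<le> 3 / r ^ 3"
    using r s assms by (intro divide_left_mono power_mono) auto
  finally show ?thesis .
qed

lemma hardy_k_zero: "R \<le> s \<Longrightarrow> hardy_k r \<rho> R s = 0"
  using hardy_f_antimono[of R "max r s"] r by (simp add: hardy_k_def)

lemma hardy_k_nonneg: "0 \<le> hardy_k r \<rho> R s"
  by (simp add: hardy_k_def)

lemma hardy_k_inner: "s \<le> r \<Longrightarrow> hardy_k r \<rho> R s = hardy_f \<rho> r - hardy_f \<rho> R"
  using hardy_f_antimono[of r R] r by (simp add: hardy_k_def)

lemma hardy_k_middle: "r \<le> s \<Longrightarrow> s \<le> R \<Longrightarrow> hardy_k r \<rho> R s = hardy_f \<rho> s - hardy_f \<rho> R"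
  using hardy_f_antimono[of s R] r by (simp add: hardy_k_def)

lemma hardy_k_le: "hardy_k r \<rho> R s \<le> hardy_f \<rho> r"
  using hardy_f_antimono[of r "max r s"] hardy_f_pos[of R] hardy_f_pos[of r] r by (simp add: hardy_k_def)

text \<open>Positive part and maximum are both 1-Lipschitz, so only the slope of
  \<open>hardy_f\<close> beyond radius \<open>r\<close> matters.\<close>

lemma hardy_k_lipschitz: "\<bar>hardy_k r \<rho> R s - hardy_k r \<rho> R t\<bar> \<le> 3 / r ^ 3 * \<bar>s - t\<bar>"
proof -
  have "\<bar>hardy_k r \<rho> R s - hardy_k r \<rho> R t\<bar> \<le> \<bar>hardy_f \<rho> (max r s) - hardy_f \<rho> (max r t)\<bar>"
    unfolding hardy_k_def by linarith
  also have "\<dots> \<le> 3 / r ^ 3 * \<bar>max r s - max r t\<bar>"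
    unfolding real_norm_def[symmetric]
  proof (rule field_differentiable_bound[of "{r..}"])
    fix z assume z: "z \<in> {r..}"
    then show "(hardy_f \<rho> has_real_derivative (- \<rho> * (2 * \<rho> + 3 * z) / (z ^ 3 * (\<rho> + z)\<^sup>2))) (at z within {r..})"
      using r by (intro hardy_f_derivative) auto
    show "norm (- \<rho> * (2 * \<rho> + 3 * z) / (z ^ 3 * (\<rho> + z)\<^sup>2)) \<le> 3 / r ^ 3"
      using z hardy_f_derivative_bound by simp
  qed auto
  also have "\<dots> \<le> 3 / r ^ 3 * \<bar>s - t\<bar>"
    using r by (intro mult_left_mono) auto
  finally show ?thesis .
qed

lemma hardy_k_derivative:
  assumes "0 < s" "s \<noteq> r" "s \<noteq> R"
  shows "(hardy_k r \<rho> R has_real_derivative hardy_k' r \<rho> R s) (at s)"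
proof -
  consider "s < r" | "r < s" "s < R" | "R < s" using assms by linarith
  then show ?thesis
  proof cases
    case 1
    then have "((\<lambda>_. hardy_f \<rho> r - hardy_f \<rho> R) has_real_derivative hardy_k' r \<rho> R s) (at s)"
      by (simp add: hardy_k'_def)
    then show ?thesis
      by (rule DERIV_transform_interval[of _ _ _ "s - 1" r]) (use 1 in \<open>auto simp: hardy_k_inner\<close>)
  next
    case 2
    have D: "hardy_k' r \<rho> R s = - \<rho> * (2 * \<rho> + 3 * s) / (s ^ 3 * (\<rho> + s)\<^sup>2) - 0"
      using 2 by (simp add: hardy_k'_def)
    have "((\<lambda>s. hardy_f \<rho> s - hardy_f \<rho> R) has_real_derivative hardy_k' r \<rho> R s) (at s)"
      unfolding D by (rule DERIV_diff[OF hardy_f_derivative[OF assms(1)] DERIV_const])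
    then show ?thesis
      by (rule DERIV_transform_interval[of _ _ _ r R]) (use 2 in \<open>auto simp: hardy_k_middle\<close>)
  next
    case 3
    then have "((\<lambda>_. 0) has_real_derivative hardy_k' r \<rho> R s) (at s)"
      by (simp add: hardy_k'_def)
    then show ?thesis
      by (rule DERIV_transform_interval[of _ _ _ R "s + 1"]) (use 3 in \<open>auto simp: hardy_k_zero\<close>)
  qed
qed

lemma hardy_k'_bound: "\<bar>hardy_k' r \<rho> R s\<bar> \<le> 3 / r ^ 3"
  using hardy_f_derivative_bound[of s] r by (auto simp: hardy_k'_def)

text \<open>Pointwise form of the Hardy inequality. With profile \<open>k\<close>, the field
  \<open>k x\<close> in dimension three has divergence \<open>3 k + s k'\<close> and length
  \<open>k s\<close>; half the squared length is set aside for Young's inequality. The rest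
  dominates the Hardy weight up to the truncation loss \<open>3 \<rho> / R^3\<close>.\<close>

lemma hardy_weight:
  assumes "0 < s" "s \<noteq> r" "s \<noteq> R"
  shows "(if r < s \<and> s < \<rho> then 1 / (8 * s\<^sup>2) else 0) - (if s < R then 3 * \<rho> / R ^ 3 else 0)
    \<le> 3 * hardy_k r \<rho> R s + s * hardy_k' r \<rho> R s - (hardy_k r \<rho> R s * s)\<^sup>2 / 2"
proof -
  consider "s < r" | "r < s" "s < R" | "R < s" using assms by linarith
  then show ?thesis
  proof cases
    case 1
    let ?k = "hardy_k r \<rho> R s"
    \<comment> \<open>In the core the profile is constant and \<open>k s^2\<close> is at most
      \<open>\<rho> / (\<rho> + r)\<close>, hence at most 1, so \<open>3 k\<close> absorbs the
      square.\<close>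
    have "?k * s\<^sup>2 \<le> hardy_f \<rho> r * r\<^sup>2"
      using hardy_k_le hardy_k_nonneg 1 assms hardy_f_pos[of r] r by (intro mult_mono power_mono) auto
    also have "\<dots> \<le> 1" using r by (simp add: hardy_f_def divide_simps power2_eq_square)
    finally have "?k * (?k * s\<^sup>2) \<le> ?k * 1" by (intro mult_left_mono hardy_k_nonneg)
    then have "(?k * s)\<^sup>2 \<le> ?k" by (simp add: power2_eq_square mult_ac)
    moreover have "0 \<le> 3 * \<rho> / R ^ 3" using r by simp
    moreover have "(if r < s \<and> s < \<rho> then 1 / (8 * s\<^sup>2) else 0) - (if s < R then 3 * \<rho> / R ^ 3 else 0)
        = - (3 * \<rho> / R ^ 3)" "s * hardy_k' r \<rho> R s = 0"
      using 1 r by (simp_all add: hardy_k'_def)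
    ultimately show ?thesis using hardy_k_nonneg[of s] by linarith
  next
    case 2
    let ?w = "\<rho>\<^sup>2 / (s\<^sup>2 * (\<rho> + s)\<^sup>2)"
    \<comment> \<open>The Riccati equation at work: before truncation the divergence
      \<open>?w\<close> equals the squared length of the field, so subtracting half the square
      leaves half of \<open>?w\<close>.\<close>
    have div: "3 * hardy_k r \<rho> R s + s * hardy_k' r \<rho> R s = ?w - 3 * hardy_f \<rho> R"
    proof -
      have "3 * hardy_f \<rho> s + s * (- \<rho> * (2 * \<rho> + 3 * s) / (s ^ 3 * (\<rho> + s)\<^sup>2)) = ?w"
        unfolding hardy_f_def using assms r
        by (simp add: divide_simps) (simp add: power2_eq_square power3_eq_cube power4_eq_xxxx algebra_simps)
      then show ?thesis using 2 by (simp add: hardy_k_middle hardy_k'_def)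
    qed
    have "hardy_k r \<rho> R s * s \<le> hardy_f \<rho> s * s"
      using 2 assms hardy_f_pos[of R] r by (intro mult_right_mono) (auto simp: hardy_k_middle)
    then have "(hardy_k r \<rho> R s * s)\<^sup>2 \<le> (hardy_f \<rho> s * s)\<^sup>2"
      using assms hardy_k_nonneg by (intro power_mono) auto
    also have "(hardy_f \<rho> s * s)\<^sup>2 = ?w"
      using assms r by (simp add: hardy_f_def power_mult_distrib power_divide divide_simps)
    finally have k2: "(hardy_k r \<rho> R s * s)\<^sup>2 \<le> ?w" .
    have fR: "3 * hardy_f \<rho> R \<le> 3 * \<rho> / R ^ 3"
    proof -
      have "hardy_f \<rho> R \<le> \<rho> / (R\<^sup>2 * R)"
        unfolding hardy_f_def using r by (intro divide_left_mono mult_left_mono) auto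
      then show ?thesis by (simp add: power2_eq_square power3_eq_cube mult.assoc)
    qed
    \<comment> \<open>For \<open>s < \<rho>\<close> the quotient
      \<open>\<rho> / (\<rho> + s)\<close> is at least \<open>1/2\<close>, so \<open>?w\<close> is
      at least \<open>1 / (4 s^2)\<close>.\<close>
    have "1 / (8 * s\<^sup>2) \<le> ?w / 2" if "s < \<rho>"
    proof -
      have "(\<rho> + s)\<^sup>2 \<le> (2 * \<rho>)\<^sup>2" using that assms r by (intro power_mono) auto
      then have "(\<rho> + s)\<^sup>2 \<le> 4 * \<rho>\<^sup>2" by (simp add: power_mult_distrib)
      then show ?thesis using assms r by (simp add: divide_simps)
    qed
    moreover have "0 \<le> ?w / 2" by simp
    ultimately have w2: "(if s < \<rho> then 1 / (8 * s\<^sup>2) else 0) \<le> ?w / 2" by (simp only: split: if_split) blast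
    have eq: "(if r < s \<and> s < \<rho> then 1 / (8 * s\<^sup>2) else 0) - (if s < R then 3 * \<rho> / R ^ 3 else 0)
        = (if s < \<rho> then 1 / (8 * s\<^sup>2) else 0) - 3 * \<rho> / R ^ 3" using 2 by simp
    have "P - F \<le> D - K / 2" if "P \<le> W / 2" "D = W - H" "K \<le> W" "H \<le> F" for P F D K W H :: real
      using that by linarith
    from this[OF w2 div k2 fR] show ?thesis unfolding eq .
  next
    case 3
    then show ?thesis using r by (simp add: hardy_k_zero hardy_k'_def)
  qed
qed

text \<open>With the shorter vector \<open>z\<close> as reference, the profile difference is
  multiplied by at most \<open>R\<close>, unless both vectors lie outside radius \<open>R\<close>,
  where the field vanishes.\<close>

lemma hardy_field_lipschitz:
  fixes y z :: R3
  assumes "norm z \<le> norm y"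
  shows "\<bar>hardy_k r \<rho> R (norm y) * y $ i - hardy_k r \<rho> R (norm z) * z $ i\<bar>
    \<le> (hardy_f \<rho> r + R * (3 / r ^ 3)) * norm (y - z)"
proof (cases "R \<le> norm z")
  case True
  then have "hardy_k r \<rho> R (norm y) = 0" "hardy_k r \<rho> R (norm z) = 0"
    using assms hardy_k_zero by auto
  moreover have "0 \<le> hardy_f \<rho> r + R * (3 / r ^ 3)"
    using hardy_f_pos[of r] r by (intro add_nonneg_nonneg mult_nonneg_nonneg) auto
  ultimately show ?thesis by simp
next
  case False
  let ?k = "\<lambda>v. hardy_k r \<rho> R (norm v)"
  have "?k y * y $ i - ?k z * z $ i = ?k y * (y - z) $ i + z $ i * (?k y - ?k z)"
    by (simp add: algebra_simps)
  also have "\<bar>\<dots>\<bar> \<le> ?k y * \<bar>(y - z) $ i\<bar> + \<bar>z $ i\<bar> * \<bar>?k y - ?k z\<bar>"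
    using hardy_k_nonneg by (intro order_trans[OF abs_triangle_ineq]) (simp add: abs_mult)
  also have "\<dots> \<le> hardy_f \<rho> r * norm (y - z) + R * (3 / r ^ 3 * norm (y - z))"
  proof (intro add_mono mult_mono)
    show "\<bar>z $ i\<bar> \<le> R" using component_le_norm_cart[of z i] False by linarith
    have "\<bar>?k y - ?k z\<bar> \<le> 3 / r ^ 3 * \<bar>norm y - norm z\<bar>" by (rule hardy_k_lipschitz)
    also have "\<dots> \<le> 3 / r ^ 3 * norm (y - z)"
      using r norm_triangle_ineq3[of y z] by (intro mult_left_mono) auto
    finally show "\<bar>?k y - ?k z\<bar> \<le> 3 / r ^ 3 * norm (y - z)" .
    show "\<bar>(y - z) $ i\<bar> \<le> norm (y - z)" by (rule component_le_norm_cart)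
    show "?k y \<le> hardy_f \<rho> r" by (rule hardy_k_le)
    show "0 \<le> hardy_f \<rho> r" using hardy_f_pos[of r] r by simp
    show "0 \<le> R" using r by simp
  qed auto
  finally show ?thesis by (simp add: algebra_simps)
qed

lemma hardy_field_bound:
  fixes y :: R3
  shows "\<bar>hardy_k r \<rho> R (norm y) * y $ i\<bar> \<le> hardy_f \<rho> r * R"
proof (cases "R \<le> norm y")
  case True
  then show ?thesis using hardy_f_pos[of r] r by (simp add: hardy_k_zero)
next
  case False
  have "\<bar>y $ i\<bar> \<le> R" using component_le_norm_cart[of y i] False by linarith
  then show ?thesis
    using hardy_k_nonneg hardy_k_le hardy_f_pos[of r] r unfolding abs_mult by (intro mult_mono) auto
qed

lemma hardy_field_derivative_bound:
  fixes y :: R3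
  shows "\<bar>hardy_k r \<rho> R (norm y) + hardy_k' r \<rho> R (norm y) * ((y $ i)\<^sup>2 / norm y)\<bar>
    \<le> hardy_f \<rho> r + R * (3 / r ^ 3)"
proof -
  have "\<bar>hardy_k' r \<rho> R (norm y) * ((y $ i)\<^sup>2 / norm y)\<bar> \<le> R * (3 / r ^ 3)"
  proof (cases "R \<le> norm y")
    case True
    then show ?thesis using r by (simp add: hardy_k'_def)
  next
    case False
    have "(y $ i)\<^sup>2 \<le> (norm y)\<^sup>2"
      using component_le_norm_cart[of y i] by (simp add: abs_le_square_iff[symmetric])
    then have "(y $ i)\<^sup>2 / norm y \<le> R"
      using False by (cases "y = 0") (auto simp: divide_simps power2_eq_square intro: order_trans mult_right_mono)
    then show ?thesis
      using hardy_k'_bound[of "norm y"] r unfolding abs_mult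
      by (subst mult.commute, intro mult_mono) auto
  qed
  moreover have "\<bar>hardy_k r \<rho> R (norm y)\<bar> \<le> hardy_f \<rho> r"
    using hardy_k_nonneg hardy_k_le by simp
  ultimately show ?thesis by linarith
qed

lemma hardy_field_difference_quotient:
  fixes x c :: R3
  assumes "norm (x - c) \<notin> {0, r, R}"
  shows "((\<lambda>t. (hardy_k r \<rho> R (norm (x + t *\<^sub>R axis i 1 - c)) * (x + t *\<^sub>R axis i 1 - c) $ i
      - hardy_k r \<rho> R (norm (x - c)) * (x - c) $ i) / t) \<longlongrightarrow>
    hardy_k r \<rho> R (norm (x - c)) + hardy_k' r \<rho> R (norm (x - c)) * (((x - c) $ i)\<^sup>2 / norm (x - c))) (at 0)"
proof -
  define y where "y = x - c"
  have xy: "x + t *\<^sub>R axis i 1 - c = y + t *\<^sub>R axis i 1" for t by (simp add: y_def)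
  have y0: "norm y \<notin> {0, r, R}" using assms by (simp add: y_def)
  let ?K = "\<lambda>t. hardy_k r \<rho> R (norm (y + t *\<^sub>R axis i 1))"
  have "(hardy_k r \<rho> R has_real_derivative hardy_k' r \<rho> R (norm y)) (at (norm y))"
    using y0 by (intro hardy_k_derivative) auto
  from radial_difference_quotient[OF this[unfolded y_def], of i] y0
  have "(?K has_real_derivative hardy_k' r \<rho> R (norm y) * (y $ i / norm y)) (at 0)"
    unfolding DERIV_def by (auto simp: y_def algebra_simps)
  moreover have "((\<lambda>t. y $ i + t) has_real_derivative 1) (at 0)"
    by (auto intro!: derivative_eq_intros)
  ultimately have "((\<lambda>t. ?K t * (y $ i + t)) has_real_derivative
      hardy_k' r \<rho> R (norm y) * (y $ i / norm y) * (y $ i + 0) + 1 * ?K 0) (at 0)"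
    by (rule DERIV_mult)
  then show ?thesis
    unfolding DERIV_def xy y_def[symmetric] by (simp add: power2_eq_square add.commute mult.assoc)
qed

text \<open>The divergence of \<open>u^2 X\<close> has integral zero for the field
  \<open>X = k x\<close>. Absorbing the cross term by Young's inequality and applying
  \<open>hardy_weight\<close> leaves the Hardy weight with factor \<open>1/8\<close>; multiplying by
  8 turns the coefficients 2 and 3 into 16 and 24.\<close>

lemma hardy_inequality:
  fixes c :: R3
  assumes u: "has_gradient u g"
  shows "(LINT x|lborel. (if r < norm (x - c) \<and> norm (x - c) < \<rho> then (u x)\<^sup>2 / (norm (x - c))\<^sup>2 else 0))
    \<le> 16 * (LINT x|lborel. indicator (ball c R) x * (norm (g x))\<^sup>2)
      + 24 * \<rho> / R ^ 3 * (LINT x|lborel. indicator (ball c R) x * (u x)\<^sup>2)"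
proof -
  let ?s = "\<lambda>x. norm (x - c)"
  let ?B = "indicator (ball c R) :: R3 \<Rightarrow> real"
  let ?a = "\<lambda>x. if r < ?s x \<and> ?s x < \<rho> then (u x)\<^sup>2 / (?s x)\<^sup>2 else 0"
  define X where "X = (\<lambda>i x. hardy_k r \<rho> R (?s x) * (x - c) $ i)"
  define d where "d = (\<lambda>i x. hardy_k r \<rho> R (?s x) + hardy_k' r \<rho> R (?s x) * (((x - c) $ i)\<^sup>2 / ?s x))"
  define M where "M = hardy_f \<rho> r + R * (3 / r ^ 3)"
  have uL: "u \<in> L2" and gL: "g \<in> L2" using u by (auto simp: has_gradient_def)
  have part: "weak_partial i u (\<lambda>x. g x $ i)" for i using u by (simp add: has_gradient_iff)
  have giL: "(\<lambda>x. g x $ i) \<in> L2" for i by (rule L2_component[OF gL])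
  have [measurable]: "u \<in> borel_measurable borel" "g \<in> borel_measurable borel"
    using L2_measurable[OF uL] L2_measurable[OF gL] by auto
  have comp [measurable]: "(\<lambda>x. (x - c) $ i) \<in> borel_measurable borel" for i
    by (intro borel_measurable_continuous_onI continuous_intros)
  have km [measurable]: "hardy_k r \<rho> R \<in> borel_measurable borel"
    unfolding hardy_k_def[abs_def] hardy_f_def by measurable
  have k'm [measurable]: "hardy_k' r \<rho> R \<in> borel_measurable borel"
    unfolding hardy_k'_def[abs_def] by measurable
  have Xm: "X i \<in> borel_measurable lborel" and dm: "d i \<in> borel_measurable lborel" for i
    unfolding X_def d_def by measurable
  have Xb: "\<bar>X i x\<bar> \<le> hardy_f \<rho> r * R" for i x unfolding X_def by (rule hardy_field_bound)
  have db: "\<bar>d i x\<bar> \<le> M" for i x unfolding d_def M_def by (rule hardy_field_derivative_bound)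
  have lip: "\<bar>X i (x + t *\<^sub>R axis i 1) - X i x\<bar> \<le> M * \<bar>t\<bar>" for i x t
  proof -
    have "norm (x + t *\<^sub>R axis i 1 - c - (x - c)) = \<bar>t\<bar>" by simp
    then show ?thesis
      unfolding X_def M_def
      using hardy_field_lipschitz[of "x - c" "x + t *\<^sub>R axis i 1 - c" i]
        hardy_field_lipschitz[of "x + t *\<^sub>R axis i 1 - c" "x - c" i]
      by (metis abs_minus_commute nle_le norm_minus_commute)
  qed
  have notin: "AE x in lborel. ?s x \<notin> {0, r, R}" by (rule AE_norm_notin) simp
  have lim: "AE x in lborel. ((\<lambda>t. (X i (x + t *\<^sub>R axis i 1) - X i x) / t) \<longlongrightarrow> d i x) (at 0)" for i
    using notin
  proof eventually_elim
    fix x assume "?s x \<notin> {0, r, R}"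
    then show "((\<lambda>t. (X i (x + t *\<^sub>R axis i 1) - X i x) / t) \<longlongrightarrow> d i x) (at 0)"
      unfolding X_def d_def by (rule hardy_field_difference_quotient)
  qed
  have XuL: "(\<lambda>x. X i x * u x) \<in> L2" for i by (rule L2_bounded_mult[OF uL Xm Xb])
  have duL: "(\<lambda>x. d i x * u x) \<in> L2" for i by (rule L2_bounded_mult[OF uL dm db])
  have XgL: "(\<lambda>x. X i x * g x $ i) \<in> L2" for i by (rule L2_bounded_mult[OF giL Xm Xb])
  \<comment> \<open>The \<open>i\<close>-th part of the divergence of \<open>u^2 X\<close>, grouped
    into products of two L2 functions: integration by parts is applied to the pair
    \<open>X i u\<close> and \<open>u\<close>, which avoids differentiating the merely integrable
    \<open>u^2\<close>.\<close>
  let ?T = "\<lambda>i x. (X i x * g x $ i) * u x + (d i x * u x) * u x + (X i x * u x) * g x $ i"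
  have Tint: "integrable lborel (?T i)" for i
    by (intro Bochner_Integration.integrable_add L2_integrable_mult XuL duL XgL uL giL)
  have T0: "(LINT x|lborel. ?T i x) = 0" for i
  proof -
    have "weak_partial i (\<lambda>x. X i x * u x) (\<lambda>x. X i x * g x $ i + d i x * u x)"
      by (rule weak_partial_mult_lipschitz[OF part Xm dm Xb db lip lim])
    from weak_partial_integration_by_parts[OF this part]
    have "(LINT x|lborel. (X i x * g x $ i + d i x * u x) * u x) + (LINT x|lborel. (X i x * u x) * g x $ i) = 0"
      by simp
    moreover have "integrable lborel (\<lambda>x. (X i x * g x $ i + d i x * u x) * u x)"
      by (intro L2_integrable_mult L2_add XgL duL uL)
    ultimately have "(LINT x|lborel. (X i x * g x $ i + d i x * u x) * u x + (X i x * u x) * g x $ i) = 0"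
      using L2_integrable_mult[OF XuL giL, of i i] by simp
    then show ?thesis by (simp add: distrib_right)
  qed
  have Gint: "integrable lborel (\<lambda>x. ?B x * (norm (g x))\<^sup>2)"
    using L2_integrable[OF gL] by (intro integrable_indicator_mult) auto
  have Uint: "integrable lborel (\<lambda>x. ?B x * (u x)\<^sup>2)"
    using L2_integrable[OF uL] by (intro integrable_indicator_mult) auto
  have aint: "integrable lborel ?a" by (rule integrable_annulus[OF uL r(1)])
  have "(LINT x|lborel. ?a x / 8 - 3 * \<rho> / R ^ 3 * (?B x * (u x)\<^sup>2) - 2 * (?B x * (norm (g x))\<^sup>2))
      \<le> (LINT x|lborel. (\<Sum>i\<in>UNIV. ?T i x))"
  proof (rule integral_mono_AE)
    show "integrable lborel (\<lambda>x. ?a x / 8 - 3 * \<rho> / R ^ 3 * (?B x * (u x)\<^sup>2) - 2 * (?B x * (norm (g x))\<^sup>2))"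
      using aint Gint Uint by (intro Bochner_Integration.integrable_diff integrable_divide integrable_mult_right)
    show "integrable lborel (\<lambda>x. \<Sum>i\<in>UNIV. ?T i x)" by (intro Bochner_Integration.integrable_sum Tint)
    have "?a x / 8 - 3 * \<rho> / R ^ 3 * (?B x * (u x)\<^sup>2) - 2 * (?B x * (norm (g x))\<^sup>2) \<le> (\<Sum>i\<in>UNIV. ?T i x)"
      if "?s x \<notin> {0, r, R}" for x
    proof -
      define y where "y = x - c"
      define s where "s = norm y"
      define k where "k = hardy_k r \<rho> R s"
      define k' where "k' = hardy_k' r \<rho> R s"
      define w where "w = u x"
      define p where "p = y \<bullet> g x"
      have s: "0 < s" "s \<noteq> r" "s \<noteq> R" using that by (auto simp: s_def y_def)
      have "(\<Sum>i\<in>UNIV. ?T i x) = (\<Sum>i\<in>UNIV. 2 * k * w * (y $ i * g x $ i) + k * w\<^sup>2 + k' * w\<^sup>2 / s * (y $ i)\<^sup>2)"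
        unfolding X_def d_def y_def[symmetric] s_def[symmetric] k_def[symmetric] k'_def[symmetric] w_def[symmetric]
        by (intro sum.cong refl) (simp add: power2_eq_square algebra_simps)
      \<comment> \<open>The factor 3 is the dimension.\<close>
      also have "\<dots> = 2 * k * w * p + 3 * k * w\<^sup>2 + k' * w\<^sup>2 / s * s\<^sup>2"
        unfolding p_def s_def norm_vec_square inner_vec_def
        by (simp add: sum.distrib sum_distrib_left)
      also have "k' * w\<^sup>2 / s * s\<^sup>2 = s * k' * w\<^sup>2" using s by (simp add: power2_eq_square)
      finally have T: "(\<Sum>i\<in>UNIV. ?T i x) = (3 * k + s * k') * w\<^sup>2 + 2 * k * w * p" by (simp add: algebra_simps)
      have p: "\<bar>p\<bar> \<le> s * norm (g x)" unfolding p_def s_def by (rule Cauchy_Schwarz_ineq2)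
      have B: "?B x = (if s < R then 1 else 0)"
        by (simp add: s_def y_def indicator_def dist_norm norm_minus_commute)
      have "\<bar>2 * k * w * p\<bar> \<le> (k * s)\<^sup>2 / 2 * w\<^sup>2 + 2 * (?B x * (norm (g x))\<^sup>2)"
      proof (cases "s < R")
        case True
        have k0: "0 \<le> k" unfolding k_def by (rule hardy_k_nonneg)
        have "\<bar>2 * k * w * p\<bar> = (2 * k * \<bar>w\<bar>) * \<bar>p\<bar>" using k0 by (simp add: abs_mult)
        also have "\<dots> \<le> (2 * k * \<bar>w\<bar>) * (s * norm (g x))"
          using k0 by (intro mult_left_mono p) auto
        \<comment> \<open>Young's inequality in the form \<open>2 a b \<le> a^2 / 2 + 2 b^2\<close>,
          which spends exactly the half square reserved in \<open>hardy_weight\<close>.\<close>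
        also have "\<dots> \<le> (k * s)\<^sup>2 / 2 * w\<^sup>2 + 2 * (norm (g x))\<^sup>2"
        proof -
          have "0 \<le> (k * s * \<bar>w\<bar> - 2 * norm (g x))\<^sup>2 / 2" by simp
          also have "\<dots> = (k * s)\<^sup>2 / 2 * w\<^sup>2 + 2 * (norm (g x))\<^sup>2 - (2 * k * \<bar>w\<bar>) * (s * norm (g x))"
            by (simp add: power2_diff power_mult_distrib field_simps)
          finally show ?thesis by simp
        qed
        finally show ?thesis using True B by simp
      next
        case False
        then have "k = 0" by (simp add: k_def hardy_k_zero)
        then show ?thesis using False B by simp
      qed
      moreover have "((if r < s \<and> s < \<rho> then 1 / (8 * s\<^sup>2) else 0) - (if s < R then 3 * \<rho> / R ^ 3 else 0)) * w\<^sup>2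
          \<le> (3 * k + s * k' - (k * s)\<^sup>2 / 2) * w\<^sup>2"
        unfolding k_def k'_def by (intro mult_right_mono hardy_weight s) simp
      moreover have "((if r < s \<and> s < \<rho> then 1 / (8 * s\<^sup>2) else 0) - (if s < R then 3 * \<rho> / R ^ 3 else 0)) * w\<^sup>2
          = ?a x / 8 - 3 * \<rho> / R ^ 3 * (?B x * (u x)\<^sup>2)"
        unfolding B w_def y_def[symmetric] s_def[symmetric] by (simp add: left_diff_distrib)
      ultimately show ?thesis unfolding T by (simp add: left_diff_distrib)
    qed
    then show "AE x in lborel. ?a x / 8 - 3 * \<rho> / R ^ 3 * (?B x * (u x)\<^sup>2) - 2 * (?B x * (norm (g x))\<^sup>2) \<le> (\<Sum>i\<in>UNIV. ?T i x)"
      using notin by (rule eventually_mono[rotated])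
  qed
  also have "(LINT x|lborel. (\<Sum>i\<in>UNIV. ?T i x)) = 0"
    using Tint T0 by (subst Bochner_Integration.integral_sum) auto
  also have "(LINT x|lborel. ?a x / 8 - 3 * \<rho> / R ^ 3 * (?B x * (u x)\<^sup>2) - 2 * (?B x * (norm (g x))\<^sup>2))
      = (LINT x|lborel. ?a x) / 8 - 3 * \<rho> / R ^ 3 * (LINT x|lborel. ?B x * (u x)\<^sup>2)
        - 2 * (LINT x|lborel. ?B x * (norm (g x))\<^sup>2)"
    using aint Gint Uint by simp
  finally show ?thesis by (simp add: field_simps)
qed

end

text \<open>Linear in \<open>ln s\<close>, falling from 1 at radius \<open>r\<close> to 0 at radius
  \<open>r * exp 16\<close>; \<open>max r s\<close> freezes it at 1 inside the particle.\<close>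

definition cutoff :: "real \<Rightarrow> real \<Rightarrow> real" where
  "cutoff r s = max 0 (1 - ln (max r s / r) / 16)"

definition cutoff' :: "real \<Rightarrow> real \<Rightarrow> real" where
  "cutoff' r s = (if r < s \<and> s < r * exp 16 then - 1 / (16 * s) else 0)"

context
  fixes r :: real
  assumes r: "0 < r"
begin

lemma cutoff_inner: "s \<le> r \<Longrightarrow> cutoff r s = 1"
  using r by (simp add: cutoff_def)

lemma cutoff_bounds: "0 \<le> cutoff r s" "cutoff r s \<le> 1"
  using r by (auto simp: cutoff_def le_max_iff_disj)

lemma cutoff_middle:
  assumes "r \<le> s" "s \<le> r * exp 16" shows "cutoff r s = 1 - ln (s / r) / 16"
proof -
  have "ln (s / r) \<le> ln (exp 16)"
    using assms r by (subst ln_le_cancel_iff) (auto simp: field_simps)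
  then show ?thesis using assms by (simp add: cutoff_def)
qed

lemma cutoff_outer:
  assumes "r * exp 16 \<le> s" shows "cutoff r s = 0"
proof -
  have s: "r \<le> s" using assms r by (smt (verit) mult_le_cancel_left1 one_le_exp_iff)
  have "ln (exp 16) \<le> ln (s / r)"
    using assms r s by (subst ln_le_cancel_iff) (auto simp: field_simps)
  then show ?thesis using s by (simp add: cutoff_def)
qed

lemma cutoff_lipschitz: "\<bar>cutoff r s - cutoff r t\<bar> \<le> 1 / (16 * r) * \<bar>s - t\<bar>"
proof -
  have "\<bar>cutoff r s - cutoff r t\<bar> \<le> \<bar>ln (max r s) / 16 - ln (max r t) / 16\<bar>"
  proof -
    have ln: "ln (max r a / r) = ln (max r a) - ln r" for a using r by (simp add: ln_div)
    show ?thesis unfolding cutoff_def ln diff_divide_distrib by linarith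
  qed
  also have "\<dots> \<le> 1 / (16 * r) * \<bar>max r s - max r t\<bar>"
    unfolding real_norm_def[symmetric]
  proof (rule field_differentiable_bound[of "{r..}" "\<lambda>s. ln s / 16" "\<lambda>s. 1 / s / 16"])
    fix z assume z: "z \<in> {r..}"
    then have z0: "0 < z" using r by simp
    then show "((\<lambda>s. ln s / 16) has_real_derivative 1 / z / 16) (at z within {r..})"
      by (auto intro!: derivative_eq_intros)
    show "norm (1 / z / 16) \<le> 1 / (16 * r)"
      using z r z0 by (simp add: divide_simps)
  qed auto
  also have "\<dots> \<le> 1 / (16 * r) * \<bar>s - t\<bar>"
    using r by (intro mult_left_mono) auto
  finally show ?thesis .
qed

lemma cutoff_derivative:
  assumes "0 < s" "s \<noteq> r" "s \<noteq> r * exp 16"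
  shows "(cutoff r has_real_derivative cutoff' r s) (at s)"
proof -
  have lt: "r < r * exp 16" using r by simp
  consider "s < r" | "r < s" "s < r * exp 16" | "r * exp 16 < s" using assms by linarith
  then show ?thesis
  proof cases
    case 1
    then have "((\<lambda>_. 1) has_real_derivative cutoff' r s) (at s)" by (simp add: cutoff'_def)
    then show ?thesis
      by (rule DERIV_transform_interval[of _ _ _ "s - 1" r]) (use 1 in \<open>auto simp: cutoff_inner\<close>)
  next
    case 2
    have "((\<lambda>s. 1 - ln (s / r) / 16) has_real_derivative cutoff' r s) (at s)"
      using 2 assms r by (auto intro!: derivative_eq_intros simp: cutoff'_def field_simps)
    then show ?thesis
      by (rule DERIV_transform_interval[of _ _ _ r "r * exp 16"]) (use 2 in \<open>auto simp: cutoff_middle\<close>)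
  next
    case 3
    then have "((\<lambda>_. 0) has_real_derivative cutoff' r s) (at s)" by (simp add: cutoff'_def)
    then show ?thesis
      by (rule DERIV_transform_interval[of _ _ _ "r * exp 16" "s + 1"]) (use 3 in \<open>auto simp: cutoff_outer\<close>)
  qed
qed

end

text \<open>The logarithmic profile keeps the weight \<^term>\<open>(cutoff' r s)\<^sup>2\<close> at the small multiple
  \<open>1 / 256\<close> of the Hardy weight \<open>1 / s\<^sup>2\<close>. This is what makes the energy of the truncated function
  smaller than twice the local energy of the function.\<close>

lemma cutoff_energy:
  fixes c :: R3
  assumes u: "has_gradient u g" and r: "0 < r" "r * exp 16 \<le> R" and \<xi>: "0 < \<xi>" "r * exp 16 / R ^ 3 \<le> 1 / \<xi>\<^sup>2"
  defines "v \<equiv> \<lambda>x. cutoff r (norm (x - c)) * u x"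
  defines "h \<equiv> \<lambda>x. cutoff r (norm (x - c)) *\<^sub>R g x + u x *\<^sub>R (cutoff' r (norm (x - c)) / norm (x - c)) *\<^sub>R (x - c)"
  shows "has_gradient v h"
    and "\<And>x. x \<in> cball c r \<Longrightarrow> v x = u x"
    and "\<And>x. x \<notin> ball c R \<Longrightarrow> v x = 0 \<and> h x = 0"
    and "(LINT x|lborel. (norm (h x))\<^sup>2 + (v x)\<^sup>2 / \<xi>\<^sup>2)
      \<le> 25 / 16 * (LINT x|lborel. indicator (ball c R) x * ((norm (g x))\<^sup>2 + (u x)\<^sup>2 / \<xi>\<^sup>2))"
proof -
  let ?s = "\<lambda>x. norm (x - c)"
  let ?\<rho> = "r * exp 16"
  let ?B = "indicator (ball c R) :: R3 \<Rightarrow> real"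
  define d where "d = (\<lambda>x. (cutoff' r (?s x) / ?s x) *\<^sub>R (x - c))"
  have \<rho>: "r < ?\<rho>" "?\<rho> \<le> R" using r by simp_all
  have uL: "u \<in> L2" and gL: "g \<in> L2" using u by (auto simp: has_gradient_def)
  have [measurable]: "u \<in> borel_measurable borel" "g \<in> borel_measurable borel"
    using L2_measurable[OF uL] L2_measurable[OF gL] by auto
  have comp [measurable]: "(\<lambda>x. (x - c) $ i) \<in> borel_measurable borel" for i
    by (intro borel_measurable_continuous_onI continuous_intros)
  have [measurable]: "cutoff r \<in> borel_measurable borel" "cutoff' r \<in> borel_measurable borel"
    unfolding cutoff_def[abs_def] cutoff'_def[abs_def] by measurable
  \<comment> \<open>At the centre both sides vanish, because \<open>cutoff' r 0 = 0\<close>.\<close>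
  have d_norm: "norm (d x) = \<bar>cutoff' r (?s x)\<bar>" for x
    by (cases "x = c") (auto simp: d_def cutoff'_def r(1) less_imp_le not_less)
  have c'_bound: "\<bar>cutoff' r s\<bar> \<le> 1 / (16 * r)" for s
    using r(1) by (auto simp: cutoff'_def abs_mult divide_simps)
  show grad: "has_gradient v h"
    unfolding v_def h_def
  proof (rule has_gradient_mult_lipschitz[OF u, where d = d and C = 1 and B = "1 / (16 * r)", unfolded d_def])
    show "(\<lambda>x. cutoff r (?s x)) \<in> borel_measurable lborel" by measurable
    show "(\<lambda>x. ((cutoff' r (?s x) / ?s x) *\<^sub>R (x - c)) $ i) \<in> borel_measurable lborel" for i
      unfolding vector_scaleR_component by measurable
    show "\<bar>cutoff r (?s x)\<bar> \<le> 1" for x using cutoff_bounds[OF r(1)] by simp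
    show "\<bar>((cutoff' r (?s x) / ?s x) *\<^sub>R (x - c)) $ i\<bar> \<le> 1 / (16 * r)" for x i
      using component_le_norm_cart[of "d x" i] d_norm[of x] c'_bound[of "?s x"] unfolding d_def by linarith
    show "\<bar>cutoff r (norm (x + t *\<^sub>R axis i 1 - c)) - cutoff r (?s x)\<bar> \<le> 1 / (16 * r) * \<bar>t\<bar>" for x t i
    proof -
      have "\<bar>cutoff r (norm (x + t *\<^sub>R axis i 1 - c)) - cutoff r (?s x)\<bar>
          \<le> 1 / (16 * r) * \<bar>norm (x + t *\<^sub>R axis i 1 - c) - ?s x\<bar>"
        by (rule cutoff_lipschitz[OF r(1)])
      also have "\<dots> \<le> 1 / (16 * r) * \<bar>t\<bar>"
        using r(1) by (intro mult_left_mono norm_diff_line_le) simp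
      finally show ?thesis .
    qed
    have "AE x in lborel. ?s x \<notin> {0, r, ?\<rho>}" by (rule AE_norm_notin) simp
    then show "AE x in lborel. ((\<lambda>t. (cutoff r (norm (x + t *\<^sub>R axis i 1 - c)) - cutoff r (?s x)) / t)
        \<longlongrightarrow> ((cutoff' r (?s x) / ?s x) *\<^sub>R (x - c)) $ i) (at 0)" for i
    proof eventually_elim
      fix x assume x: "?s x \<notin> {0, r, ?\<rho>}"
      then have "(cutoff r has_real_derivative cutoff' r (?s x)) (at (?s x))"
        by (intro cutoff_derivative[OF r(1)]) auto
      from radial_difference_quotient[OF this, of i] x
      show "((\<lambda>t. (cutoff r (norm (x + t *\<^sub>R axis i 1 - c)) - cutoff r (?s x)) / t)
          \<longlongrightarrow> ((cutoff' r (?s x) / ?s x) *\<^sub>R (x - c)) $ i) (at 0)"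
        by simp
    qed
  qed
  have h_eq: "h x = cutoff r (?s x) *\<^sub>R g x + u x *\<^sub>R d x" for x
    unfolding h_def d_def ..
  have vL: "v \<in> L2" and hL: "h \<in> L2" using grad by (auto simp: has_gradient_def)
  show "v x = u x" if "x \<in> cball c r" for x
    using that cutoff_inner[OF r(1)] by (simp add: v_def dist_norm norm_minus_commute)
  show outside: "v x = 0 \<and> h x = 0" if "x \<notin> ball c R" for x
  proof -
    have "?\<rho> \<le> ?s x" using that \<rho>(2) by (simp add: dist_norm norm_minus_commute)
    then show ?thesis
      using cutoff_outer[OF r(1), of "?s x"] by (auto simp: v_def h_def cutoff'_def)
  qed
  let ?a = "\<lambda>x. if r < ?s x \<and> ?s x < ?\<rho> then (u x)\<^sup>2 / (?s x)\<^sup>2 else 0"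
  have Gint: "integrable lborel (\<lambda>x. ?B x * (norm (g x))\<^sup>2)"
    using L2_integrable[OF gL] by (intro integrable_indicator_mult) auto
  have Uint: "integrable lborel (\<lambda>x. ?B x * (u x)\<^sup>2)"
    using L2_integrable[OF uL] by (intro integrable_indicator_mult) auto
  have aint: "integrable lborel ?a" by (rule integrable_annulus[OF uL r(1)])
  define G where "G = (LINT x|lborel. ?B x * (norm (g x))\<^sup>2)"
  define U where "U = (LINT x|lborel. ?B x * (u x)\<^sup>2)"
  have pt: "(norm (h x))\<^sup>2 + (v x)\<^sup>2 / \<xi>\<^sup>2
      \<le> 5 / 4 * (?B x * (norm (g x))\<^sup>2) + 5 / 256 * ?a x + (?B x * (u x)\<^sup>2) / \<xi>\<^sup>2" for x
  proof (cases "x \<in> ball c R")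
    case False
    then show ?thesis using outside[OF False] by simp
  next
    case True
    define \<eta> where "\<eta> = cutoff r (?s x)"
    have \<eta>: "0 \<le> \<eta>" "\<eta> \<le> 1" unfolding \<eta>_def by (rule cutoff_bounds[OF r(1)])+
    have "(norm (h x))\<^sup>2 \<le> (norm (g x) + \<bar>u x\<bar> * norm (d x))\<^sup>2"
    proof (intro power_mono norm_ge_zero)
      have "norm (h x) \<le> norm (\<eta> *\<^sub>R g x) + norm (u x *\<^sub>R d x)"
        unfolding h_eq \<eta>_def by (rule norm_triangle_ineq)
      also have "norm (\<eta> *\<^sub>R g x) \<le> 1 * norm (g x)"
        using \<eta> by (simp add: mult_left_le_one_le)
      finally show "norm (h x) \<le> norm (g x) + \<bar>u x\<bar> * norm (d x)" by simp
    qed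
    \<comment> \<open>Unequal Young weights: the gradient keeps a coefficient near 1, while the
      large weight falls on the cutoff term, which carries the small factor
      \<open>1/256\<close>.\<close>
    also have "\<dots> \<le> 5 / 4 * (norm (g x))\<^sup>2 + 5 * (\<bar>u x\<bar> * norm (d x))\<^sup>2"
    proof -
      have "(a + b)\<^sup>2 \<le> 5 / 4 * a\<^sup>2 + 5 * b\<^sup>2" for a b :: real
      proof -
        have "0 \<le> (a / 2 - 2 * b)\<^sup>2" by simp
        then show ?thesis by (simp add: power2_eq_square algebra_simps)
      qed
      then show ?thesis .
    qed
    also have "5 * (\<bar>u x\<bar> * norm (d x))\<^sup>2 = 5 / 256 * ?a x"
      by (simp add: d_norm cutoff'_def power_mult_distrib power_divide)
    finally have 1: "(norm (h x))\<^sup>2 \<le> 5 / 4 * (norm (g x))\<^sup>2 + 5 / 256 * ?a x" .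
    have "(v x)\<^sup>2 \<le> (u x)\<^sup>2"
    proof -
      have "\<bar>v x\<bar> \<le> \<bar>u x\<bar>" using \<eta> by (simp add: v_def \<eta>_def abs_mult mult_left_le_one_le)
      then show ?thesis by (simp add: abs_le_square_iff)
    qed
    then have "(v x)\<^sup>2 / \<xi>\<^sup>2 \<le> (u x)\<^sup>2 / \<xi>\<^sup>2" by (rule divide_right_mono) simp
    then show ?thesis using 1 True by simp
  qed
  have "(LINT x|lborel. (norm (h x))\<^sup>2 + (v x)\<^sup>2 / \<xi>\<^sup>2)
      \<le> (LINT x|lborel. 5 / 4 * (?B x * (norm (g x))\<^sup>2) + 5 / 256 * ?a x + (?B x * (u x)\<^sup>2) / \<xi>\<^sup>2)"
  proof (rule integral_mono)
    show "integrable lborel (\<lambda>x. (norm (h x))\<^sup>2 + (v x)\<^sup>2 / \<xi>\<^sup>2)"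
      using L2_integrable[OF hL] L2_integrable[OF vL] by simp
    show "integrable lborel (\<lambda>x. 5 / 4 * (?B x * (norm (g x))\<^sup>2) + 5 / 256 * ?a x + (?B x * (u x)\<^sup>2) / \<xi>\<^sup>2)"
      using aint Gint Uint
      by (intro Bochner_Integration.integrable_add integrable_mult_right integrable_divide)
  qed (rule pt)
  also have "\<dots> = 5 / 4 * G + 5 / 256 * (LINT x|lborel. ?a x) + U / \<xi>\<^sup>2"
    using aint Gint Uint by (simp add: G_def U_def)
  \<comment> \<open>Hardy's inequality with \<open>?\<rho>\<close> the outer radius of the cutoff;
    the gradient coefficient becomes \<open>5/4 + 5/16\<close>.\<close>
  also have "\<dots> \<le> 5 / 4 * G + 5 / 256 * (16 * G + 24 * ?\<rho> / R ^ 3 * U) + U / \<xi>\<^sup>2"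
    using hardy_inequality[OF r(1) \<rho> u, of c] unfolding G_def U_def by (intro add_mono mult_left_mono) auto
  also have "\<dots> \<le> 25 / 16 * (G + U / \<xi>\<^sup>2)"
  proof -
    have "0 \<le> U" unfolding U_def by (intro integral_nonneg_AE AE_I2) (simp add: indicator_def)
    then have "?\<rho> / R ^ 3 * U \<le> 1 / \<xi>\<^sup>2 * U" by (rule mult_right_mono[OF \<xi>(2)])
    then have le: "?\<rho> / R ^ 3 * U \<le> U / \<xi>\<^sup>2" by simp
    \<comment> \<open>The lower-order coefficient is \<open>1 + 5 * 24 / 256 = 47/32\<close>, still
      below \<open>25/16\<close>.\<close>
    have "5 / 4 * G + 5 / 256 * (16 * G + 24 * P) + Q \<le> 25 / 16 * (G + Q)"
      if "P \<le> Q" "0 \<le> Q" for P Q :: real using that by (simp add: algebra_simps)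
    from this[OF le] \<open>0 \<le> U\<close>
    have "5 / 4 * G + 5 / 256 * (16 * G + 24 * (?\<rho> / R ^ 3 * U)) + U / \<xi>\<^sup>2 \<le> 25 / 16 * (G + U / \<xi>\<^sup>2)"
      by fastforce
    then show ?thesis by (simp only: times_divide_eq_right times_divide_eq_left mult.assoc)
  qed
  also have "G + U / \<xi>\<^sup>2 = (LINT x|lborel. ?B x * ((norm (g x))\<^sup>2 + (u x)\<^sup>2 / \<xi>\<^sup>2))"
    unfolding G_def U_def using Gint Uint by (simp add: distrib_left)
  finally show "(LINT x|lborel. (norm (h x))\<^sup>2 + (v x)\<^sup>2 / \<xi>\<^sup>2)
      \<le> 25 / 16 * (LINT x|lborel. ?B x * ((norm (g x))\<^sup>2 + (u x)\<^sup>2 / \<xi>\<^sup>2))" .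
qed

section \<open>$H^1(\mathbf{R}^3)$ as a Hilbert space\<close>

lemma H1_iff_gradient: "u \<in> H1 \<longleftrightarrow> (\<exists>g. has_gradient u g)"
  by (auto simp: H1_def has_gradient_def)

lemma has_gradient_wgrad:
  assumes "u \<in> H1" shows "has_gradient u (wgrad u)"
proof -
  have "\<exists>g. g \<in> L2 \<and> weak_gradient u g" using assms by (auto simp: H1_def)
  then have "wgrad u \<in> L2 \<and> weak_gradient u (wgrad u)" unfolding wgrad_def by (rule someI_ex)
  then show ?thesis using assms by (simp add: has_gradient_def H1_def)
qed

lemma has_gradient_unique:
  assumes "has_gradient u g" "has_gradient u' g'" "AE x in lborel. u x = u' x"
  shows "AE x in lborel. g x = g' x"
proof -
  have "AE x in lborel. g x $ i = g' x $ i" for i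
    using weak_partial_unique[OF assms(1)[unfolded has_gradient_iff, rule_format]
        assms(2)[unfolded has_gradient_iff, rule_format] assms(3), of i] .
  then have "AE x in lborel. \<forall>i\<in>UNIV. g x $ i = g' x $ i"
    by (intro AE_finite_allI) simp_all
  then show ?thesis by eventually_elim (simp add: vec_eq_iff)
qed

lemma has_gradient_lincomb:
  assumes "has_gradient u g" "has_gradient v h"
  shows "has_gradient (\<lambda>x. u x + c * v x) (\<lambda>x. g x + c *\<^sub>R h x)"
  using assms weak_partial_lincomb by (simp add: has_gradient_iff)

lemma has_gradient_zero: "has_gradient (\<lambda>_. 0) (\<lambda>_. 0)"
  by (simp add: has_gradient_def L2_zero weak_gradient_def)

lemma L2_Pair:
  fixes u :: "R3 \<Rightarrow> real" and g :: "R3 \<Rightarrow> R3"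
  assumes "u \<in> L2" "g \<in> L2" shows "(\<lambda>x. (u x / \<xi>, g x)) \<in> L2"
proof (rule L2I)
  have [measurable]: "u \<in> borel_measurable lborel" "g \<in> borel_measurable lborel"
    using assms by (auto dest: L2_measurable)
  show "(\<lambda>x. (u x / \<xi>, g x)) \<in> borel_measurable lborel" by (intro borel_measurable_Pair) measurable
  have "(\<lambda>x. (norm (u x / \<xi>, g x))\<^sup>2) = (\<lambda>x. (u x)\<^sup>2 / \<xi>\<^sup>2 + (norm (g x))\<^sup>2)"
    by (simp add: norm_Pair power_divide)
  then show "integrable lborel (\<lambda>x. (norm (u x / \<xi>, g x))\<^sup>2)"
    using L2_integrable[OF assms(1)] L2_integrable[OF assms(2)] by simp
qed

text \<open>An isometric copy of $H^1$ with the inner product of the screened Poisson equation.\<close>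

definition emb :: "real \<Rightarrow> (R3 \<Rightarrow> real) \<Rightarrow> (real \<times> R3) l2" where
  "emb \<xi> u = abs_l2 (\<lambda>x. (u x / \<xi>, wgrad u x))"

text \<open>Weak gradients are unique almost everywhere, so any gradient computes the embedding, not
  only the chosen one.\<close>

lemma emb_eq:
  assumes "has_gradient u g" shows "emb \<xi> u = abs_l2 (\<lambda>x. (u x / \<xi>, g x))"
proof -
  have u: "has_gradient u (wgrad u)" using assms H1_iff_gradient has_gradient_wgrad by blast
  have "AE x in lborel. wgrad u x = g x" using has_gradient_unique[OF u assms] by simp
  then show ?thesis
    unfolding emb_def using u assms
    by (subst abs_l2_eq_iff) (auto simp: has_gradient_def intro!: L2_Pair)
qed

lemma emb_eq_iff:
  assumes "\<xi> \<noteq> 0" "u \<in> H1" "v \<in> H1"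
  shows "emb \<xi> u = emb \<xi> v \<longleftrightarrow> (AE x in lborel. u x = v x)"
proof -
  note g = has_gradient_wgrad[OF assms(2)] has_gradient_wgrad[OF assms(3)]
  have L: "(\<lambda>x. (u x / \<xi>, wgrad u x)) \<in> L2" "(\<lambda>x. (v x / \<xi>, wgrad v x)) \<in> L2"
    using g by (auto simp: has_gradient_def intro!: L2_Pair)
  show ?thesis
    unfolding emb_def abs_l2_eq_iff[OF L]
  proof
    assume "AE x in lborel. (u x / \<xi>, wgrad u x) = (v x / \<xi>, wgrad v x)"
    then show "AE x in lborel. u x = v x" by eventually_elim (use assms(1) in simp)
  next
    assume eq: "AE x in lborel. u x = v x"
    from eq has_gradient_unique[OF g eq]
    show "AE x in lborel. (u x / \<xi>, wgrad u x) = (v x / \<xi>, wgrad v x)" by eventually_elim simp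
  qed
qed

lemma H1_lincomb:
  assumes "u \<in> H1" "v \<in> H1"
  shows "(\<lambda>x. u x + c * v x) \<in> H1"
    and "emb \<xi> (\<lambda>x. u x + c * v x) = emb \<xi> u + c *\<^sub>R emb \<xi> v"
proof -
  note g = has_gradient_wgrad[OF assms(1)] has_gradient_wgrad[OF assms(2)]
  note gg = has_gradient_lincomb[OF g, of c]
  show "(\<lambda>x. u x + c * v x) \<in> H1" using gg H1_iff_gradient by blast
  have L: "(\<lambda>x. (u x / \<xi>, wgrad u x)) \<in> L2" "(\<lambda>x. (v x / \<xi>, wgrad v x)) \<in> L2"
    using g by (auto simp: has_gradient_def intro!: L2_Pair)
  show "emb \<xi> (\<lambda>x. u x + c * v x) = emb \<xi> u + c *\<^sub>R emb \<xi> v"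
    unfolding emb_eq[OF gg] emb_def
    by (simp only: abs_l2_scaleR[OF L(2)] abs_l2_add[OF L(1) L2_scaleR[OF L(2)]])
      (simp add: add_divide_distrib)
qed

lemma H1_zero: "(\<lambda>_. 0) \<in> H1" "emb \<xi> (\<lambda>_. 0) = 0"
  using has_gradient_zero H1_iff_gradient
  by (blast, simp add: emb_eq[OF has_gradient_zero] zero_prod_def[symmetric] abs_l2_zero)

lemma H1_scale:
  assumes "u \<in> H1" shows "(\<lambda>x. c * u x) \<in> H1" "emb \<xi> (\<lambda>x. c * u x) = c *\<^sub>R emb \<xi> u"
  using H1_lincomb[OF H1_zero(1) assms, where c = c] by (simp_all add: H1_zero)

lemma H1_minus:
  assumes "u \<in> H1" shows "(\<lambda>x. - u x) \<in> H1" "emb \<xi> (\<lambda>x. - u x) = - emb \<xi> u"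
  using H1_scale[OF assms, where c = "-1"] by simp_all

lemma H1_add:
  assumes "u \<in> H1" "v \<in> H1"
  shows "(\<lambda>x. u x + v x) \<in> H1" "emb \<xi> (\<lambda>x. u x + v x) = emb \<xi> u + emb \<xi> v"
  using H1_lincomb[OF assms, where c = 1] by simp_all

lemma H1_diff:
  assumes "u \<in> H1" "v \<in> H1"
  shows "(\<lambda>x. u x - v x) \<in> H1" "emb \<xi> (\<lambda>x. u x - v x) = emb \<xi> u - emb \<xi> v"
  using H1_lincomb[OF assms, where c = "-1"] by simp_all

lemma H1_sum:
  assumes "\<And>j. j \<in> A \<Longrightarrow> F j \<in> H1"
  shows "(\<lambda>x. \<Sum>j\<in>A. F j x) \<in> H1" "emb \<xi> (\<lambda>x. \<Sum>j\<in>A. F j x) = (\<Sum>j\<in>A. emb \<xi> (F j))"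
proof -
  have "(\<lambda>x. \<Sum>j\<in>A. F j x) \<in> H1 \<and> emb \<xi> (\<lambda>x. \<Sum>j\<in>A. F j x) = (\<Sum>j\<in>A. emb \<xi> (F j))"
    using assms
  proof (induction A rule: infinite_finite_induct)
    case (insert j A)
    then have "F j \<in> H1" "(\<lambda>x. \<Sum>j\<in>A. F j x) \<in> H1" "emb \<xi> (\<lambda>x. \<Sum>j\<in>A. F j x) = (\<Sum>j\<in>A. emb \<xi> (F j))"
      by auto
    then show ?case using H1_add[of "F j" "\<lambda>x. \<Sum>j\<in>A. F j x"] insert.hyps by simp
  qed (simp_all add: H1_zero)
  then show "(\<lambda>x. \<Sum>j\<in>A. F j x) \<in> H1" "emb \<xi> (\<lambda>x. \<Sum>j\<in>A. F j x) = (\<Sum>j\<in>A. emb \<xi> (F j))" by auto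
qed

lemma inner_emb:
  assumes "u \<in> H1" "v \<in> H1"
  shows "emb \<xi> u \<bullet> emb \<xi> v =
    (LINT y|lborel. wgrad u y \<bullet> wgrad v y) + (1 / \<xi>\<^sup>2) * (LINT y|lborel. u y * v y)"
proof -
  note g = has_gradient_wgrad[OF assms(1)] has_gradient_wgrad[OF assms(2)]
  have L: "u \<in> L2" "v \<in> L2" "wgrad u \<in> L2" "wgrad v \<in> L2" using g by (auto simp: has_gradient_def)
  have "emb \<xi> u \<bullet> emb \<xi> v = (LINT y|lborel. (1 / \<xi>\<^sup>2) * (u y * v y) + wgrad u y \<bullet> wgrad v y)"
    unfolding emb_def by (subst inner_abs_l2) (auto simp: L L2_Pair inner_Pair power2_eq_square)
  also have "\<dots> = (LINT y|lborel. wgrad u y \<bullet> wgrad v y) + (1 / \<xi>\<^sup>2) * (LINT y|lborel. u y * v y)"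
    using L2_integrable_mult[OF L(1,2)] L2_integrable_inner[OF L(3,4)] by simp
  finally show ?thesis .
qed

lemma norm_emb:
  assumes "has_gradient u g"
  shows "(norm (emb \<xi> u))\<^sup>2 = (LINT x|lborel. (norm (g x))\<^sup>2 + (u x)\<^sup>2 / \<xi>\<^sup>2)"
proof -
  have "(\<lambda>x. (u x / \<xi>, g x)) \<in> L2" using assms by (auto simp: has_gradient_def intro!: L2_Pair)
  then show ?thesis
    unfolding emb_eq[OF assms] by (simp add: norm_abs_l2 norm_Pair power_divide add.commute)
qed

lemma H1_norm_eq: "u \<in> H1 \<Longrightarrow> H1_norm u = norm (emb 1 u)"
  using norm_emb[OF has_gradient_wgrad, of u 1] real_sqrt_abs[of "norm (emb 1 u)"]
  by (simp add: H1_norm_on_def set_lebesgue_integral_def add.commute)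

lemma norm_Pair_square: "(norm (a :: real, b :: R3))\<^sup>2 = a\<^sup>2 + (norm b)\<^sup>2"
  by (simp add: norm_Pair)

lemma norm_fst_snd_le: "norm (fst z) \<le> norm z" "norm (snd z) \<le> norm z"
  for z :: "'a::real_normed_vector \<times> 'b::real_normed_vector"
  by (cases z, simp add: norm_fst_le, cases z, simp add: norm_snd_le)

text \<open>Equivalence of the norms for different screening lengths. Length 1 is the H1 norm, so
  the factor \<open>max 1 \<xi>\<close> is the source of the constant depending on
  \<open>\<xi>\<close>.\<close>

lemma norm_emb_le:
  assumes "u \<in> H1" "0 < \<xi>" "0 < \<zeta>"
  shows "norm (emb \<zeta> u) \<le> max 1 (\<xi> / \<zeta>) * norm (emb \<xi> u)"
proof -
  note g = has_gradient_wgrad[OF assms(1)]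
  have L: "u \<in> L2" "wgrad u \<in> L2" using g by (auto simp: has_gradient_def)
  let ?m = "max 1 (\<xi> / \<zeta>)"
  show ?thesis unfolding emb_def
  proof (rule norm_abs_l2_mono)
    fix x
    have 1: "(u x / \<zeta>)\<^sup>2 \<le> ?m\<^sup>2 * (u x / \<xi>)\<^sup>2"
    proof -
      have "(\<xi> / \<zeta>)\<^sup>2 * (u x / \<xi>)\<^sup>2 \<le> ?m\<^sup>2 * (u x / \<xi>)\<^sup>2"
        using assms by (intro mult_right_mono power_mono) auto
      then show ?thesis using assms by (simp add: power_divide)
    qed
    have 2: "(norm (wgrad u x))\<^sup>2 \<le> ?m\<^sup>2 * (norm (wgrad u x))\<^sup>2"
      using mult_right_mono[OF power_mono[of 1 ?m 2], of "(norm (wgrad u x))\<^sup>2"] by simp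
    have "(norm (u x / \<zeta>, wgrad u x))\<^sup>2 \<le> (?m * norm (u x / \<xi>, wgrad u x))\<^sup>2"
      using 1 2 unfolding power_mult_distrib norm_Pair_square distrib_left by linarith
    then show "norm (u x / \<zeta>, wgrad u x) \<le> ?m * norm (u x / \<xi>, wgrad u x)"
      by (rule power2_le_imp_le) simp
  qed (auto intro: L2_Pair L)
qed

text \<open>Here \<open>p\<close> is any element of the ambient L2 space, such as a limit not yet
  known to come from H1. Convergence of embedded functions thus yields convergence of values and of
  each gradient component.\<close>

lemma norm_component_emb_le:
  assumes "u \<in> H1" "p \<in> L2" "0 < \<xi>"
  shows "norm (abs_l2 u - abs_l2 (\<lambda>x. \<xi> * fst (p x))) \<le> \<xi> * norm (emb \<xi> u - abs_l2 p)"
    and "norm (abs_l2 (\<lambda>x. wgrad u x $ i) - abs_l2 (\<lambda>x. snd (p x) $ i)) \<le> 1 * norm (emb \<xi> u - abs_l2 p)"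
    and "(\<lambda>x. \<xi> * fst (p x)) \<in> L2" "(\<lambda>x. snd (p x)) \<in> L2"
proof -
  note g = has_gradient_wgrad[OF assms(1)]
  have L: "u \<in> L2" "wgrad u \<in> L2" using g by (auto simp: has_gradient_def)
  have [measurable]: "p \<in> borel_measurable borel" using L2_measurable[OF assms(2)] by simp
  have fm: "(\<lambda>x. \<xi> * fst (p x)) \<in> borel_measurable lborel"
    using borel_measurable_continuous_on[OF continuous_on_fst[OF continuous_on_id] \<open>p \<in> borel_measurable borel\<close>]
    by simp
  have sm: "(\<lambda>x. snd (p x)) \<in> borel_measurable lborel"
    using borel_measurable_continuous_on[OF continuous_on_snd[OF continuous_on_id] \<open>p \<in> borel_measurable borel\<close>]
    by simp
  show fL: "(\<lambda>x. \<xi> * fst (p x)) \<in> L2"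
    using assms(3) norm_fst_snd_le(1)[of "p _"]
    by (intro L2_dominated[OF assms(2) fm, of "\<xi>"]) (simp add: abs_mult)
  show sL: "(\<lambda>x. snd (p x)) \<in> L2"
    by (intro L2_dominated[OF assms(2) sm, of 1]) (simp add: norm_fst_snd_le)
  have P: "(\<lambda>x. (u x / \<xi>, wgrad u x)) \<in> L2" by (rule L2_Pair[OF L])
  have D: "emb \<xi> u - abs_l2 p = abs_l2 (\<lambda>x. (u x / \<xi>, wgrad u x) - p x)"
    unfolding emb_def by (rule abs_l2_diff[OF P assms(2)])
  note DL = L2_diff[OF P assms(2)]
  show "norm (abs_l2 u - abs_l2 (\<lambda>x. \<xi> * fst (p x))) \<le> \<xi> * norm (emb \<xi> u - abs_l2 p)"
    unfolding D abs_l2_diff[OF L(1) fL]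
  proof (rule norm_abs_l2_mono[OF L2_diff[OF L(1) fL] DL])
    fix x
    have "u x - \<xi> * fst (p x) = \<xi> * fst ((u x / \<xi>, wgrad u x) - p x)"
      using assms(3) by (simp add: right_diff_distrib)
    then have "norm (u x - \<xi> * fst (p x)) = \<xi> * norm (fst ((u x / \<xi>, wgrad u x) - p x))"
      using assms(3) by (simp add: abs_mult)
    also have "\<dots> \<le> \<xi> * norm ((u x / \<xi>, wgrad u x) - p x)"
      using assms(3) by (intro mult_left_mono norm_fst_snd_le) simp
    finally show "norm (u x - \<xi> * fst (p x)) \<le> \<xi> * norm ((u x / \<xi>, wgrad u x) - p x)" .
  qed (use assms in simp)
  show "norm (abs_l2 (\<lambda>x. wgrad u x $ i) - abs_l2 (\<lambda>x. snd (p x) $ i)) \<le> 1 * norm (emb \<xi> u - abs_l2 p)"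
    unfolding D abs_l2_diff[OF L2_component[OF L(2)] L2_component[OF sL]]
  proof (rule norm_abs_l2_mono[OF L2_diff[OF L2_component[OF L(2)] L2_component[OF sL]] DL])
    fix x
    have "norm (wgrad u x $ i - snd (p x) $ i) \<le> norm (snd ((u x / \<xi>, wgrad u x) - p x))"
      using component_le_norm_cart[of "wgrad u x - snd (p x)" i] by simp
    also have "\<dots> \<le> 1 * norm ((u x / \<xi>, wgrad u x) - p x)"
      unfolding mult_1 by (rule norm_fst_snd_le)
    finally show "norm (wgrad u x $ i - snd (p x) $ i) \<le> 1 * norm ((u x / \<xi>, wgrad u x) - p x)" .
  qed simp
qed

text \<open>Picks a representative, so that operations on functions such as cutoffs apply to Hilbert
  space elements.\<close>

definition rep :: "real \<Rightarrow> (real \<times> R3) l2 \<Rightarrow> R3 \<Rightarrow> real" where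
  "rep \<xi> w = (SOME u. u \<in> H1 \<and> emb \<xi> u = w)"

lemma rep_H1: "w \<in> emb \<xi> ` H1 \<Longrightarrow> rep \<xi> w \<in> H1"
  and emb_rep: "w \<in> emb \<xi> ` H1 \<Longrightarrow> emb \<xi> (rep \<xi> w) = w"
proof -
  assume "w \<in> emb \<xi> ` H1"
  then have "\<exists>u. u \<in> H1 \<and> emb \<xi> u = w" by blast
  then have "rep \<xi> w \<in> H1 \<and> emb \<xi> (rep \<xi> w) = w" unfolding rep_def by (rule someI_ex)
  then show "rep \<xi> w \<in> H1" "emb \<xi> (rep \<xi> w) = w" by auto
qed

section \<open>Closed subspaces of the Hilbert space\<close>

lemma subspace_emb_H1: "subspace (emb \<xi> ` H1)"
proof (rule subspaceI)
  show "0 \<in> emb \<xi> ` H1" using H1_zero by (metis image_eqI)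
  show "f + g \<in> emb \<xi> ` H1" if "f \<in> emb \<xi> ` H1" "g \<in> emb \<xi> ` H1" for f g
    using that H1_add by (auto simp: image_iff) metis
  show "c *\<^sub>R f \<in> emb \<xi> ` H1" if "f \<in> emb \<xi> ` H1" for c f
    using that H1_scale by (auto simp: image_iff) metis
qed

text \<open>Completeness of H1: values and gradient components converge in L2, and weak derivatives
  pass to such limits. The factor \<open>\<xi>\<close> in \<open>?v\<close> undoes the scaling of
  the first component of \<open>emb\<close>.\<close>

lemma closed_emb_H1:
  assumes \<xi>: "0 < \<xi>" shows "closed (emb \<xi> ` H1)"
  unfolding closed_sequential_limits
proof (intro allI impI, elim conjE)
  fix f l assume "\<forall>n. f n \<in> emb \<xi> ` H1" and l: "f \<longlonglongrightarrow> l"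
  then obtain u where u: "\<And>n. u n \<in> H1" "\<And>n. f n = emb \<xi> (u n)" unfolding image_iff by metis
  obtain p where p: "p \<in> L2" "l = abs_l2 p" using abs_l2_surj by blast
  let ?v = "\<lambda>x. \<xi> * fst (p x)" and ?g = "\<lambda>x. snd (p x)"
  have lim: "(\<lambda>n. c * norm (emb \<xi> (u n) - abs_l2 p)) \<longlonglongrightarrow> 0" for c
    using l tendsto_mult_right_zero[OF tendsto_norm_zero[OF LIM_zero[of f l]]] by (simp add: u(2) p(2))
  note vL = norm_component_emb_le(3)[OF u(1)[of 0] p(1) \<xi>] and gL = norm_component_emb_le(4)[OF u(1)[of 0] p(1) \<xi>]
  have "(\<lambda>n. abs_l2 (u n) - abs_l2 ?v) \<longlonglongrightarrow> 0"
    by (rule Lim_null_comparison[OF always_eventually[OF allI] lim[of \<xi>]])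
      (rule norm_component_emb_le(1)[OF u(1) p(1) \<xi>])
  then have 1: "(\<lambda>n. abs_l2 (u n)) \<longlonglongrightarrow> abs_l2 ?v" by (rule LIM_zero_cancel)
  have 2: "(\<lambda>n. abs_l2 (\<lambda>x. wgrad (u n) x $ i)) \<longlonglongrightarrow> abs_l2 (\<lambda>x. ?g x $ i)" for i
  proof -
    have "(\<lambda>n. abs_l2 (\<lambda>x. wgrad (u n) x $ i) - abs_l2 (\<lambda>x. ?g x $ i)) \<longlonglongrightarrow> 0"
      by (rule Lim_null_comparison[OF always_eventually[OF allI] lim[of 1]])
        (rule norm_component_emb_le(2)[OF u(1) p(1) \<xi>])
    then show ?thesis by (rule LIM_zero_cancel)
  qed
  have "weak_partial i ?v (\<lambda>x. ?g x $ i)" for i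
    by (rule weak_partial_closed[OF _ vL L2_component[OF gL] 1 2])
      (use has_gradient_wgrad[OF u(1)] in \<open>simp add: has_gradient_iff\<close>)
  then have v: "has_gradient ?v ?g" by (simp add: has_gradient_iff)
  have "emb \<xi> ?v = l" unfolding emb_eq[OF v] p(2) using \<xi> by simp
  moreover have "?v \<in> H1" using v H1_iff_gradient by blast
  ultimately show "l \<in> emb \<xi> ` H1" by blast
qed

definition vanishing :: "real \<Rightarrow> R3 set \<Rightarrow> (real \<times> R3) l2 set" where
  "vanishing \<xi> A = emb \<xi> ` {u \<in> H1. eq_on A u (\<lambda>_. 0)}"

lemma emb_in_vanishing_iff:
  assumes "\<xi> \<noteq> 0" "u \<in> H1"
  shows "emb \<xi> u \<in> vanishing \<xi> A \<longleftrightarrow> eq_on A u (\<lambda>_. 0)"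
proof
  assume "emb \<xi> u \<in> vanishing \<xi> A"
  then obtain v where v: "v \<in> H1" "eq_on A v (\<lambda>_. 0)" "emb \<xi> u = emb \<xi> v" by (auto simp: vanishing_def)
  then have "AE x in lborel. u x = v x" using emb_eq_iff assms by blast
  then show "eq_on A u (\<lambda>_. 0)" using v(2) unfolding eq_on_def by eventually_elim simp
qed (use assms in \<open>auto simp: vanishing_def\<close>)

lemma emb_diff_in_vanishing_iff:
  assumes "\<xi> \<noteq> 0" "u \<in> H1" "v \<in> H1"
  shows "emb \<xi> u - emb \<xi> v \<in> vanishing \<xi> A \<longleftrightarrow> eq_on A u v"
  using emb_in_vanishing_iff[OF assms(1) H1_diff(1)[OF assms(2,3)]] H1_diff(2)[OF assms(2,3)]
  by (simp add: eq_on_def)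

lemma vanishing_subset: "vanishing \<xi> A \<subseteq> emb \<xi> ` H1"
  by (auto simp: vanishing_def)

lemma subspace_vanishing: "subspace (vanishing \<xi> A)"
proof (rule subspaceI)
  show "0 \<in> vanishing \<xi> A"
    unfolding vanishing_def using H1_zero by (intro image_eqI[of _ _ "\<lambda>_. 0"]) (auto simp: eq_on_def)
next
  fix f g assume "f \<in> vanishing \<xi> A" "g \<in> vanishing \<xi> A"
  then obtain u v where *: "u \<in> H1" "eq_on A u (\<lambda>_. 0)" "f = emb \<xi> u" "v \<in> H1" "eq_on A v (\<lambda>_. 0)" "g = emb \<xi> v"
    by (auto simp: vanishing_def)
  have "eq_on A (\<lambda>x. u x + v x) (\<lambda>_. 0)" using *(2,5) unfolding eq_on_def by eventually_elim simp
  then show "f + g \<in> vanishing \<xi> A"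
    unfolding vanishing_def using * H1_add[of u v] by (intro image_eqI[of _ _ "\<lambda>x. u x + v x"]) auto
next
  fix f c assume "f \<in> vanishing \<xi> A"
  then obtain u where *: "u \<in> H1" "eq_on A u (\<lambda>_. 0)" "f = emb \<xi> u"
    by (auto simp: vanishing_def)
  have "eq_on A (\<lambda>x. c * u x) (\<lambda>_. 0)" using *(2) unfolding eq_on_def by eventually_elim simp
  then show "c *\<^sub>R f \<in> vanishing \<xi> A"
    unfolding vanishing_def using * H1_scale[of u] by (intro image_eqI[of _ _ "\<lambda>x. c * u x"]) auto
qed

text \<open>On \<open>A\<close> the limit \<open>v\<close> coincides with the error
  \<open>v - u n\<close>, so multiplication by the indicator bounds the L2 norm of \<open>v\<close>
  on \<open>A\<close> by \<open>\<xi>\<close> times the distance to \<open>u n\<close>.\<close>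

lemma closed_vanishing:
  assumes \<xi>: "0 < \<xi>" and A: "A \<in> sets borel" shows "closed (vanishing \<xi> A)"
  unfolding closed_sequential_limits
proof (intro allI impI, elim conjE)
  fix f l assume f: "\<forall>n. f n \<in> vanishing \<xi> A" and l: "f \<longlonglongrightarrow> l"
  have "l \<in> emb \<xi> ` H1"
    using f l vanishing_subset closed_sequentially[OF closed_emb_H1[OF \<xi>], of f l] by blast
  then obtain v where v: "v \<in> H1" "l = emb \<xi> v" by blast
  obtain u where u: "\<And>n. u n \<in> H1" "\<And>n. eq_on A (u n) (\<lambda>_. 0)" "\<And>n. f n = emb \<xi> (u n)"
    using f unfolding vanishing_def image_iff by (metis (mono_tags, lifting) mem_Collect_eq)
  let ?I = "indicator A :: R3 \<Rightarrow> real"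
  have Im: "?I \<in> borel_measurable lborel" using A by simp
  have Ib: "\<bar>?I x\<bar> \<le> 1" for x by (simp add: indicator_def)
  have vL: "v \<in> L2" "u n \<in> L2" for n using v u by (auto simp: H1_def)
  have IvL: "(\<lambda>x. ?I x * v x) \<in> L2" by (rule L2_bounded_mult[OF vL(1) Im Ib])
  have est: "norm (abs_l2 (\<lambda>x. ?I x * v x)) \<le> \<xi> * norm (emb \<xi> (u n) - emb \<xi> v)" for n
  proof -
    have dL: "(\<lambda>x. u n x - v x) \<in> L2" using vL by (intro L2_diff)
    have IdL: "(\<lambda>x. ?I x * (u n x - v x)) \<in> L2" by (rule L2_bounded_mult[OF dL Im Ib])
    have "abs_l2 (\<lambda>x. ?I x * v x) = abs_l2 (\<lambda>x. - (?I x * (u n x - v x)))"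
      unfolding abs_l2_eq_iff[OF IvL L2_minus[OF IdL]]
      using u(2)[of n] unfolding eq_on_def by eventually_elim (auto simp: indicator_def)
    also have "norm \<dots> \<le> 1 * norm (abs_l2 (\<lambda>x. u n x - v x))"
      using Ib by (intro norm_abs_l2_mono L2_minus IdL dL) (auto simp: indicator_def)
    also have "abs_l2 (\<lambda>x. u n x - v x) = abs_l2 (u n) - abs_l2 (\<lambda>x. \<xi> * fst (v x / \<xi>, wgrad v x))"
      using \<xi> vL by (simp add: abs_l2_diff)
    also have "norm \<dots> \<le> \<xi> * norm (emb \<xi> (u n) - abs_l2 (\<lambda>x. (v x / \<xi>, wgrad v x)))"
      using has_gradient_wgrad[OF v(1)]
      by (intro norm_component_emb_le(1) u(1) \<xi> L2_Pair) (auto simp: has_gradient_def)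
    finally show ?thesis by (simp add: emb_def)
  qed
  have "(\<lambda>n. \<xi> * norm (emb \<xi> (u n) - emb \<xi> v)) \<longlonglongrightarrow> 0"
    using l tendsto_mult_right_zero[OF tendsto_norm_zero[OF LIM_zero[of f l]]] by (simp add: u(3) v(2))
  then have "norm (abs_l2 (\<lambda>x. ?I x * v x)) \<le> 0"
    by (rule LIMSEQ_le_const) (use est in blast)
  then have "abs_l2 (\<lambda>x. ?I x * v x) = abs_l2 (\<lambda>_. 0)" by (simp add: abs_l2_zero)
  then have "AE x in lborel. ?I x * v x = 0" unfolding abs_l2_eq_iff[OF IvL L2_zero] .
  then have "eq_on A v (\<lambda>_. 0)"
    unfolding eq_on_def by eventually_elim (auto simp: indicator_def split: if_splits)
  then show "l \<in> vanishing \<xi> A" using v by (auto simp: vanishing_def)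
qed

lemma weak_solution_iff:
  "weak_solution \<xi> A f u \<longleftrightarrow> u \<in> H1 \<and> (\<forall>v\<in>H1. eq_on A v (\<lambda>_. 0) \<longrightarrow> emb \<xi> u \<bullet> emb \<xi> v = f v)"
  unfolding weak_solution_def by (auto simp: inner_emb)

text \<open>The series are posed in the H1 norm while the projections use the inner product with
  \<open>\<xi>\<close>; norm equivalence makes the two notions of convergence agree.\<close>

lemma H1_has_sum_iff:
  assumes \<xi>: "0 < \<xi>"
  shows "H1_has_sum F J s \<longleftrightarrow>
    (\<forall>j\<in>J. F j \<in> H1) \<and> s \<in> H1 \<and> ((\<lambda>j. emb \<xi> (F j)) has_sum emb \<xi> s) J"
proof -
  have "((\<lambda>A. H1_norm (\<lambda>y. (\<Sum>j\<in>A. F j y) - s y)) \<longlongrightarrow> 0) (finite_subsets_at_top J)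
      \<longleftrightarrow> ((\<lambda>j. emb \<xi> (F j)) has_sum emb \<xi> s) J"
    if F: "\<forall>j\<in>J. F j \<in> H1" and s: "s \<in> H1"
  proof -
    let ?w = "\<lambda>A y. (\<Sum>j\<in>A. F j y) - s y"
    have w: "?w A \<in> H1" "emb \<zeta> (?w A) = (\<Sum>j\<in>A. emb \<zeta> (F j)) - emb \<zeta> s" if "A \<subseteq> J" for A \<zeta>
      using H1_diff[OF H1_sum(1) s, of A F] H1_sum(2)[of A F] F that by (auto simp: subset_iff)
    have le1: "norm (emb 1 (?w A)) \<le> max 1 \<xi> * norm (emb \<xi> (?w A))"
      and le2: "norm (emb \<xi> (?w A)) \<le> max 1 (1 / \<xi>) * norm (emb 1 (?w A))" if "A \<subseteq> J" for A
      using norm_emb_le[OF w(1)[OF that] \<xi> zero_less_one] norm_emb_le[OF w(1)[OF that] zero_less_one \<xi>] by simp_all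
    have ev: "\<forall>\<^sub>F A in finite_subsets_at_top J. A \<subseteq> J"
      by (rule eventually_finite_subsets_at_top_weakI)
    have "((\<lambda>A. H1_norm (?w A)) \<longlongrightarrow> 0) (finite_subsets_at_top J)
        \<longleftrightarrow> ((\<lambda>A. norm (emb \<xi> (?w A))) \<longlongrightarrow> 0) (finite_subsets_at_top J)"
    proof
      assume "((\<lambda>A. H1_norm (?w A)) \<longlongrightarrow> 0) (finite_subsets_at_top J)"
      then show "((\<lambda>A. norm (emb \<xi> (?w A))) \<longlongrightarrow> 0) (finite_subsets_at_top J)"
        by (rule Lim_null_comparison[rotated, OF tendsto_mult_right_zero[of _ _ "max 1 (1 / \<xi>)"]])
          (use ev in \<open>eventually_elim, use le2 w(1) in \<open>simp add: H1_norm_eq\<close>\<close>)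
    next
      assume "((\<lambda>A. norm (emb \<xi> (?w A))) \<longlongrightarrow> 0) (finite_subsets_at_top J)"
      then show "((\<lambda>A. H1_norm (?w A)) \<longlongrightarrow> 0) (finite_subsets_at_top J)"
        by (rule Lim_null_comparison[rotated, OF tendsto_mult_right_zero[of _ _ "max 1 \<xi>"]])
          (use ev in \<open>eventually_elim, use le1 w(1) in \<open>simp add: H1_norm_eq\<close>\<close>)
    qed
    also have "\<dots> \<longleftrightarrow> ((\<lambda>A. norm ((\<Sum>j\<in>A. emb \<xi> (F j)) - emb \<xi> s)) \<longlongrightarrow> 0) (finite_subsets_at_top J)"
      by (rule filterlim_cong[OF refl refl]) (use ev in \<open>eventually_elim, simp add: w(2)\<close>)
    also have "\<dots> \<longleftrightarrow> ((\<lambda>j. emb \<xi> (F j)) has_sum emb \<xi> s) J"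
      unfolding has_sum_def tendsto_norm_zero_iff by (rule LIM_zero_iff)
    finally show ?thesis .
  qed
  then show ?thesis unfolding H1_has_sum_def by blast
qed

lemma H1_norm_on_le:
  assumes "u \<in> H1" "S \<in> sets borel" shows "H1_norm_on S u \<le> H1_norm u"
proof -
  have L: "u \<in> L2" "wgrad u \<in> L2" using has_gradient_wgrad[OF assms(1)] by (auto simp: has_gradient_def)
  have int: "integrable lborel (\<lambda>x. (u x)\<^sup>2 + (norm (wgrad u x))\<^sup>2)"
    using L2_integrable[OF L(1)] L2_integrable[OF L(2)] by simp
  have "(LINT x|lborel. indicator S x * ((u x)\<^sup>2 + (norm (wgrad u x))\<^sup>2))
      \<le> (LINT x|lborel. (u x)\<^sup>2 + (norm (wgrad u x))\<^sup>2)"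
    by (intro integral_mono integrable_indicator_mult int assms) (auto simp: indicator_def)
  then show ?thesis unfolding H1_norm_on_def set_lebesgue_integral_def by simp
qed

section \<open>Functionals in the dual space\<close>

lemma H_minus1_add: "f \<in> H_minus1 \<Longrightarrow> u \<in> H1 \<Longrightarrow> v \<in> H1 \<Longrightarrow> f (\<lambda>x. u x + v x) = f u + f v"
  and H_minus1_scale: "f \<in> H_minus1 \<Longrightarrow> u \<in> H1 \<Longrightarrow> f (\<lambda>x. c * u x) = c * f u"
  by (simp_all add: H_minus1_def)

lemma H_minus1_bounded:
  assumes "f \<in> H_minus1" obtains B where "\<And>u. u \<in> H1 \<Longrightarrow> \<bar>f u\<bar> \<le> B * H1_norm u"
proof -
  have "\<exists>B. \<forall>u\<in>H1. \<bar>f u\<bar> \<le> B * H1_norm u" using assms by (simp add: H_minus1_def)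
  then show ?thesis using that by blast
qed

text \<open>A functional acts on functions, not on classes; boundedness makes it blind to a
  difference of norm zero.\<close>

lemma H_minus1_cong:
  assumes f: "f \<in> H_minus1" and u: "u \<in> H1" "v \<in> H1" "emb \<xi> u = emb \<xi> v" and \<xi>: "0 < \<xi>"
  shows "f u = f v"
proof -
  obtain B where B: "\<And>u. u \<in> H1 \<Longrightarrow> \<bar>f u\<bar> \<le> B * H1_norm u"
    using H_minus1_bounded[OF f] by blast
  have d: "(\<lambda>x. u x - v x) \<in> H1" and 0: "emb \<xi> (\<lambda>x. u x - v x) = 0" using H1_diff[OF u(1,2)] u(3) by auto
  have "norm (emb 1 (\<lambda>x. u x - v x)) \<le> 0" using norm_emb_le[OF d \<xi> zero_less_one] 0 by simp
  then have "f (\<lambda>x. u x - v x) = 0" using B[OF d] H1_norm_eq[OF d] by simp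
  moreover have "f u = f (\<lambda>x. u x - v x) + f v"
    using H_minus1_add[OF f d u(2)] by simp
  ultimately show ?thesis by simp
qed

text \<open>The functional is transported to the Hilbert space through \<open>rep\<close>. The
  vector \<open>a\<close> obtained here is the embedding of \<open>\<Phi> 0\<close>.\<close>

lemma H_minus1_riesz:
  assumes f: "f \<in> H_minus1" and \<xi>: "0 < \<xi>"
  obtains a where "a \<in> emb \<xi> ` H1" "\<And>v. v \<in> H1 \<Longrightarrow> f v = a \<bullet> emb \<xi> v"
proof -
  let ?r = "rep \<xi>"
  have f_rep: "f (?r (emb \<xi> u)) = f u" if "u \<in> H1" for u
    using H_minus1_cong[OF f _ that _ \<xi>] rep_H1[OF imageI[OF that]] emb_rep[OF imageI[OF that]] by blast
  have f_add: "f (\<lambda>x. u x + v x) = f u + f v" if "u \<in> H1" "v \<in> H1" for u v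
    by (rule H_minus1_add[OF f that])
  have f_scale: "f (\<lambda>x. c * u x) = c * f u" if "u \<in> H1" for u c
    by (rule H_minus1_scale[OF f that])
  obtain B where B: "\<And>u. u \<in> H1 \<Longrightarrow> \<bar>f u\<bar> \<le> B * H1_norm u"
    using H_minus1_bounded[OF f] by blast
  obtain a where a: "a \<in> emb \<xi> ` H1" "\<And>w. w \<in> emb \<xi> ` H1 \<Longrightarrow> f (?r w) = a \<bullet> w"
  proof (rule riesz_representation[OF subspace_emb_H1 closed_emb_H1[OF \<xi>], of "\<lambda>w. f (?r w)" "\<bar>B\<bar> * max 1 \<xi>"])
    fix v w assume "v \<in> emb \<xi> ` H1" "w \<in> emb \<xi> ` H1"
    then obtain p q where pq: "p \<in> H1" "q \<in> H1" "v = emb \<xi> p" "w = emb \<xi> q" by blast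
    then have "v + w = emb \<xi> (\<lambda>x. p x + q x)" by (simp add: H1_add)
    then show "f (?r (v + w)) = f (?r v) + f (?r w)" using pq by (simp add: f_rep f_add H1_add(1))
  next
    fix c w assume "w \<in> emb \<xi> ` H1"
    then obtain q where q: "q \<in> H1" "w = emb \<xi> q" by blast
    then have "c *\<^sub>R w = emb \<xi> (\<lambda>x. c * q x)" by (simp add: H1_scale)
    then show "f (?r (c *\<^sub>R w)) = c * f (?r w)" using q by (simp add: f_rep f_scale H1_scale(1))
  next
    fix w assume "w \<in> emb \<xi> ` H1"
    then obtain q where q: "q \<in> H1" "w = emb \<xi> q" by blast
    have "\<bar>f (?r w)\<bar> \<le> B * H1_norm q" using B q by (simp add: f_rep)
    also have "\<dots> \<le> \<bar>B\<bar> * norm (emb 1 q)"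
      unfolding H1_norm_eq[OF q(1)] by (intro mult_right_mono) auto
    also have "\<dots> \<le> \<bar>B\<bar> * (max 1 \<xi> * norm w)"
      using norm_emb_le[OF q(1) \<xi> zero_less_one] q(2) by (intro mult_left_mono) auto
    finally show "\<bar>f (?r w)\<bar> \<le> \<bar>B\<bar> * max 1 \<xi> * norm w" by (simp add: mult.assoc)
  qed (rule that)
  show ?thesis
    by (rule that[OF a(1)]) (use a(2) f_rep in force)
qed

lemma H_minus1_bdd_above:
  assumes f: "f \<in> H_minus1" shows "bdd_above {\<bar>f v\<bar> | v. v \<in> H1 \<and> H1_norm v \<le> 1}"
proof -
  obtain B where B: "\<And>u. u \<in> H1 \<Longrightarrow> \<bar>f u\<bar> \<le> B * H1_norm u"
    using H_minus1_bounded[OF f] by blast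
  show ?thesis
  proof (rule bdd_aboveI)
    fix y assume "y \<in> {\<bar>f v\<bar> | v. v \<in> H1 \<and> H1_norm v \<le> 1}"
    then obtain u where u: "y = \<bar>f u\<bar>" "u \<in> H1" "H1_norm u \<le> 1" by blast
    have "B * H1_norm u \<le> \<bar>B\<bar> * 1"
      using u H1_norm_eq[OF u(2)] by (intro mult_mono) auto
    then show "y \<le> \<bar>B\<bar>" using B[OF u(2)] u(1) by linarith
  qed
qed

text \<open>Scaling to unit norm puts \<open>v\<close> into the set of the supremum; for norm zero,
  where scaling fails, boundedness alone gives \<open>f v = 0\<close>.\<close>

lemma H_minus1_norm_bound:
  assumes f: "f \<in> H_minus1" and v: "v \<in> H1"
  shows "\<bar>f v\<bar> \<le> H_minus1_norm f * H1_norm v"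
proof -
  obtain B where B: "\<And>u. u \<in> H1 \<Longrightarrow> \<bar>f u\<bar> \<le> B * H1_norm u"
    using H_minus1_bounded[OF f] by blast
  show ?thesis
  proof (cases "H1_norm v = 0")
    case True
    then show ?thesis using B[OF v] by simp
  next
    case False
    define t where "t = H1_norm v"
    have t: "0 < t" using False H1_norm_eq[OF v] by (simp add: t_def)
    let ?w = "\<lambda>x. (1 / t) * v x"
    have w: "?w \<in> H1" by (rule H1_scale(1)[OF v])
    have "H1_norm ?w = \<bar>1 / t\<bar> * norm (emb 1 v)"
      unfolding H1_norm_eq[OF w] H1_scale(2)[OF v] by simp
    then have "H1_norm ?w = 1" using t by (simp add: t_def H1_norm_eq[OF v])
    then have "\<bar>f ?w\<bar> \<in> {\<bar>f v\<bar> | v. v \<in> H1 \<and> H1_norm v \<le> 1}" using w by (intro CollectI exI[of _ ?w]) simp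
    then have "\<bar>f ?w\<bar> \<le> H_minus1_norm f"
      unfolding H_minus1_norm_def by (rule cSup_upper) (rule H_minus1_bdd_above[OF f])
    then have "\<bar>f v\<bar> / t \<le> H_minus1_norm f"
      unfolding H_minus1_scale[OF f v, of "1 / t"] using t by (simp add: abs_mult)
    then show ?thesis using t by (simp add: t_def[symmetric] pos_divide_le_eq)
  qed
qed

lemma H_minus1_norm_nonneg:
  assumes f: "f \<in> H_minus1" shows "0 \<le> H_minus1_norm f"
proof -
  have z: "H1_norm (\<lambda>_. 0) \<le> 1" using H1_norm_eq[OF H1_zero(1)] H1_zero(2)[of 1] by simp
  have "\<bar>f (\<lambda>_. 0)\<bar> \<le> H_minus1_norm f"
    unfolding H_minus1_norm_def
  proof (rule cSup_upper)
    show "\<bar>f (\<lambda>_. 0)\<bar> \<in> {\<bar>f v\<bar> | v. v \<in> H1 \<and> H1_norm v \<le> 1}"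
      using z H1_zero(1) by blast
    show "bdd_above {\<bar>f v\<bar> | v. v \<in> H1 \<and> H1_norm v \<le> 1}"
      by (rule H_minus1_bdd_above[OF f])
  qed
  then show ?thesis using abs_ge_zero order_trans by blast
qed

section \<open>Separated particles\<close>

text \<open>\<open>R i\<close> is the radius reserved for particle \<open>i\<close>: half the
  nearest distance if that is finite, a sufficiently large number otherwise. The conditions named
  \<open>r\<close> are those under which \<open>cutoff_energy\<close> applies.\<close>

locale separated_particles =
  fixes \<xi> :: real and I :: "nat set" and x :: "nat \<Rightarrow> R3" and r R :: "nat \<Rightarrow> real"
  assumes \<xi>: "0 < \<xi>"
    and r: "\<And>i. i \<in> I \<Longrightarrow> 0 < r i" "\<And>i. i \<in> I \<Longrightarrow> r i * exp 16 \<le> R i"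
      "\<And>i. i \<in> I \<Longrightarrow> r i * exp 16 / R i ^ 3 \<le> 1 / \<xi>\<^sup>2"
    and disj: "\<And>i j. i \<in> I \<Longrightarrow> j \<in> I \<Longrightarrow> i \<noteq> j \<Longrightarrow> ball (x i) (R i) \<inter> ball (x j) (R j) = {}"
begin

section \<open>Truncation near a particle\<close>

definition trunc :: "nat \<Rightarrow> (R3 \<Rightarrow> real) \<Rightarrow> R3 \<Rightarrow> real" where
  "trunc i u = (\<lambda>y. cutoff (r i) (norm (y - x i)) * u y)"

definition trunc_grad :: "nat \<Rightarrow> (R3 \<Rightarrow> real) \<Rightarrow> R3 \<Rightarrow> R3" where
  "trunc_grad i u = (\<lambda>y. cutoff (r i) (norm (y - x i)) *\<^sub>R wgrad u y
    + u y *\<^sub>R (cutoff' (r i) (norm (y - x i)) / norm (y - x i)) *\<^sub>R (y - x i))"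

lemma trunc:
  assumes "i \<in> I" "u \<in> H1"
  shows "has_gradient (trunc i u) (trunc_grad i u)"
    and "\<And>y. y \<in> cball (x i) (r i) \<Longrightarrow> trunc i u y = u y"
    and "\<And>y. y \<notin> ball (x i) (R i) \<Longrightarrow> trunc i u y = 0 \<and> trunc_grad i u y = 0"
    and "(LINT y|lborel. (norm (trunc_grad i u y))\<^sup>2 + (trunc i u y)\<^sup>2 / \<xi>\<^sup>2)
      \<le> 25 / 16 * (LINT y|lborel. indicator (ball (x i) (R i)) y * ((norm (wgrad u y))\<^sup>2 + (u y)\<^sup>2 / \<xi>\<^sup>2))"
proof -
  note e = cutoff_energy[OF has_gradient_wgrad[OF assms(2)] r(1)[OF assms(1)] r(2)[OF assms(1)] \<xi> r(3)[OF assms(1)], where c = "x i"]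
  show "has_gradient (trunc i u) (trunc_grad i u)"
    unfolding trunc_def trunc_grad_def by (rule e(1))
  show "trunc i u y = u y" if "y \<in> cball (x i) (r i)" for y
    unfolding trunc_def by (rule e(2)[OF that])
  show "trunc i u y = 0 \<and> trunc_grad i u y = 0" if "y \<notin> ball (x i) (R i)" for y
    unfolding trunc_def trunc_grad_def by (rule e(3)[OF that])
  show "(LINT y|lborel. (norm (trunc_grad i u y))\<^sup>2 + (trunc i u y)\<^sup>2 / \<xi>\<^sup>2)
      \<le> 25 / 16 * (LINT y|lborel. indicator (ball (x i) (R i)) y * ((norm (wgrad u y))\<^sup>2 + (u y)\<^sup>2 / \<xi>\<^sup>2))"
    unfolding trunc_def trunc_grad_def by (rule e(4))
qed

lemma trunc_H1: "i \<in> I \<Longrightarrow> u \<in> H1 \<Longrightarrow> trunc i u \<in> H1"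
  using trunc(1) H1_iff_gradient by blast

lemma cball_subset_ball: "i \<in> I \<Longrightarrow> cball (x i) (r i) \<subseteq> ball (x i) (R i)"
proof -
  assume i: "i \<in> I"
  have "r i * 1 < r i * exp 16" using r(1)[OF i] by (intro mult_strict_left_mono) auto
  then have "r i < R i" using r(2)[OF i] by simp
  then show ?thesis by auto
qed

lemma trunc_orthogonal:
  assumes "i \<in> I" "j \<in> I" "i \<noteq> j" "u \<in> H1" "v \<in> H1"
  shows "emb \<xi> (trunc i u) \<bullet> emb \<xi> (trunc j v) = 0"
proof -
  note t = trunc[OF assms(1,4)] and t' = trunc[OF assms(2,5)]
  have L: "(\<lambda>y. (trunc i u y / \<xi>, trunc_grad i u y)) \<in> L2" "(\<lambda>y. (trunc j v y / \<xi>, trunc_grad j v y)) \<in> L2"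
    using t(1) t'(1) by (auto simp: has_gradient_def intro!: L2_Pair)
  have "(trunc i u y / \<xi>, trunc_grad i u y) \<bullet> (trunc j v y / \<xi>, trunc_grad j v y) = 0" for y
  proof (cases "y \<in> ball (x i) (R i)")
    case True
    then have "y \<notin> ball (x j) (R j)" using disj[OF assms(1,2,3)] by blast
    then show ?thesis using t'(3) by (simp add: zero_prod_def)
  next
    case False
    then show ?thesis using t(3) by (simp add: zero_prod_def)
  qed
  then show ?thesis
    unfolding emb_eq[OF t(1)] emb_eq[OF t'(1)] inner_abs_l2[OF L] by simp
qed

lemma trunc_bound:
  assumes J: "finite J" "J \<subseteq> I" and u: "u \<in> H1"
  shows "(\<Sum>i\<in>J. (norm (emb \<xi> (trunc i u)))\<^sup>2) \<le> 25 / 16 * (norm (emb \<xi> u))\<^sup>2"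
proof -
  let ?e = "\<lambda>y. (norm (wgrad u y))\<^sup>2 + (u y)\<^sup>2 / \<xi>\<^sup>2"
  let ?B = "\<lambda>i. indicator (ball (x i) (R i)) :: R3 \<Rightarrow> real"
  have L: "u \<in> L2" "wgrad u \<in> L2" using has_gradient_wgrad[OF u] by (auto simp: has_gradient_def)
  have int: "integrable lborel ?e" using L2_integrable[OF L(1)] L2_integrable[OF L(2)] by simp
  have intB: "integrable lborel (\<lambda>y. ?B i y * ?e y)" for i by (intro integrable_indicator_mult int) simp
  have "(\<Sum>i\<in>J. (norm (emb \<xi> (trunc i u)))\<^sup>2) \<le> (\<Sum>i\<in>J. 25 / 16 * (LINT y|lborel. ?B i y * ?e y))"
  proof (rule sum_mono)
    fix i assume "i \<in> J"
    then have i: "i \<in> I" using J by blast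
    show "(norm (emb \<xi> (trunc i u)))\<^sup>2 \<le> 25 / 16 * (LINT y|lborel. ?B i y * ?e y)"
      unfolding norm_emb[OF trunc(1)[OF i u]] by (rule trunc(4)[OF i u])
  qed
  also have "\<dots> = 25 / 16 * (LINT y|lborel. (\<Sum>i\<in>J. ?B i y * ?e y))"
    using intB by (simp add: sum_distrib_left)
  also have "\<dots> \<le> 25 / 16 * (LINT y|lborel. ?e y)"
  proof (intro mult_left_mono integral_mono int Bochner_Integration.integrable_sum intB)
    fix y
    \<comment> \<open>Disjointness bounds the sum of the indicators by 1, so the constant does not
      depend on the number of particles.\<close>
    have "disjoint_family_on (\<lambda>i. ball (x i) (R i)) J"
      unfolding disjoint_family_on_def using disj J(2) by blast
    then have "(\<Sum>i\<in>J. ?B i y) = indicator (\<Union>i\<in>J. ball (x i) (R i)) y"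
      using J(1) by (simp add: indicator_UN_disjoint)
    also have "\<dots> \<le> 1" by (simp add: indicator_def)
    finally have "(\<Sum>i\<in>J. ?B i y) * ?e y \<le> 1 * ?e y" by (intro mult_right_mono) auto
    then show "(\<Sum>i\<in>J. ?B i y * ?e y) \<le> ?e y" by (simp add: sum_distrib_right)
  qed simp
  also have "\<dots> = 25 / 16 * (norm (emb \<xi> u))\<^sup>2"
    using norm_emb[OF has_gradient_wgrad[OF u], of \<xi>] by simp
  finally show ?thesis .
qed

abbreviation "M \<equiv> emb \<xi> ` H1"
abbreviation "V i \<equiv> vanishing \<xi> (cball (x i) (r i))"

text \<open>Cutoffs act on functions, so an element of \<open>M\<close> passes through a
  representative. From here on the abstract theory is available with
  \<open>b = 25/16\<close>.\<close>

sublocale reflections M V I "\<lambda>i w. emb \<xi> (trunc i (rep \<xi> w))" "25 / 16"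
proof
  show "subspace M" by (rule subspace_emb_H1)
  show "closed M" by (rule closed_emb_H1[OF \<xi>])
  fix i assume i: "i \<in> I"
  show "subspace (V i)" by (rule subspace_vanishing)
  show "closed (V i)" by (rule closed_vanishing[OF \<xi>]) simp
  show "V i \<subseteq> M" by (rule vanishing_subset)
  fix w assume w: "w \<in> M"
  note u = rep_H1[OF w] and eu = emb_rep[OF w]
  show "emb \<xi> (trunc i (rep \<xi> w)) \<in> M" using trunc_H1[OF i u] by blast
  have "eq_on (cball (x i) (r i)) (rep \<xi> w) (trunc i (rep \<xi> w))"
    unfolding eq_on_def using trunc(2)[OF i u] by simp
  then have "emb \<xi> (rep \<xi> w) - emb \<xi> (trunc i (rep \<xi> w)) \<in> V i"
    using emb_diff_in_vanishing_iff[OF _ u trunc_H1[OF i u]] \<xi> by simp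
  then show "w - emb \<xi> (trunc i (rep \<xi> w)) \<in> V i" using eu by simp
  fix j assume j: "j \<in> I" "i \<noteq> j"
  \<comment> \<open>Particle \<open>j\<close> lies inside its own reserved ball, which the support
    of the cutoff around \<open>x i\<close> avoids.\<close>
  have "y \<notin> ball (x i) (R i)" if "y \<in> cball (x j) (r j)" for y
    using that cball_subset_ball[OF j(1)] disj[OF i j] by blast
  then have "eq_on (cball (x j) (r j)) (trunc i (rep \<xi> w)) (\<lambda>_. 0)"
    unfolding eq_on_def using trunc(3)[OF i u] by simp
  then show "emb \<xi> (trunc i (rep \<xi> w)) \<in> V j"
    using emb_in_vanishing_iff[OF _ trunc_H1[OF i u]] \<xi> by simp
  fix w' assume "w' \<in> M"
  then show "emb \<xi> (trunc i (rep \<xi> w)) \<bullet> emb \<xi> (trunc j (rep \<xi> w')) = 0"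
    by (intro trunc_orthogonal i j u rep_H1)
next
  fix J w assume "finite J" "J \<subseteq> I" "w \<in> M"
  then show "(\<Sum>i\<in>J. (norm (emb \<xi> (trunc i (rep \<xi> w))))\<^sup>2) \<le> 25 / 16 * (norm w)\<^sup>2"
    using trunc_bound[of J "rep \<xi> w"] rep_H1 emb_rep by simp
qed simp_all

text \<open>The index set is countable, so the exceptional null sets of the individual particles can
  be united.\<close>

lemma emb_in_W_iff:
  assumes "u \<in> H1"
  shows "emb \<xi> u \<in> W \<longleftrightarrow> eq_on (particles I x r) u (\<lambda>_. 0)"
proof -
  have "eq_on (particles I x r) u (\<lambda>_. 0) \<longleftrightarrow> (AE y in lborel. \<forall>i\<in>I. y \<in> cball (x i) (r i) \<longrightarrow> u y = 0)"
    unfolding eq_on_def particles_def by (intro AE_cong) auto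
  also have "\<dots> \<longleftrightarrow> (\<forall>i\<in>I. eq_on (cball (x i) (r i)) u (\<lambda>_. 0))"
    unfolding eq_on_def by (rule AE_ball_countable) simp
  finally show ?thesis
    using emb_in_vanishing_iff[OF _ assms] \<xi> assms by (simp add: W_def)
qed

section \<open>From functions to the abstract iteration and back\<close>

lemma subspace_W: "subspace W" and closed_W: "closed W"
proof -
  have "W = M \<inter> (\<Inter>i\<in>I. V i)" by (auto simp: W_def)
  then show "subspace W" "closed W"
    using M V by (auto intro!: subspace_inter subspace_Inter closed_INT)
qed

lemma particles_borel: "particles I x r \<in> sets borel"
  unfolding particles_def by (intro sets.countable_UN'') auto

text \<open>Tested on \<open>W\<close>, the weak equation says that \<open>a - emb \<xi> u\<close>
  is orthogonal to \<open>W\<close>: the solution is the projection of the Riesz vector. Existence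
  and uniqueness are read off from this.\<close>

lemma dirichlet_solution_iff:
  assumes a: "\<And>v. v \<in> H1 \<Longrightarrow> f v = a \<bullet> emb \<xi> v"
  shows "dirichlet_solution \<xi> (particles I x r) f u \<longleftrightarrow>
    u \<in> H1 \<and> emb \<xi> u \<in> W \<and> (\<forall>w\<in>W. (a - emb \<xi> u) \<bullet> w = 0)"
proof -
  have "(\<forall>v\<in>H1. eq_on (particles I x r) v (\<lambda>_. 0) \<longrightarrow> emb \<xi> u \<bullet> emb \<xi> v = f v)
      \<longleftrightarrow> (\<forall>w\<in>W. (a - emb \<xi> u) \<bullet> w = 0)"
  proof
    assume *: "\<forall>v\<in>H1. eq_on (particles I x r) v (\<lambda>_. 0) \<longrightarrow> emb \<xi> u \<bullet> emb \<xi> v = f v"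
    show "\<forall>w\<in>W. (a - emb \<xi> u) \<bullet> w = 0"
    proof
      fix w assume w: "w \<in> W"
      then obtain v where v: "v \<in> H1" "w = emb \<xi> v" by (auto simp: W_def)
      then have "emb \<xi> u \<bullet> w = a \<bullet> w" using * w emb_in_W_iff[OF v(1)] a[OF v(1)] by simp
      then show "(a - emb \<xi> u) \<bullet> w = 0" by (simp add: inner_diff_left)
    qed
  next
    assume *: "\<forall>w\<in>W. (a - emb \<xi> u) \<bullet> w = 0"
    show "\<forall>v\<in>H1. eq_on (particles I x r) v (\<lambda>_. 0) \<longrightarrow> emb \<xi> u \<bullet> emb \<xi> v = f v"
    proof (intro ballI impI)
      fix v assume v: "v \<in> H1" "eq_on (particles I x r) v (\<lambda>_. 0)"
      then have "(a - emb \<xi> u) \<bullet> emb \<xi> v = 0" using * emb_in_W_iff[OF v(1)] by blast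
      then show "emb \<xi> u \<bullet> emb \<xi> v = f v" using a[OF v(1)] by (simp add: inner_diff_left)
    qed
  qed
  then show ?thesis
    unfolding dirichlet_solution_def weak_solution_iff using emb_in_W_iff by blast
qed

text \<open>The homogeneous equation outside the ball is orthogonality to \<open>V i\<close>, and
  agreement inside it is membership of the difference in \<open>V i\<close>; together they
  characterize the projection residual.\<close>

lemma is_Q_iff:
  assumes i: "i \<in> I" and w: "w \<in> H1" and q: "q \<in> H1"
  shows "is_Q \<xi> (x i) (r i) w q \<longleftrightarrow> emb \<xi> q = Q i (emb \<xi> w)"
proof -
  have \<xi>0: "\<xi> \<noteq> 0" using \<xi> by simp
  have "is_Q \<xi> (x i) (r i) w q \<longleftrightarrow> (\<forall>v\<in>V i. emb \<xi> q \<bullet> v = 0) \<and> emb \<xi> w - emb \<xi> q \<in> V i"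
    unfolding is_Q_def weak_solution_iff emb_diff_in_vanishing_iff[OF \<xi>0 w q]
    using q by (auto simp: vanishing_def eq_on_def)
  also have "\<dots> \<longleftrightarrow> emb \<xi> q = Q i (emb \<xi> w)"
  proof
    assume "(\<forall>v\<in>V i. emb \<xi> q \<bullet> v = 0) \<and> emb \<xi> w - emb \<xi> q \<in> V i"
    then show "emb \<xi> q = Q i (emb \<xi> w)" by (intro Q_unique[OF i, symmetric]) auto
  qed (simp add: Q_orth[OF i] Q_diff_V[OF i])
  finally show ?thesis .
qed

lemma method_of_reflections_terms:
  assumes mor: "method_of_reflections \<xi> f I x r \<Psi> \<Phi>" and a: "a \<in> M" "\<And>v. v \<in> H1 \<Longrightarrow> f v = a \<bullet> emb \<xi> v"
  shows "\<And>k. \<Phi> k \<in> H1" and "emb \<xi> (\<Phi> 0) = a"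
    and "reflection_terms a (\<lambda>k i. emb \<xi> (\<Psi> k i)) (\<lambda>k. emb \<xi> (\<Phi> k))"
proof -
  have m0: "weak_solution \<xi> {} f (\<Phi> 0)"
    and m1: "\<And>i. i \<in> I \<Longrightarrow> is_Q \<xi> (x i) (r i) (\<Phi> 0) (\<lambda>y. - \<Psi> 1 i y)"
    and m2: "\<And>k i. k \<ge> 2 \<Longrightarrow> i \<in> I \<Longrightarrow> \<exists>s. H1_has_sum (\<Psi> (k - 1)) (I - {i}) s \<and>
        is_Q \<xi> (x i) (r i) s (\<lambda>y. - \<Psi> k i y)"
    and m3: "\<And>k. k \<ge> 1 \<Longrightarrow> H1_has_sum (\<Psi> k) I (\<Phi> k)"
    using mor unfolding method_of_reflections_def by blast+
  have \<Phi>0: "\<Phi> 0 \<in> H1" using m0 by (simp add: weak_solution_def)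
  show \<Phi>: "\<Phi> k \<in> H1" for k
    using \<Phi>0 m3[of k] by (cases "k = 0") (auto simp: H1_has_sum_def)
  have \<Psi>: "\<Psi> k i \<in> H1" if "k \<ge> 1" "i \<in> I" for k i
    using m3[OF that(1)] that(2) by (simp add: H1_has_sum_def)
  have \<Psi>': "emb \<xi> (\<Psi> k i) = - Q i (emb \<xi> s)" if "k \<ge> 1" "i \<in> I" "s \<in> H1" "is_Q \<xi> (x i) (r i) s (\<lambda>y. - \<Psi> k i y)" for k i s
    using is_Q_iff[OF that(2,3) H1_minus(1)[OF \<Psi>[OF that(1,2)]]] that(4)
      H1_minus(2)[OF \<Psi>[OF that(1,2)], of \<xi>] by (metis minus_minus)
  \<comment> \<open>Without particles every element of H1 is a test function, in particular this
    difference itself.\<close>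
  have "a - emb \<xi> (\<Phi> 0) \<in> M" using a(1) \<Phi>0 M(1) by (intro subspace_diff) auto
  then obtain v where v: "v \<in> H1" "a - emb \<xi> (\<Phi> 0) = emb \<xi> v" by blast
  have "emb \<xi> (\<Phi> 0) \<bullet> emb \<xi> v = f v"
    using m0 v(1) unfolding weak_solution_iff by (simp add: eq_on_def)
  then have "(a - emb \<xi> (\<Phi> 0)) \<bullet> (a - emb \<xi> (\<Phi> 0)) = 0"
    using a(2)[OF v(1)] v(2) by (metis inner_diff_left right_minus_eq)
  then show a0: "emb \<xi> (\<Phi> 0) = a" by simp
  show "reflection_terms a (\<lambda>k i. emb \<xi> (\<Psi> k i)) (\<lambda>k. emb \<xi> (\<Phi> k))"
    unfolding reflection_terms_def
  proof (intro conjI allI impI ballI)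
    show "emb \<xi> (\<Phi> 0) = a" by (rule a0)
    show "emb \<xi> (\<Psi> 1 i) = - Q i a" if "i \<in> I" for i
      using \<Psi>'[OF _ that \<Phi>0 m1[OF that]] a0 by simp
    show "((\<lambda>i. emb \<xi> (\<Psi> k i)) has_sum emb \<xi> (\<Phi> k)) I" if "k \<ge> 1" for k
      using m3[OF that] unfolding H1_has_sum_iff[OF \<xi>] by blast
    show "\<exists>s. ((\<lambda>i. emb \<xi> (\<Psi> (k - 1) i)) has_sum s) (I - {i}) \<and> emb \<xi> (\<Psi> k i) = - Q i s"
      if k: "2 \<le> k" and i: "i \<in> I" for k i
    proof -
      obtain s where s: "H1_has_sum (\<Psi> (k - 1)) (I - {i}) s" "is_Q \<xi> (x i) (r i) s (\<lambda>y. - \<Psi> k i y)"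
        using m2[OF k i] by blast
      have "((\<lambda>i. emb \<xi> (\<Psi> (k - 1) i)) has_sum emb \<xi> s) (I - {i})" "s \<in> H1"
        using s(1) unfolding H1_has_sum_iff[OF \<xi>] by blast+
      moreover have "emb \<xi> (\<Psi> k i) = - Q i (emb \<xi> s)"
        using k by (intro \<Psi>' i s(2) \<open>s \<in> H1\<close>) simp
      ultimately show ?thesis by blast
    qed
  qed
qed

lemma method_of_reflections_exists:
  assumes a: "a \<in> M" "\<And>v. v \<in> H1 \<Longrightarrow> f v = a \<bullet> emb \<xi> v"
  shows "\<exists>\<Psi> \<Phi>. method_of_reflections \<xi> f I x r \<Psi> \<Phi>"
proof -
  obtain \<psi> \<phi> where R: "reflection_terms a \<psi> \<phi>" and \<psi>M: "\<And>k i. i \<in> I \<Longrightarrow> \<psi> k i \<in> M" and \<phi>M: "\<And>k. \<phi> k \<in> M"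
    using reflection_terms_exist[OF a(1)] by blast
  have R0: "\<phi> 0 = a" and R1: "\<And>i. i \<in> I \<Longrightarrow> \<psi> 1 i = - Q i a"
    and R2: "\<And>k i. k \<ge> 2 \<Longrightarrow> i \<in> I \<Longrightarrow> \<exists>s. (\<psi> (k - 1) has_sum s) (I - {i}) \<and> \<psi> k i = - Q i s"
    and R3: "\<And>k. k \<ge> 1 \<Longrightarrow> (\<psi> k has_sum \<phi> k) I"
    using R unfolding reflection_terms_def by blast+
  let ?\<Psi> = "\<lambda>k i. rep \<xi> (\<psi> k i)" and ?\<Phi> = "\<lambda>k. rep \<xi> (\<phi> k)"
  note \<Phi>H = rep_H1[OF \<phi>M] and \<Phi>e = emb_rep[OF \<phi>M]
  note \<Psi>H = rep_H1[OF \<psi>M] and \<Psi>e = emb_rep[OF \<psi>M]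
  have isQ: "is_Q \<xi> (x i) (r i) s (\<lambda>y. - ?\<Psi> k i y)" if "i \<in> I" "s \<in> H1" "\<psi> k i = - Q i (emb \<xi> s)" for i k s
    unfolding is_Q_iff[OF that(1,2) H1_minus(1)[OF \<Psi>H[OF that(1)]]] H1_minus(2)[OF \<Psi>H[OF that(1)]]
      \<Psi>e[OF that(1)] using that(3) by simp
  have hs: "H1_has_sum (?\<Psi> k) J (rep \<xi> s)" if "J \<subseteq> I" "s \<in> M" "(\<psi> k has_sum s) J" for k J s
  proof -
    have "((\<lambda>i. emb \<xi> (?\<Psi> k i)) has_sum s) J \<longleftrightarrow> (\<psi> k has_sum s) J"
      using that(1) \<Psi>e by (intro has_sum_cong) auto
    then show ?thesis
      unfolding H1_has_sum_iff[OF \<xi>] emb_rep[OF that(2)] using that rep_H1[OF that(2)] \<Psi>H by auto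
  qed
  have "method_of_reflections \<xi> f I x r ?\<Psi> ?\<Phi>"
    unfolding method_of_reflections_def
  proof (intro conjI allI impI ballI)
    show "weak_solution \<xi> {} f (?\<Phi> 0)"
      unfolding weak_solution_iff R0 using rep_H1[OF a(1)] emb_rep[OF a(1)] a(2) by simp
    show "is_Q \<xi> (x i) (r i) (?\<Phi> 0) (\<lambda>y. - ?\<Psi> 1 i y)" if "i \<in> I" for i
      by (rule isQ[OF that \<Phi>H]) (simp only: R0 emb_rep[OF a(1)] R1[OF that])
    show "H1_has_sum (?\<Psi> k) I (?\<Phi> k)" if "1 \<le> k" for k
      by (rule hs[OF subset_refl \<phi>M R3[OF that]])
    show "\<exists>s. H1_has_sum (?\<Psi> (k - 1)) (I - {i}) s \<and> is_Q \<xi> (x i) (r i) s (\<lambda>y. - ?\<Psi> k i y)"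
      if k: "2 \<le> k" and i: "i \<in> I" for k i
    proof -
      obtain s where s: "(\<psi> (k - 1) has_sum s) (I - {i})" "\<psi> k i = - Q i s"
        using R2[OF k i] by blast
      have "\<psi> (k - 1) summable_on (I - {i})" using s(1) by (auto simp: summable_on_def)
      then have "(\<Sum>\<^sub>\<infinity>j\<in>I - {i}. \<psi> (k - 1) j) \<in> M"
        using M \<psi>M by (intro infsum_in_closed_subspace) auto
      then have sM: "s \<in> M" using infsumI[OF s(1)] by simp
      have "H1_has_sum (?\<Psi> (k - 1)) (I - {i}) (rep \<xi> s)" by (rule hs[OF _ sM s(1)]) blast
      moreover have "is_Q \<xi> (x i) (r i) (rep \<xi> s) (\<lambda>y. - ?\<Psi> k i y)"
        by (rule isQ[OF i rep_H1[OF sM]]) (simp only: emb_rep[OF sM] s(2))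
      ultimately show ?thesis by blast
    qed
  qed
  then show ?thesis by blast
qed

lemma dirichlet_solution_exists:
  assumes a: "a \<in> M" "\<And>v. v \<in> H1 \<Longrightarrow> f v = a \<bullet> emb \<xi> v"
  shows "\<exists>u. dirichlet_solution \<xi> (particles I x r) f u"
proof -
  have p: "proj W a \<in> W" "\<And>w. w \<in> W \<Longrightarrow> (a - proj W a) \<bullet> w = 0"
    using proj_in[OF subspace_W closed_W] proj_orth[OF subspace_W closed_W] by blast+
  then have pM: "proj W a \<in> M" by (simp add: W_def)
  show ?thesis
    by (rule exI[of _ "rep \<xi> (proj W a)"]) (simp add: dirichlet_solution_iff[OF a(2)] rep_H1[OF pM] emb_rep[OF pM] p)
qed

lemma dirichlet_solution_unique:
  assumes a: "\<And>v. v \<in> H1 \<Longrightarrow> f v = a \<bullet> emb \<xi> v"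
    and u: "dirichlet_solution \<xi> (particles I x r) f u" "dirichlet_solution \<xi> (particles I x r) f u'"
  shows "AE y in lborel. u y = u' y"
proof -
  have "proj W a = emb \<xi> u" "proj W a = emb \<xi> u'" "u \<in> H1" "u' \<in> H1"
    using u by (auto simp: dirichlet_solution_iff[OF a] intro!: proj_unique[OF subspace_W closed_W])
  then show ?thesis using emb_eq_iff[of \<xi> u u'] \<xi> by simp
qed

text \<open>One factor \<open>max 1 \<xi>\<close> comes from bounding the norm of the Riesz vector
  by the dual norm of \<open>f\<close>, the other from returning to the H1 norm.\<close>

lemma reflections_error:
  assumes f: "f \<in> H_minus1" and mor: "method_of_reflections \<xi> f I x r \<Psi> \<Phi>"
    and u: "dirichlet_solution \<xi> (particles I x r) f u"
  shows "H1_norm_on (- particles I x r) (\<lambda>y. (\<Sum>k\<le>N. \<Phi> k y) - u y)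
    \<le> (max 1 \<xi>)\<^sup>2 * (9 / 10) ^ N * H_minus1_norm f"
proof -
  obtain a where a: "a \<in> M" "\<And>v. v \<in> H1 \<Longrightarrow> f v = a \<bullet> emb \<xi> v"
    using H_minus1_riesz[OF f \<xi>] by blast
  note terms = method_of_reflections_terms[OF mor a]
  have uH: "u \<in> H1" and uW: "emb \<xi> u \<in> W" and orth: "\<And>w. w \<in> W \<Longrightarrow> (a - emb \<xi> u) \<bullet> w = 0"
    using u by (auto simp: dirichlet_solution_iff[OF a(2)])
  let ?m = "max 1 \<xi>"
  let ?w = "\<lambda>y. (\<Sum>k\<le>N. \<Phi> k y) - u y"
  have wH: "?w \<in> H1" using terms(1) uH by (intro H1_diff H1_sum)
  have w_emb: "emb \<xi> ?w = iterate a N - emb \<xi> u"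
  proof -
    have "emb \<xi> ?w = emb \<xi> (\<lambda>y. \<Sum>k\<le>N. \<Phi> k y) - emb \<xi> u"
      using terms(1) by (intro H1_diff(2) H1_sum(1) uH)
    also have "emb \<xi> (\<lambda>y. \<Sum>k\<le>N. \<Phi> k y) = (\<Sum>k\<le>N. emb \<xi> (\<Phi> k))"
      using terms(1) by (intro H1_sum(2))
    finally show ?thesis using reflection_terms_partial_sum[OF a(1) terms(3), of N] by simp
  qed
  have na: "norm a \<le> ?m * H_minus1_norm f"
  proof -
    \<comment> \<open>Energy estimate: \<open>\<Phi> 0\<close> is embedded as \<open>a\<close>, so
      it is used as its own test function.\<close>
    have "norm a * norm a = f (\<Phi> 0)"
      using a(2)[OF terms(1)] terms(2) by (simp add: dot_square_norm power2_eq_square)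
    also have "\<dots> \<le> H_minus1_norm f * H1_norm (\<Phi> 0)"
      using H_minus1_norm_bound[OF f terms(1)[of 0]] by linarith
    also have "\<dots> \<le> H_minus1_norm f * (?m * norm a)"
    proof (rule mult_left_mono)
      show "H1_norm (\<Phi> 0) \<le> ?m * norm a"
        using norm_emb_le[OF terms(1)[of 0] \<xi> zero_less_one] H1_norm_eq[OF terms(1)[of 0]] terms(2) by simp
      show "0 \<le> H_minus1_norm f" by (rule H_minus1_norm_nonneg[OF f])
    qed
    finally have "norm a * norm a \<le> (?m * H_minus1_norm f) * norm a" by (simp add: mult_ac)
    moreover have "0 \<le> ?m * H_minus1_norm f"
      using H_minus1_norm_nonneg[OF f] by simp
    ultimately show ?thesis by (cases "a = 0") (auto dest: mult_right_le_imp_le)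
  qed
  have "norm (iterate a N - emb \<xi> u) \<le> (9 / 10) ^ N * norm (a - emb \<xi> u)"
  proof (rule power2_le_imp_le)
    have "(norm (iterate a N - emb \<xi> u))\<^sup>2 \<le> (2 - 2 / (25 / 16)) ^ N * (norm (a - emb \<xi> u))\<^sup>2"
      by (rule iterate_converges[OF a(1) uW orth])
    \<comment> \<open>\<open>2 - 2 / (25/16)\<close> is \<open>18/25 = 0.72\<close>, rounded up to
      the square \<open>0.81\<close> so that the rate after taking roots is rational.\<close>
    also have "\<dots> \<le> ((9 / 10) ^ 2) ^ N * (norm (a - emb \<xi> u))\<^sup>2"
      by (intro mult_right_mono power_mono) (auto simp: power2_eq_square)
    also have "\<dots> = ((9 / 10) ^ N * norm (a - emb \<xi> u))\<^sup>2"
      by (simp add: power_mult_distrib flip: power_mult) (simp add: mult.commute)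
    finally show "(norm (iterate a N - emb \<xi> u))\<^sup>2 \<le> ((9 / 10) ^ N * norm (a - emb \<xi> u))\<^sup>2" .
  qed simp
  also have "\<dots> \<le> (9 / 10) ^ N * norm a"
  proof (rule mult_left_mono)
    \<comment> \<open>The initial error is the residual of a projection, so it is no longer than
      \<open>a\<close>.\<close>
    have "proj W a = emb \<xi> u" by (rule proj_unique[OF subspace_W closed_W uW orth])
    then show "norm (a - emb \<xi> u) \<le> norm a"
      using norm_diff_proj_le[OF subspace_W closed_W, of a a] subspace_0[OF subspace_W] by simp
  qed simp
  also have "\<dots> \<le> (9 / 10) ^ N * (?m * H_minus1_norm f)"
    by (intro mult_left_mono na) simp
  finally have "norm (emb \<xi> ?w) \<le> (9 / 10) ^ N * (?m * H_minus1_norm f)"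
    unfolding w_emb .
  then have "?m * norm (emb \<xi> ?w) \<le> ?m * ((9 / 10) ^ N * (?m * H_minus1_norm f))"
    by (rule mult_left_mono) simp
  moreover have "H1_norm_on (- particles I x r) ?w \<le> ?m * norm (emb \<xi> ?w)"
  proof -
    have "H1_norm_on (- particles I x r) ?w \<le> H1_norm ?w"
      using particles_borel by (intro H1_norm_on_le wH) auto
    also have "\<dots> \<le> ?m * norm (emb \<xi> ?w)"
      using norm_emb_le[OF wH \<xi> zero_less_one] H1_norm_eq[OF wH] by simp
    finally show ?thesis .
  qed
  ultimately show ?thesis by (simp add: power2_eq_square mult_ac)
qed

end

text \<open>The first bound makes the lower-order term of the Hardy inequality at most \<open>1 / \<xi>\<^sup>2\<close>; the second one
  yields \<open>(2 exp 16 r\<^sub>i)\<^sup>3 \<le> d\<^sub>i\<^sup>3\<close> because \<open>r\<^sub>i\<^sup>3 \<le> (\<alpha> \<xi>)\<^sup>2 r\<^sub>i \<le> \<alpha>\<^sup>2 \<xi>\<^sup>2 \<mu>\<^sub>0 d\<^sub>i\<^sup>3\<close>.\<close>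

definition particle_const :: "real \<Rightarrow> real" where
  "particle_const \<alpha> = min (1 / (8 * exp 16)) (1 / (\<alpha>\<^sup>2 * (2 * exp 16) ^ 3))"

lemma admissible_separated:
  assumes adm: "admissible \<alpha> \<kappa> (particle_const \<alpha>) \<xi> I x r" and pos: "0 < \<alpha>" "1 < \<kappa>" "0 < \<xi>"
  shows "\<exists>R. separated_particles \<xi> I x r R"
proof -
  let ?A = "exp 16 :: real"
  have r0: "0 < r i" and rd: "ennreal (\<kappa> * r i) < nearest_dist I x i / 2" and ra: "r i \<le> \<alpha> * \<xi>" if "i \<in> I" for i
    using adm that by (auto simp: admissible_def)
  have C0: "0 < particle_const \<alpha>" using pos by (simp add: particle_const_def)
  have C1: "particle_const \<alpha> * (8 * ?A) \<le> 1"
  proof -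
    have "particle_const \<alpha> \<le> 1 / (8 * ?A)" by (simp add: particle_const_def)
    then show ?thesis by (simp add: field_simps)
  qed
  have C2: "particle_const \<alpha> * (\<alpha>\<^sup>2 * (2 * ?A) ^ 3) \<le> 1"
  proof -
    have "particle_const \<alpha> \<le> 1 / (\<alpha>\<^sup>2 * (2 * ?A) ^ 3)" by (simp add: particle_const_def)
    moreover have "0 < \<alpha>\<^sup>2 * (2 * ?A) ^ 3" using pos by simp
    ultimately show ?thesis by (simp only: pos_le_divide_eq)
  qed
  have fin: "r i * ?A \<le> enn2real (nearest_dist I x i) / 2 \<and> r i * ?A / (enn2real (nearest_dist I x i) / 2) ^ 3 \<le> 1 / \<xi>\<^sup>2"
    if i: "i \<in> I" and nt: "nearest_dist I x i \<noteq> top" for i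
  proof -
    obtain d where d: "nearest_dist I x i = ennreal d" "0 \<le> d" using nt by (cases "nearest_dist I x i") auto
    \<comment> \<open>A priori centres may coincide; the separation
      \<open>\<kappa> r i < d / 2\<close> forces \<open>d > 0\<close>.\<close>
    have d0: "0 < d"
    proof (rule ccontr)
      assume "\<not> 0 < d"
      then show False using rd[OF i] d by simp
    qed
    have "ennreal (r i) / ennreal d ^ 3 \<le> mu0 I x r"
      unfolding mu0_def d(1)[symmetric] by (rule SUP_upper[OF i])
    also have "\<dots> < ennreal (particle_const \<alpha> * (1 / \<xi>\<^sup>2))" using adm by (simp add: admissible_def)
    finally have "ennreal (r i / d ^ 3) < ennreal (particle_const \<alpha> * (1 / \<xi>\<^sup>2))"
      using r0[OF i] d0 by (simp add: ennreal_power divide_ennreal)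
    then have "r i / d ^ 3 < particle_const \<alpha> * (1 / \<xi>\<^sup>2)"
      using r0[OF i] d0 by (subst (asm) ennreal_less_iff) auto
    then have mu: "r i * \<xi>\<^sup>2 \<le> particle_const \<alpha> * d ^ 3" using d0 pos by (simp add: field_simps)
    \<comment> \<open>The 8 in \<open>particle_const\<close> pays for halving the distance before
      cubing.\<close>
    have "r i * ?A / (d / 2) ^ 3 \<le> 1 / \<xi>\<^sup>2"
    proof -
      have "r i * \<xi>\<^sup>2 * (8 * ?A) \<le> particle_const \<alpha> * d ^ 3 * (8 * ?A)" by (intro mult_right_mono mu) simp
      also have "\<dots> = (particle_const \<alpha> * (8 * ?A)) * d ^ 3" by (simp add: mult_ac)
      also have "\<dots> \<le> 1 * d ^ 3" using d0 by (intro mult_right_mono C1) simp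
      finally have "r i * \<xi>\<^sup>2 * (8 * ?A) \<le> d ^ 3" by simp
      then show ?thesis using d0 pos by (simp add: power_divide field_simps)
    qed
    moreover have "r i * ?A \<le> d / 2"
    proof -
      have "(r i * (2 * ?A)) ^ 3 \<le> d ^ 3"
      proof -
        have "(r i) ^ 3 \<le> r i * (\<alpha> * \<xi>)\<^sup>2"
        proof -
          have "(r i)\<^sup>2 \<le> (\<alpha> * \<xi>)\<^sup>2" using r0[OF i] ra[OF i] by (intro power_mono) auto
          then have "r i * (r i)\<^sup>2 \<le> r i * (\<alpha> * \<xi>)\<^sup>2" using r0[OF i] by (intro mult_left_mono) auto
          then show ?thesis by (simp add: power3_eq_cube power2_eq_square mult.assoc)
        qed
        also have "\<dots> = r i * \<xi>\<^sup>2 * \<alpha>\<^sup>2" by (simp add: power_mult_distrib)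
        also have "\<dots> \<le> particle_const \<alpha> * d ^ 3 * \<alpha>\<^sup>2" by (intro mult_right_mono mu) simp
        finally have "(r i) ^ 3 * (2 * ?A) ^ 3 \<le> particle_const \<alpha> * d ^ 3 * \<alpha>\<^sup>2 * (2 * ?A) ^ 3"
          by (intro mult_right_mono) auto
        also have "\<dots> = (particle_const \<alpha> * (\<alpha>\<^sup>2 * (2 * ?A) ^ 3)) * d ^ 3" by (simp add: mult_ac)
        also have "\<dots> \<le> 1 * d ^ 3" using d0 by (intro mult_right_mono C2) simp
        finally show ?thesis by (simp add: power_mult_distrib)
      qed
      then have "r i * (2 * ?A) \<le> d" using d0 by (simp add: power_mono_iff r0[OF i] less_imp_le)
      then show ?thesis by simp
    qed
    ultimately show ?thesis using d by simp
  qed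
  \<comment> \<open>An infinite nearest distance means that there is only one particle.\<close>
  have inf: "\<exists>\<rho>. r i * ?A \<le> \<rho> \<and> r i * ?A / \<rho> ^ 3 \<le> 1 / \<xi>\<^sup>2" if i: "i \<in> I" for i
  proof -
    \<comment> \<open>Any sufficiently large radius works. The entry 1 gives
      \<open>\<rho> \<le> \<rho>^3\<close>, so a bound linear in \<open>\<rho>\<close>
      suffices.\<close>
    define \<rho> where "\<rho> = max 1 (max (r i * ?A) (r i * ?A * \<xi>\<^sup>2))"
    have \<rho>: "1 \<le> \<rho>" "r i * ?A \<le> \<rho>" "r i * ?A * \<xi>\<^sup>2 \<le> \<rho>" by (simp_all add: \<rho>_def)
    have "\<rho> ^ 1 \<le> \<rho> ^ 3" using \<rho>(1) by (intro power_increasing) auto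
    then have "r i * ?A * \<xi>\<^sup>2 \<le> \<rho> ^ 3" using \<rho>(3) by simp
    then have "r i * ?A / \<rho> ^ 3 \<le> 1 / \<xi>\<^sup>2" using \<rho>(1) pos by (simp add: field_simps)
    then show ?thesis using \<rho>(2) by blast
  qed
  then obtain \<rho> where \<rho>: "\<And>i. i \<in> I \<Longrightarrow> r i * ?A \<le> \<rho> i" "\<And>i. i \<in> I \<Longrightarrow> r i * ?A / \<rho> i ^ 3 \<le> 1 / \<xi>\<^sup>2" by metis
  define R where "R = (\<lambda>i. if nearest_dist I x i = top then \<rho> i else enn2real (nearest_dist I x i) / 2)"
  have "separated_particles \<xi> I x r R"
  proof
    show "0 < \<xi>" by fact
    show "0 < r i" if "i \<in> I" for i by (rule r0[OF that])
    show "r i * exp 16 \<le> R i" "r i * exp 16 / R i ^ 3 \<le> 1 / \<xi>\<^sup>2" if "i \<in> I" for i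
      using \<rho>[OF that] fin[OF that] by (auto simp: R_def)
    show "ball (x i) (R i) \<inter> ball (x j) (R j) = {}" if i: "i \<in> I" and j: "j \<in> I" and ij: "i \<noteq> j" for i j
    proof -
      \<comment> \<open>The presence of \<open>j\<close> makes the nearest distance of
        \<open>i\<close> finite, so \<open>R i\<close> is the half distance. Two such radii add up
        to at most the distance of the centres.\<close>
      have half: "R i \<le> dist (x i) (x j) / 2" if i: "i \<in> I" and j: "j \<in> I" and ij: "i \<noteq> j" for i j
      proof -
        have le: "nearest_dist I x i \<le> ennreal (dist (x i) (x j))"
          unfolding nearest_dist_def using j ij by (intro INF_lower) auto
        then have nt: "nearest_dist I x i \<noteq> top" by (auto simp: top_unique)
        have "enn2real (nearest_dist I x i) \<le> enn2real (ennreal (dist (x i) (x j)))"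
          by (rule enn2real_mono[OF le]) simp
        then show ?thesis using nt by (simp add: R_def)
      qed
      show ?thesis
      proof (rule ccontr)
        assume "ball (x i) (R i) \<inter> ball (x j) (R j) \<noteq> {}"
        then obtain y where "dist (x i) y < R i" "dist (x j) y < R j" by auto
        moreover have "dist (x i) (x j) \<le> dist (x i) y + dist (x j) y"
          by (metis dist_triangle2)
        ultimately show False
          using half[OF i j ij] half[OF j i ij[symmetric]] by (simp add: dist_commute[of "x j" "x i"])
      qed
    qed
  qed
  then show ?thesis by blast
qed

theorem theorem1p1:
  shows "\<exists>(C0 :: real \<Rightarrow> real \<Rightarrow> real) (\<epsilon> :: real \<Rightarrow> real) (C :: real \<Rightarrow> real).
    \<forall>\<alpha> > 0. \<forall>\<kappa> > 1.
      0 < C0 \<alpha> \<kappa> \<and> 0 \<le> \<epsilon> \<kappa> \<and> \<epsilon> \<kappa> < 1 \<and>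
      (\<forall>\<xi> > 0.
        (\<forall>I x r. admissible \<alpha> \<kappa> (C0 \<alpha> \<kappa>) \<xi> I x r \<longrightarrow>
          (\<forall>f \<in> H_minus1.
            (\<exists>\<Psi> \<Phi>. method_of_reflections \<xi> f I x r \<Psi> \<Phi>) \<and>
            (\<exists>u. dirichlet_solution \<xi> (particles I x r) f u) \<and>
            (\<forall>u u'. dirichlet_solution \<xi> (particles I x r) f u \<longrightarrow>
                    dirichlet_solution \<xi> (particles I x r) f u' \<longrightarrow>
                    (AE y in lborel. u y = u' y)) \<and>
            (\<forall>\<Psi> \<Phi> u. method_of_reflections \<xi> f I x r \<Psi> \<Phi> \<longrightarrow>
                      dirichlet_solution \<xi> (particles I x r) f u \<longrightarrow>
                (\<lambda>N. H1_norm_on (- particles I x r) (\<lambda>y. (\<Sum>k\<le>N. \<Phi> k y) - u y)) \<longlonglongrightarrow> 0 \<and>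
                (\<forall>N. H1_norm_on (- particles I x r) (\<lambda>y. (\<Sum>k\<le>N. \<Phi> k y) - u y)
                       \<le> C \<xi> * \<epsilon> \<kappa> ^ N * H_minus1_norm f)))) \<and>
        (\<forall>f \<in> H_minus1. \<forall>\<delta> > 0. \<exists>N0. \<forall>N \<ge> N0.
          \<forall>I x r \<Psi> \<Phi> u. admissible \<alpha> \<kappa> (C0 \<alpha> \<kappa>) \<xi> I x r \<longrightarrow>
            method_of_reflections \<xi> f I x r \<Psi> \<Phi> \<longrightarrow>
            dirichlet_solution \<xi> (particles I x r) f u \<longrightarrow>
            H1_norm_on (- particles I x r) (\<lambda>y. (\<Sum>k\<le>N. \<Phi> k y) - u y) < \<delta>))"
proof -
  have sep: "\<exists>R. separated_particles \<xi> I x r R"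
    if "\<alpha> > 0" "\<kappa> > 1" "\<xi> > 0" "admissible \<alpha> \<kappa> (particle_const \<alpha>) \<xi> I x r" for \<alpha> \<kappa> \<xi> I x r
    using admissible_separated that by blast
  have lim: "(\<lambda>N. (max 1 \<xi>)\<^sup>2 * (9 / 10) ^ N * c) \<longlonglongrightarrow> 0" for \<xi> c :: real
    by (intro tendsto_mult_left_zero tendsto_mult_right_zero LIMSEQ_realpow_zero) auto
  have nonneg: "0 \<le> H1_norm_on S w" for S w
    unfolding H1_norm_on_def set_lebesgue_integral_def
    by (intro real_sqrt_ge_zero integral_nonneg_AE AE_I2) (simp add: indicator_def)
  show ?thesis
  \<comment> \<open>The rate is the rounded root of the contraction factor, and the square of
    \<open>max 1 \<xi>\<close> collects the two norm comparisons in
    \<open>reflections_error\<close>.\<close>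
  proof (rule exI[of _ "\<lambda>\<alpha> \<kappa>. particle_const \<alpha>"], rule exI[of _ "\<lambda>\<kappa>. 9 / 10"], rule exI[of _ "\<lambda>\<xi>. (max 1 \<xi>)\<^sup>2"],
      intro allI impI conjI ballI)
    fix \<alpha> \<kappa> :: real assume \<alpha>: "0 < \<alpha>" and \<kappa>: "1 < \<kappa>"
    show "0 < particle_const \<alpha>" using \<alpha> by (simp add: particle_const_def)
    show "0 \<le> (9 / 10 :: real)" "9 / 10 < (1 :: real)" by simp_all
    fix \<xi> :: real assume \<xi>: "0 < \<xi>"
    {
      fix I x r f assume adm: "admissible \<alpha> \<kappa> (particle_const \<alpha>) \<xi> I x r" and f: "f \<in> H_minus1"
      obtain R where "separated_particles \<xi> I x r R" using sep[OF \<alpha> \<kappa> \<xi> adm] by blast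
      then interpret separated_particles \<xi> I x r R .
      obtain a where a: "a \<in> emb \<xi> ` H1" "\<And>v. v \<in> H1 \<Longrightarrow> f v = a \<bullet> emb \<xi> v"
        using H_minus1_riesz[OF f \<xi>] by blast
      show "\<exists>\<Psi> \<Phi>. method_of_reflections \<xi> f I x r \<Psi> \<Phi>" by (rule method_of_reflections_exists[OF a])
      show "\<exists>u. dirichlet_solution \<xi> (particles I x r) f u" by (rule dirichlet_solution_exists[OF a])
      show "AE y in lborel. u y = u' y"
        if "dirichlet_solution \<xi> (particles I x r) f u" "dirichlet_solution \<xi> (particles I x r) f u'" for u u'
        by (rule dirichlet_solution_unique[OF a(2) that])
      fix \<Psi> \<Phi> u assume mor: "method_of_reflections \<xi> f I x r \<Psi> \<Phi>"
        and u: "dirichlet_solution \<xi> (particles I x r) f u"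
      show err: "H1_norm_on (- particles I x r) (\<lambda>y. (\<Sum>k\<le>N. \<Phi> k y) - u y)
          \<le> (max 1 \<xi>)\<^sup>2 * (9 / 10) ^ N * H_minus1_norm f" for N
        by (rule reflections_error[OF f mor u])
      show "(\<lambda>N. H1_norm_on (- particles I x r) (\<lambda>y. (\<Sum>k\<le>N. \<Phi> k y) - u y)) \<longlonglongrightarrow> 0"
        by (rule tendsto_sandwich[OF _ _ tendsto_const lim[of \<xi> "H_minus1_norm f"]])
          (simp_all add: nonneg err)
    }
    fix f :: "(R3 \<Rightarrow> real) \<Rightarrow> real" and \<delta> :: real assume f: "f \<in> H_minus1" and \<delta>: "0 < \<delta>"
    have "\<forall>\<^sub>F N in sequentially. (max 1 \<xi>)\<^sup>2 * (9 / 10) ^ N * H_minus1_norm f < \<delta>"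
      by (rule order_tendstoD(2)[OF lim \<delta>])
    \<comment> \<open>\<open>N0\<close> is chosen from the error bound alone, which involves only
      \<open>\<xi>\<close> and \<open>f\<close>; hence it serves all configurations at once.\<close>
    then obtain N0 where N0: "\<And>N. N \<ge> N0 \<Longrightarrow> (max 1 \<xi>)\<^sup>2 * (9 / 10) ^ N * H_minus1_norm f < \<delta>"
      by (auto simp: eventually_sequentially)
    show "\<exists>N0. \<forall>N\<ge>N0. \<forall>I x r \<Psi> \<Phi> u. admissible \<alpha> \<kappa> (particle_const \<alpha>) \<xi> I x r \<longrightarrow>
        method_of_reflections \<xi> f I x r \<Psi> \<Phi> \<longrightarrow> dirichlet_solution \<xi> (particles I x r) f u \<longrightarrow>
        H1_norm_on (- particles I x r) (\<lambda>y. (\<Sum>k\<le>N. \<Phi> k y) - u y) < \<delta>"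
    proof (intro exI[of _ N0] allI impI)
      fix N I x r \<Psi> \<Phi> u
      assume N: "N0 \<le> N" and adm: "admissible \<alpha> \<kappa> (particle_const \<alpha>) \<xi> I x r"
        and mor: "method_of_reflections \<xi> f I x r \<Psi> \<Phi>" and u: "dirichlet_solution \<xi> (particles I x r) f u"
      obtain R where "separated_particles \<xi> I x r R" using sep[OF \<alpha> \<kappa> \<xi> adm] by blast
      from separated_particles.reflections_error[OF this f mor u, of N] N0[OF N]
      show "H1_norm_on (- particles I x r) (\<lambda>y. (\<Sum>k\<le>N. \<Phi> k y) - u y) < \<delta>" by linarith
    qed
  qed
qed

end
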